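(* The coloring complex $\Delta_G$ of any finite graph $G$ has a convex ear decomposition. Moreover, let $A$ be an essential, central, simplicial hyperplane arrangement in $\mathbb{R}^d$ and let $B$ be any subarrangement of $A$; then the subcomplex of the simplicial decomposition of the unit sphere $S^{d-1}$ induced by $A$, consisting of those cells contained in the union of the hyperplanes of $B$, has a convex ear decomposition.
   Context: The coloring complex $\Delta_G$ of a graph $G$ on vertex set $[n]$ is the simplicial complex whose $(r-1)$-dimensional faces are ordered lists $T_1|\cdots|T_r$ of nonempty pairwise disjoint subsets of $[n]$ with $\bigcup_i T_i\ne[n]$ and at least one $T_i$ containing both endpoints of an edge of $G$ (faces ordered by refinement; equivalently chains $T_1\subset T_1\cup T_2\subset\cdots$ in the Boolean lattice). An arrangement is central if every hyperplane contains the origin, essential if the intersection of all its hyperplanes is a single point, and simplicial if the cells it induces on the unit sphere are simplices. A convex ear decomposition of a $(d-1)$-dimensional simplicial complex $\Delta$ is an ordered sequence $\Delta_1,\dots,\Delta_m$ of pure $(d-1)$-dimensional subcomplexes such that: (1) $\Delta_1$ is the boundary complex of a simplicial $d$-polytope, and for each $j\ge2$, $\Delta_j$ is a $(d-1)$-ball which is a proper subcomplex of the boundary complex of a simplicial $d$-polytope; (2) for $j\ge 2$, $\Delta_j\cap\bigcup_{i<j}\Delta_i=\partial\Delta_j$; (3) $\bigcup_j\Delta_j=\Delta$.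
   Formalization: In the coloring complex the complement of T_1∪…∪T_r also counts as a block that may contain an edge; as literally worded the faces are not closed under taking subfaces, and for n=3 with the single edge 12 the claim fails (a single point). *)

theory Defs
  imports "HOL-Analysis.Analysis"
begin

section \<open>Abstract simplicial complexes\<close>

text \<open>
  The library constant \<open>simplicial_complex\<close> is about rectilinear complexes in a Euclidean space,
  so abstract complexes are introduced here.  Every complex contains the empty face, of
  dimension -1; the smallest complex is \<open>{{}}\<close>.
\<close>

definition abstract_complex :: "'v set set \<Rightarrow> bool" where
  "abstract_complex K \<longleftrightarrow>
     finite K \<and> {} \<in> K \<and> (\<forall>F\<in>K. finite F) \<and> (\<forall>F\<in>K. \<forall>G. G \<subseteq> F \<longrightarrow> G \<in> K)"

definition face_dim :: "'v set \<Rightarrow> int" where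
  "face_dim F = int (card F) - 1"

definition complex_dim :: "'v set set \<Rightarrow> int" where
  "complex_dim K = Max (face_dim ` K)"

definition pure_complex :: "'v set set \<Rightarrow> bool" where
  "pure_complex K \<longleftrightarrow>
     abstract_complex K \<and> (\<forall>F\<in>K. \<exists>G\<in>K. F \<subseteq> G \<and> face_dim G = complex_dim K)"

definition complex_iso :: "'v set set \<Rightarrow> 'w set set \<Rightarrow> bool" where
  "complex_iso K L \<longleftrightarrow> (\<exists>f. inj_on f (\<Union>K) \<and> L = (\<lambda>F. f ` F) ` K)"

text \<open>Points of the realization are given by their barycentric coordinates.\<close>

definition geometric_realization :: "'v set set \<Rightarrow> ('v \<Rightarrow> real) topology" where
  "geometric_realization K =
     subtopology (powertop_real UNIV)
       {x. (\<forall>v. 0 \<le> x v) \<and> {v. x v \<noteq> 0} \<in> K \<and> (\<Sum>v | x v \<noteq> 0. x v) = 1}"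

definition nball :: "nat \<Rightarrow> (nat \<Rightarrow> real) topology" where
  "nball n = subtopology (Euclidean_space n) {x. (\<Sum>i<n. x i ^ 2) \<le> 1}"

definition simplicial_ball :: "'v set set \<Rightarrow> bool" where
  "simplicial_ball K \<longleftrightarrow>
     (\<exists>n. complex_dim K = int n \<and> geometric_realization K homeomorphic_space nball n)"

text \<open>
  The boundary of a triangulated ball is generated by the codimension-one faces lying in exactly
  one facet; for a single vertex this gives \<open>{{}}\<close>.
\<close>

definition ball_boundary :: "'v set set \<Rightarrow> 'v set set" where
  "ball_boundary K =
     {F. \<exists>R\<in>K. F \<subseteq> R \<and> face_dim R = complex_dim K - 1 \<and> (\<exists>!G. G \<in> K \<and> R \<subset> G)}"


section \<open>Simplicial polytopes and convex ear decompositions\<close>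

definition simplicial_polytope :: "nat \<Rightarrow> 'b::euclidean_space set \<Rightarrow> bool" where
  "simplicial_polytope d P \<longleftrightarrow>
     polytope P \<and> aff_dim P = int d \<and> (\<forall>F. F face_of P \<and> F \<noteq> P \<longrightarrow> (\<exists>k. k simplex F))"

definition boundary_complex :: "'b::euclidean_space set \<Rightarrow> 'b set set" where
  "boundary_complex P = {{v. v extreme_point_of F} | F. F face_of P \<and> F \<noteq> P}"

text \<open>
  A type argument names the ambient space \<open>'b\<close> of the polytopes.  It has no influence as long as
  \<open>d \<le> DIM('b)\<close>, because the dimension of a polytope is that of its affine hull; if
  \<open>DIM('b) < d\<close> there is no \<open>d\<close>-polytope in \<open>'b\<close> and hence no decomposition.
\<close>

definition convex_ear_decomposition ::
    "'b::euclidean_space itself \<Rightarrow> nat \<Rightarrow> 'v set set \<Rightarrow> 'v set set list \<Rightarrow> bool" where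
  "convex_ear_decomposition T d K Ks \<longleftrightarrow>
     Ks \<noteq> [] \<and>
     (\<forall>D\<in>set Ks. D \<subseteq> K \<and> pure_complex D \<and> complex_dim D = int d - 1) \<and>
     (\<exists>P::'b set. simplicial_polytope d P \<and> complex_iso (Ks ! 0) (boundary_complex P)) \<and>
     (\<forall>j. 1 \<le> j \<and> j < length Ks \<longrightarrow>
        simplicial_ball (Ks ! j) \<and>
        (\<exists>(P::'b set) L. simplicial_polytope d P \<and> L \<subset> boundary_complex P \<and>
           complex_iso (Ks ! j) L) \<and>
        Ks ! j \<inter> (\<Union>i<j. Ks ! i) = ball_boundary (Ks ! j)) \<and>
     \<Union>(set Ks) = K"

definition has_convex_ear_decomposition ::
    "'b::euclidean_space itself \<Rightarrow> 'v set set \<Rightarrow> bool" where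
  "has_convex_ear_decomposition T K \<longleftrightarrow>
     abstract_complex K \<and>
     (\<exists>d Ks. complex_dim K = int d - 1 \<and> convex_ear_decomposition T d K Ks)"


section \<open>The coloring complex\<close>

definition simple_graph :: "'v set \<Rightarrow> 'v set set \<Rightarrow> bool" where
  "simple_graph V E \<longleftrightarrow> finite V \<and> (\<forall>e\<in>E. e \<subseteq> V \<and> card e = 2)"

definition ordered_blocks :: "'v set \<Rightarrow> 'v set list \<Rightarrow> bool" where
  "ordered_blocks V Ts \<longleftrightarrow>
     (\<forall>T\<in>set Ts. T \<noteq> {} \<and> T \<subseteq> V) \<and> sorted_wrt disjnt Ts \<and> \<Union>(set Ts) \<noteq> V"

definition chain_of_blocks :: "'v set list \<Rightarrow> 'v set set" where
  "chain_of_blocks Ts = {\<Union>(set (take k Ts)) | k. 1 \<le> k \<and> k \<le> length Ts}"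

text \<open>
  A list \<open>T\<^sub>1|\<dots>|T\<^sub>r\<close> is identified with the chain of its partial unions, so the vertices are proper
  nonempty subsets of \<open>V\<close>.  The list stands for the ordered set partition of \<open>V\<close> that ends with
  the block \<open>V - \<Union>T\<^sub>i\<close>, and this last block counts when looking for an edge; otherwise the
  family would not be closed under deleting the top element of a chain.  The empty face is
  inserted separately for the edgeless graphs.
\<close>

definition coloring_complex :: "'v set \<Rightarrow> 'v set set \<Rightarrow> 'v set set set" where
  "coloring_complex V E =
     insert {} {chain_of_blocks Ts | Ts. ordered_blocks V Ts \<and>
       (\<exists>T \<in> insert (V - \<Union>(set Ts)) (set Ts). \<exists>e\<in>E. e \<subseteq> T)}"


section \<open>Hyperplane arrangements\<close>

definition is_hyperplane :: "'a::euclidean_space set \<Rightarrow> bool" where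
  "is_hyperplane H \<longleftrightarrow> (\<exists>a b. a \<noteq> 0 \<and> H = {x. a \<bullet> x = b})"

definition arrangement :: "'a::euclidean_space set set \<Rightarrow> bool" where
  "arrangement A \<longleftrightarrow> finite A \<and> (\<forall>H\<in>A. is_hyperplane H)"

definition central :: "'a::euclidean_space set set \<Rightarrow> bool" where
  "central A \<longleftrightarrow> (\<forall>H\<in>A. 0 \<in> H)"

definition essential :: "'a::euclidean_space set set \<Rightarrow> bool" where
  "essential A \<longleftrightarrow> (\<exists>p. \<Inter>A = {p})"

definition same_side :: "'a::euclidean_space set \<Rightarrow> 'a \<Rightarrow> 'a \<Rightarrow> bool" where
  "same_side H x y \<longleftrightarrow>
     (\<forall>a b. H = {z. a \<bullet> z = b} \<longrightarrow> sgn (a \<bullet> x - b) = sgn (a \<bullet> y - b))"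

definition arrangement_cells :: "'a::euclidean_space set set \<Rightarrow> 'a set set" where
  "arrangement_cells A = range (\<lambda>x. {y. \<forall>H\<in>A. same_side H x y})"

text \<open>
  Closed cells on the unit sphere.  For a central essential arrangement the cell \<open>{0}\<close>
  contributes the empty cell.
\<close>

definition sphere_cells :: "'a::euclidean_space set set \<Rightarrow> 'a set set" where
  "sphere_cells A = {closure C \<inter> sphere 0 1 | C. C \<in> arrangement_cells A}"

definition spherical_simplex :: "'a::euclidean_space set \<Rightarrow> 'a set \<Rightarrow> bool" where
  "spherical_simplex W S \<longleftrightarrow>
     W \<subseteq> sphere 0 1 \<and> independent W \<and> S = (convex_cone hull W) \<inter> sphere 0 1"

definition simplicial_arrangement :: "'a::euclidean_space set set \<Rightarrow> bool" where
  "simplicial_arrangement A \<longleftrightarrow> (\<forall>S\<in>sphere_cells A. \<exists>W. spherical_simplex W S)"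

text \<open>Each cell is recorded by its vertex set \<open>W\<close>, which the cell determines.\<close>

definition induced_subcomplex ::
    "'a::euclidean_space set set \<Rightarrow> 'a set set \<Rightarrow> 'a set set" where
  "induced_subcomplex A B = {W. \<exists>S\<in>sphere_cells A. S \<subseteq> \<Union>B \<and> spherical_simplex W S}"

end

theory Submission
  imports Defs "HOL-Homology.Invariance_of_Domain"
begin

text \<open>
  List the hyperplanes of \<open>B\<close> as \<open>H\<^sub>1, \<dots>, H\<^sub>k\<close>.  The cells in \<open>H\<^sub>1\<close> triangulate a sphere, which is the
  boundary of a simplicial polytope: the unit ball of the norm \<open>\<Sum>\<bar>a \<bullet> x\<bar>\<close>, where \<open>a\<close> runs over the
  normals of \<open>A\<close> (the polar of a zonotope).  For \<open>j > 1\<close> the hyperplanes \<open>H\<^sub>i\<close>, \<open>i < j\<close>, cut \<open>H\<^sub>j\<close> into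
  chambers.  Each of them is a proper full-dimensional subcomplex of the sphere of \<open>H\<^sub>j\<close>, a ball by
  stereographic projection, and it meets what has been built before exactly in its boundary.  So the
  chambers can be attached one after the other as ears.  The coloring complex is the part of the
  essentialized braid arrangement lying in the hyperplanes \<open>x\<^sub>u = x\<^sub>v\<close> with \<open>{u, v}\<close> an edge.
\<close>

section \<open>Cones and generic points\<close>

text \<open>The delicate point is that an ear must meet its predecessors in its combinatorial
  boundary, generated by ridges lying in a single facet, while the geometry only shows that it meets
  them in the faces lying on walls. \<open>ball_boundary_chamber\<close> identifies the two; its
  hard half is that every face on a wall extends to a ridge on a wall. Within one hyperplane the
  chambers may come in any order, since two of them share only faces on walls. Everything is done
  for a fan given by a subspace \<open>E\<close>, a finite set \<open>N\<close> of normals and a set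
  \<open>Z\<close> with at most one point on each ray. Passing to a hyperplane shrinks
  \<open>E\<close> and keeps \<open>N\<close> and \<open>Z\<close>, so the cells and vertex labels
  inside \<open>H\<^sub>j\<close> are literally those of the whole fan. Both claims fit this
  setting: \<open>Z\<close> is the unit sphere for an arrangement, and the set of projected
  indicator vectors for the braid arrangement, whose vertices are finally renamed to subsets of
  \<open>V\<close>. The norm works because on each cell it agrees with a linear functional that is
  strictly smaller than the norm off that cell.\<close>

lemma convex_cone_hull_finite:
  fixes W :: "'a::real_vector set"
  assumes "finite W"
  shows "convex_cone hull W = {\<Sum>w\<in>W. c w *\<^sub>R w | c. \<forall>w\<in>W. 0 \<le> c w}" (is "_ = ?C")
proof
  show "convex_cone hull W \<subseteq> ?C"
  proof (rule hull_minimal)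
    show "W \<subseteq> ?C"
    proof
      fix v assume "v \<in> W"
      then have "v = (\<Sum>w\<in>W. (if w = v then 1 else 0) *\<^sub>R w)"
        using assms by (simp add: if_distrib[of "\<lambda>r. r *\<^sub>R _"] sum.delta cong: if_cong)
      then show "v \<in> ?C"
        by (intro CollectI exI[of _ "\<lambda>w. if w = v then 1 else 0"]) auto
    qed
    show "convex_cone ?C"
      unfolding convex_cone_iff
    proof (intro conjI allI impI ballI)
      show "0 \<in> ?C" by (intro CollectI exI[of _ "\<lambda>w. 0"]) auto
    next
      fix x y assume "x \<in> ?C" "y \<in> ?C"
      then obtain c d where "\<forall>w\<in>W. 0 \<le> c w" "\<forall>w\<in>W. 0 \<le> d w"
        "x = (\<Sum>w\<in>W. c w *\<^sub>R w)" "y = (\<Sum>w\<in>W. d w *\<^sub>R w)" by auto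
      then show "x + y \<in> ?C"
        by (intro CollectI exI[of _ "\<lambda>w. c w + d w"]) (auto simp: scaleR_add_left sum.distrib)
    next
      fix x and r :: real assume "x \<in> ?C" "0 \<le> r"
      then obtain c where "\<forall>w\<in>W. 0 \<le> c w" "x = (\<Sum>w\<in>W. c w *\<^sub>R w)" by auto
      then show "r *\<^sub>R x \<in> ?C" using \<open>0 \<le> r\<close>
        by (intro CollectI exI[of _ "\<lambda>w. r * c w"]) (auto simp: scaleR_sum_right)
    qed
  qed
  show "?C \<subseteq> convex_cone hull W"
  proof
    fix x assume "x \<in> ?C"
    then obtain c where c: "\<forall>w\<in>W. 0 \<le> c w" and x: "x = (\<Sum>w\<in>W. c w *\<^sub>R w)" by auto
    have "(\<Sum>w\<in>F. c w *\<^sub>R w) \<in> convex_cone hull W" if "F \<subseteq> W" for F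
      using finite_subset[OF that assms] that
    proof (induction F rule: finite_induct)
      case empty
      then show ?case by (simp add: convex_cone_hull_contains_0)
    next
      case (insert v F)
      then show ?case
        using c by (simp add: convex_cone_hull_add convex_cone_hull_mul hull_inc)
    qed
    then show "x \<in> convex_cone hull W" using x by blast
  qed
qed

lemma convex_cone_hullE:
  assumes "finite W" "x \<in> convex_cone hull W"
  obtains c where "\<And>w. w \<in> W \<Longrightarrow> 0 \<le> c w" "x = (\<Sum>w\<in>W. c w *\<^sub>R w)"
  using assms by (auto simp: convex_cone_hull_finite)

lemma convex_cone_hull_sumI:
  assumes "finite W" "\<And>w. w \<in> W \<Longrightarrow> 0 \<le> c w"
  shows "(\<Sum>w\<in>W. c w *\<^sub>R w) \<in> convex_cone hull W"
  using assms by (auto simp: convex_cone_hull_finite)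

lemma independent_sum_eqD:
  fixes W :: "'a::real_vector set"
  assumes "independent W" "finite W" "(\<Sum>w\<in>W. c w *\<^sub>R w) = (\<Sum>w\<in>W. d w *\<^sub>R w)" "v \<in> W"
  shows "c v = d v"
proof -
  have "(\<Sum>w\<in>W. (c w - d w) *\<^sub>R w) = 0"
    using assms(3) by (simp add: scaleR_diff_left sum_subtractf)
  then have "c v - d v = 0"
    using independentD[OF assms(1,2) order_refl, of "\<lambda>w. c w - d w" v] assms(4) by simp
  then show ?thesis by simp
qed

text \<open>The basic perturbation. Strict signs are open conditions and \<open>M\<close> is finite,
  so a short step keeps them all; only forms vanishing at \<open>x\<close> can change, and these
  take the sign of \<open>a \<bullet> y\<close>.\<close>

lemma eventually_sgn_inner_add:
  fixes x :: "'a::real_inner"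
  assumes "finite M"
  shows "\<forall>\<^sub>F t in at_right 0. \<forall>a\<in>M. a \<bullet> x \<noteq> 0 \<longrightarrow> sgn (a \<bullet> (x + t *\<^sub>R y)) = sgn (a \<bullet> x)"
proof (rule eventually_ball_finite[OF assms], rule ballI)
  fix a assume "a \<in> M"
  have lim: "((\<lambda>t. a \<bullet> (x + t *\<^sub>R y)) \<longlongrightarrow> a \<bullet> (x + 0 *\<^sub>R y)) (at_right 0)"
    by (intro tendsto_intros)
  consider "a \<bullet> x = 0" | "a \<bullet> x > 0" | "a \<bullet> x < 0" by linarith
  then show "\<forall>\<^sub>F t in at_right 0. a \<bullet> x \<noteq> 0 \<longrightarrow> sgn (a \<bullet> (x + t *\<^sub>R y)) = sgn (a \<bullet> x)"
  proof cases
    case 2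
    then have "\<forall>\<^sub>F t in at_right 0. 0 < a \<bullet> (x + t *\<^sub>R y)"
      using order_tendstoD(1)[OF lim, of 0] by simp
    then show ?thesis by eventually_elim (use 2 in simp)
  next
    case 3
    then have "\<forall>\<^sub>F t in at_right 0. 0 > a \<bullet> (x + t *\<^sub>R y)"
      using order_tendstoD(2)[OF lim, of 0] by simp
    then show ?thesis by eventually_elim (use 3 in simp)
  qed simp
qed

lemma eventually_at_right_0E:
  assumes "\<forall>\<^sub>F t in at_right (0::real). P t"
  obtains t where "t > 0" "P t"
proof -
  have "\<forall>\<^sub>F t in at_right (0::real). 0 < t \<and> P t"
    using eventually_at_right_less assms by (rule eventually_conj)
  then show ?thesis using that eventually_happens trivial_limit_at_right_real by blast
qed

lemma sgn_inner_addE: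
  fixes x :: "'a::real_inner"
  assumes "finite M"
  obtains t where "t > 0" "\<And>a. a \<in> M \<Longrightarrow> a \<bullet> x \<noteq> 0 \<Longrightarrow> sgn (a \<bullet> (x + t *\<^sub>R y)) = sgn (a \<bullet> x)"
  using eventually_at_right_0E[OF eventually_sgn_inner_add[OF assms, of x y]] by metis

text \<open>A real subspace is not a finite union of proper subspaces. If the new form vanishes at
  the point found so far, a short step towards a point where it does not vanish repairs this without
  spoiling the earlier forms.\<close>

lemma generic_point_exists:
  fixes E :: "'a::real_inner set"
  assumes "subspace E" "finite M" "\<And>a. a \<in> M \<Longrightarrow> \<exists>x\<in>E. a \<bullet> x \<noteq> 0"
  shows "\<exists>g\<in>E. \<forall>a\<in>M. a \<bullet> g \<noteq> 0"
  using assms(2,3)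
proof (induction M rule: finite_induct)
  case empty
  then show ?case using assms(1) subspace_0 by auto
next
  case (insert b M)
  then obtain g where g: "g \<in> E" "\<forall>a\<in>M. a \<bullet> g \<noteq> 0" by auto
  show ?case
  proof (cases "b \<bullet> g = 0")
    case True
    obtain w where w: "w \<in> E" "b \<bullet> w \<noteq> 0" using insert.prems by auto
    obtain t where t: "t > 0" "\<And>a. a \<in> M \<Longrightarrow> a \<bullet> g \<noteq> 0 \<Longrightarrow> sgn (a \<bullet> (g + t *\<^sub>R w)) = sgn (a \<bullet> g)"
      using sgn_inner_addE[OF insert.hyps(1)] by metis
    have "g + t *\<^sub>R w \<in> E" using g w assms(1) by (simp add: subspace_add subspace_scale)
    moreover have "a \<bullet> (g + t *\<^sub>R w) \<noteq> 0" if "a \<in> M" for a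
      using t(2)[OF that] g(2) that by (metis sgn_0_0)
    moreover have "b \<bullet> (g + t *\<^sub>R w) \<noteq> 0" using True w t(1) by (simp add: inner_add_right)
    ultimately show ?thesis by blast
  qed (use g in auto)
qed

lemma generic_point_near:
  fixes E :: "'a::real_inner set"
  assumes "subspace E" "finite M" "\<And>a. a \<in> M \<Longrightarrow> \<exists>x\<in>E. a \<bullet> x \<noteq> 0" "p \<in> E"
  obtains g where "g \<in> E" "\<And>a. a \<in> M \<Longrightarrow> a \<bullet> g \<noteq> 0"
    "\<And>a. a \<in> M \<Longrightarrow> a \<bullet> p \<noteq> 0 \<Longrightarrow> sgn (a \<bullet> g) = sgn (a \<bullet> p)"
proof -
  obtain w where w: "w \<in> E" "\<forall>a\<in>M. a \<bullet> w \<noteq> 0" using generic_point_exists assms by metis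
  obtain t where t: "t > 0" "\<And>a. a \<in> M \<Longrightarrow> a \<bullet> p \<noteq> 0 \<Longrightarrow> sgn (a \<bullet> (p + t *\<^sub>R w)) = sgn (a \<bullet> p)"
    using sgn_inner_addE[OF assms(2)] by metis
  have "a \<bullet> (p + t *\<^sub>R w) \<noteq> 0" if "a \<in> M" for a
  proof (cases "a \<bullet> p = 0")
    case True
    then show ?thesis using t(1) w that by (simp add: inner_add_right)
  next
    case False
    then show ?thesis using t(2)[OF that] by (metis sgn_0_0)
  qed
  then show ?thesis using that[of "p + t *\<^sub>R w"] t w assms(1,4)
    by (simp add: subspace_add subspace_scale)
qed

lemma dim_Int_hyperplane:
  fixes E :: "'a::euclidean_space set"
  assumes "subspace E" "v \<in> E" "b \<bullet> v \<noteq> 0"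
  shows "dim (E \<inter> {x. b \<bullet> x = 0}) + 1 = dim E"
proof -
  let ?H = "E \<inter> {x. b \<bullet> x = 0}"
  have H: "subspace ?H" using assms(1) subspace_hyperplane by (rule subspace_inter)
  have "E \<subseteq> span (insert v ?H)"
  proof
    fix x assume "x \<in> E"
    define k where "k = (b \<bullet> x) / (b \<bullet> v)"
    have "x - k *\<^sub>R v \<in> ?H"
      using \<open>x \<in> E\<close> assms by (auto simp: k_def subspace_diff subspace_scale inner_diff_right)
    then show "x \<in> span (insert v ?H)" unfolding span_breakdown_eq by (meson span_base)
  qed
  moreover have "insert v ?H \<subseteq> E" using assms by auto
  ultimately have "dim E = dim (insert v ?H)"
    using dim_subset[of E "span (insert v ?H)"] dim_subset[of "insert v ?H" E] by simp
  moreover have "span ?H = ?H" using H by (simp only: span_eq_iff)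
  then have "v \<notin> span ?H" using assms(3) by (metis (mono_tags, lifting) IntD2 mem_Collect_eq)
  ultimately show ?thesis by (simp add: dim_insert)
qed


section \<open>Simplicial fans\<close>

text \<open>Where \<open>a \<bullet> x = 0\<close> both disjuncts say
  \<open>a \<bullet> y = 0\<close>; elsewhere \<open>y\<close> may only drop to the wall. With a
  smaller set of normals the same formula describes the chambers of a subarrangement.\<close>

definition closed_cell :: "'a::euclidean_space set \<Rightarrow> 'a set \<Rightarrow> 'a \<Rightarrow> 'a set" where
  "closed_cell E N x = {y \<in> E. \<forall>a\<in>N. a \<bullet> y = 0 \<or> sgn (a \<bullet> y) = sgn (a \<bullet> x)}"

text \<open>A cell is recorded by its generators. Choosing them in \<open>Z\<close> normalizes the
  rays, which makes the generating set unique (\<open>hull_inj\<close>).\<close>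

definition fan_faces :: "'a::euclidean_space set \<Rightarrow> 'a set \<Rightarrow> 'a set \<Rightarrow> 'a set set" where
  "fan_faces E N Z = {W. W \<subseteq> Z \<and> independent W \<and> (\<exists>x\<in>E. convex_cone hull W = closed_cell E N x)}"

lemma closed_cell_refl: "x \<in> E \<Longrightarrow> x \<in> closed_cell E N x"
  by (simp add: closed_cell_def)

lemma closed_cell_mono:
  assumes "x \<in> closed_cell E N y"
  shows "closed_cell E N x \<subseteq> closed_cell E N y"
  using assms unfolding closed_cell_def by (auto simp del: sgn_0_0) (metis sgn_0 sgn_0_0)

text \<open>The region is a hyperplane or one of two closed half-spaces, depending on the sign of
  \<open>a \<bullet> x\<close>. Both the cone property and closedness of cells are derived through
  this.\<close>

lemma sgn_region_cases:
  assumes "P {y. a \<bullet> y = 0}" "P {y. a \<bullet> y \<ge> 0}" "P {y. a \<bullet> y \<le> 0}"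
  shows "P {y. a \<bullet> y = 0 \<or> sgn (a \<bullet> y) = sgn (a \<bullet> x)}" (is "P ?R")
proof -
  consider "a \<bullet> x = 0" | "a \<bullet> x > 0" | "a \<bullet> x < 0" by linarith
  then have "?R = {y. a \<bullet> y = 0} \<or> ?R = {y. a \<bullet> y \<ge> 0} \<or> ?R = {y. a \<bullet> y \<le> 0}"
  proof cases
    case 1
    then have "?R = {y. a \<bullet> y = 0}" by (auto simp: sgn_zero_iff)
    then show ?thesis by blast
  next
    case 2
    then have "?R = {y. a \<bullet> y \<ge> 0}" by (auto simp: sgn_if split: if_splits)
    then show ?thesis by blast
  next
    case 3
    then have "?R = {y. a \<bullet> y \<le> 0}" by (auto simp: sgn_if split: if_splits)
    then show ?thesis by blast
  qed
  then show ?thesis using assms by (elim disjE) (simp_all only:)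
qed

lemma convex_cone_closed_cell:
  assumes "subspace E"
  shows "convex_cone (closed_cell E N x)"
proof -
  have "closed_cell E N x = E \<inter> (\<Inter>a\<in>N. {y. a \<bullet> y = 0 \<or> sgn (a \<bullet> y) = sgn (a \<bullet> x)})"
    by (auto simp: closed_cell_def)
  moreover have "convex_cone {y. a \<bullet> y = 0 \<or> sgn (a \<bullet> y) = sgn (a \<bullet> x)}" for a
    by (rule sgn_region_cases)
      (simp_all add: subspace_imp_convex_cone subspace_hyperplane convex_cone_halfspace_ge convex_cone_halfspace_le)
  ultimately show ?thesis
    using convex_cone_Inter[of "insert E ((\<lambda>a. {y. a \<bullet> y = 0 \<or> sgn (a \<bullet> y) = sgn (a \<bullet> x)}) ` N)"]
      subspace_imp_convex_cone[OF assms] by auto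
qed

text \<open>For finite independent \<open>W\<close> this is the relative interior of the cone. For
  \<open>W = {}\<close> it is \<open>{0}\<close>, so the empty face carries the origin.\<close>

definition open_cone :: "'a::real_vector set \<Rightarrow> 'a set" where
  "open_cone W = {\<Sum>w\<in>W. c w *\<^sub>R w | c. \<forall>w\<in>W. 0 < c w}"

lemma open_coneI: "(\<And>w. w \<in> W \<Longrightarrow> 0 < c w) \<Longrightarrow> (\<Sum>w\<in>W. c w *\<^sub>R w) \<in> open_cone W"
  unfolding open_cone_def by auto

lemma open_coneE:
  assumes "x \<in> open_cone W"
  obtains c where "\<And>w. w \<in> W \<Longrightarrow> 0 < c w" "x = (\<Sum>w\<in>W. c w *\<^sub>R w)"
  using assms unfolding open_cone_def by auto

text \<open>\<open>\<Sum>W\<close> plays the part of a barycentre: the chosen interior point of a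
  face in all later arguments.\<close>

lemma sum_in_open_cone: "\<Sum>W \<in> open_cone W"
  using open_coneI[of W "\<lambda>_. 1"] by simp

lemma open_cone_subset: "finite W \<Longrightarrow> open_cone W \<subseteq> convex_cone hull W"
  unfolding open_cone_def by (auto intro: convex_cone_hull_sumI less_imp_le)

lemma open_cone_span: "open_cone W \<subseteq> span W"
  unfolding open_cone_def by (auto intro: span_sum span_scale span_base)

text \<open>\<open>essential_N\<close> makes the cells pointed. \<open>rays_Z\<close> allows one
  point of \<open>Z\<close> per open ray and also excludes the origin, since
  \<open>0 = 2 *\<^sub>R 0\<close>.\<close>

locale simplicial_fan =
  fixes E N Z :: "'a::euclidean_space set"
  assumes subspace_E: "subspace E"
    and finite_N: "finite N"
    and essential_N: "\<And>x. x \<in> E \<Longrightarrow> (\<And>a. a \<in> N \<Longrightarrow> a \<bullet> x = 0) \<Longrightarrow> x = 0"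
    and rays_Z: "\<And>z c. z \<in> Z \<Longrightarrow> 0 < c \<Longrightarrow> c *\<^sub>R z \<in> Z \<Longrightarrow> c = 1"
    and simplicial_cells:
      "\<And>x. x \<in> E \<Longrightarrow> \<exists>W\<subseteq>Z. independent W \<and> convex_cone hull W = closed_cell E N x"
begin

abbreviation "cell \<equiv> closed_cell E N"
abbreviation "faces \<equiv> fan_faces E N Z"

lemma face_independent: "W \<in> faces \<Longrightarrow> independent W"
  and face_rays: "W \<in> faces \<Longrightarrow> W \<subseteq> Z"
  by (auto simp: fan_faces_def)

lemma face_finite: "W \<in> faces \<Longrightarrow> finite W"
  using face_independent finiteI_independent by blast

lemma face_hull_subset: "W \<in> faces \<Longrightarrow> convex_cone hull W \<subseteq> E"
  by (auto simp: fan_faces_def closed_cell_def)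

lemma face_subset: "W \<in> faces \<Longrightarrow> W \<subseteq> E"
  using face_hull_subset hull_subset[of W convex_cone] by blast

text \<open>If \<open>y\<close> lies in the cell of \<open>x\<close>, then so does
  \<open>x - t *\<^sub>R y\<close> for small \<open>t > 0\<close>. Both have nonnegative
  coefficients over \<open>W\<close>, and these add up to those of \<open>x\<close>; hence
  \<open>y\<close> can only use generators that \<open>x\<close> uses.\<close>

lemma cell_eq_support_hull:
  assumes W: "W \<in> faces" and c: "\<And>w. w \<in> W \<Longrightarrow> 0 \<le> c w" and x: "x = (\<Sum>w\<in>W. c w *\<^sub>R w)"
  shows "cell x = convex_cone hull {w \<in> W. 0 < c w}" (is "_ = convex_cone hull ?S")
proof
  note fin = face_finite[OF W] and ind = face_independent[OF W]
  obtain x0 where x0: "x0 \<in> E" "convex_cone hull W = cell x0"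
    using W by (auto simp: fan_faces_def)
  have xx0: "x \<in> cell x0" using convex_cone_hull_sumI[OF fin c] x x0 by auto
  then have xE: "x \<in> E" by (simp add: closed_cell_def)
  show "cell x \<subseteq> convex_cone hull ?S"
  proof
    fix y assume y: "y \<in> cell x"
    then have yE: "y \<in> E" by (simp add: closed_cell_def)
    obtain t where t: "t > 0" "\<And>a. a \<in> N \<Longrightarrow> a \<bullet> x \<noteq> 0 \<Longrightarrow> sgn (a \<bullet> (x + t *\<^sub>R (- y))) = sgn (a \<bullet> x)"
      using sgn_inner_addE[OF finite_N] by metis
    have "a \<bullet> (x + t *\<^sub>R (- y)) = 0" if "a \<in> N" "a \<bullet> x = 0" for a
    proof -
      have "a \<bullet> y = 0" using y that unfolding closed_cell_def by (metis (mono_tags, lifting) mem_Collect_eq sgn_0 sgn_0_0)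
      then show ?thesis using that by (simp add: inner_diff_right)
    qed
    moreover have "x - t *\<^sub>R y \<in> E" using xE yE subspace_E by (simp add: subspace_diff subspace_scale)
    ultimately have "x - t *\<^sub>R y \<in> cell x"
      unfolding closed_cell_def using t(2) by auto
    then have "x - t *\<^sub>R y \<in> convex_cone hull W" "y \<in> convex_cone hull W"
      using closed_cell_mono[OF xx0] y unfolding x0(2) by blast+
    note hulls = this
    obtain d where d: "\<And>w. w \<in> W \<Longrightarrow> 0 \<le> d w" "y = (\<Sum>w\<in>W. d w *\<^sub>R w)"
      using convex_cone_hullE[OF fin hulls(2)] by blast
    obtain e where e: "\<And>w. w \<in> W \<Longrightarrow> 0 \<le> e w" "x - t *\<^sub>R y = (\<Sum>w\<in>W. e w *\<^sub>R w)"
      using convex_cone_hullE[OF fin hulls(1)] by blast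
    have "(\<Sum>w\<in>W. c w *\<^sub>R w) = (\<Sum>w\<in>W. (e w + t * d w) *\<^sub>R w)"
      using e(2) d(2) x by (simp add: scaleR_add_left sum.distrib scaleR_sum_right algebra_simps)
    then have eq: "c w = e w + t * d w" if "w \<in> W" for w
      using independent_sum_eqD[OF ind fin] that by metis
    have "d w = 0" if "w \<in> W - ?S" for w
    proof -
      have "c w = 0" using that c[of w] by force
      moreover have "0 \<le> e w" "0 \<le> d w" using that d e by auto
      moreover have "c w = e w + t * d w" using that eq by auto
      ultimately have "t * d w \<le> 0" "0 \<le> d w" by auto
      then show ?thesis using t(1) by (simp add: mult_le_0_iff)
    qed
    then have "y = (\<Sum>w\<in>?S. d w *\<^sub>R w)"
      unfolding d(2) by (intro sum.mono_neutral_right) (use fin in auto)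
    then show "y \<in> convex_cone hull ?S"
      using convex_cone_hull_sumI[of ?S d] fin d(1) by auto
  qed
  show "convex_cone hull ?S \<subseteq> cell x"
  proof (rule hull_minimal)
    show "convex_cone (cell x)" by (rule convex_cone_closed_cell[OF subspace_E])
    show "?S \<subseteq> cell x"
    proof
      fix w assume w: "w \<in> ?S"
      \<comment> \<open>\<open>x\<close> splits as \<open>c w *\<^sub>R w + z\<close> with both
        parts in \<open>cell x0\<close>, so no normal takes opposite signs on them and nothing
        cancels in \<open>a \<bullet> x\<close>.\<close>
      define z where "z = (\<Sum>v\<in>W - {w}. c v *\<^sub>R v)"
      have xz: "x = c w *\<^sub>R w + z" unfolding x z_def using sum.remove[of W w "\<lambda>v. c v *\<^sub>R v"] w fin by simp
      have "z \<in> convex_cone hull (W - {w})"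
        unfolding z_def by (rule convex_cone_hull_sumI) (use fin c in auto)
      then have z: "z \<in> cell x0" using x0 hull_mono[of "W - {w}" W] by auto
      have w0: "w \<in> cell x0" using hull_inc[of w W convex_cone] w x0 by auto
      show "w \<in> cell x" unfolding closed_cell_def
      proof (intro CollectI conjI ballI)
        show "w \<in> E" using w0 by (simp add: closed_cell_def)
        fix a assume "a \<in> N"
        then have *: "a \<bullet> w = 0 \<or> sgn (a \<bullet> w) = sgn (a \<bullet> x0)" "a \<bullet> z = 0 \<or> sgn (a \<bullet> z) = sgn (a \<bullet> x0)"
          using w0 z by (auto simp: closed_cell_def)
        have ax: "a \<bullet> x = c w * (a \<bullet> w) + a \<bullet> z" by (simp add: xz inner_add_right)
        have cw: "0 < c w" using w by simp
        consider "a \<bullet> w = 0" | "a \<bullet> w > 0" | "a \<bullet> w < 0" by linarith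
        then show "a \<bullet> w = 0 \<or> sgn (a \<bullet> w) = sgn (a \<bullet> x)"
        proof cases
          case 2
          then have "a \<bullet> z \<ge> 0" using * by (auto simp: sgn_if split: if_splits)
          moreover have "c w * (a \<bullet> w) > 0" using 2 cw by simp
          ultimately show ?thesis using 2 ax by simp
        next
          case 3
          then have "a \<bullet> z \<le> 0" using * by (auto simp: sgn_if split: if_splits)
          moreover have "c w * (a \<bullet> w) < 0" using 3 cw by (simp add: mult_pos_neg)
          ultimately show ?thesis using 3 ax by simp
        qed simp
      qed
    qed
  qed
qed

lemma cell_eq_hull:
  assumes "W \<in> faces" "x \<in> open_cone W"
  shows "cell x = convex_cone hull W"
proof -
  obtain c where c: "\<And>w. w \<in> W \<Longrightarrow> 0 < c w" "x = (\<Sum>w\<in>W. c w *\<^sub>R w)"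
    using open_coneE[OF assms(2)] by blast
  moreover from c have "{w \<in> W. 0 < c w} = W" by auto
  ultimately show ?thesis using cell_eq_support_hull[OF assms(1), of c x] by (simp add: less_imp_le)
qed

lemma open_cone_subset_E: "W \<in> faces \<Longrightarrow> open_cone W \<subseteq> E"
  using open_cone_subset face_finite face_hull_subset by blast

text \<open>The sum of \<open>S\<close>, written over \<open>W\<close> with coefficients 1 and 0,
  has support \<open>S\<close>, so its cell is generated by \<open>S\<close>.\<close>

lemma face_down_closed:
  assumes W: "W \<in> faces" and S: "S \<subseteq> W"
  shows "S \<in> faces"
proof -
  define x where "x = (\<Sum>w\<in>W. (if w \<in> S then 1 else 0) *\<^sub>R w)"
  have "cell x = convex_cone hull {w \<in> W. 0 < (if w \<in> S then 1 else (0::real))}"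
    by (rule cell_eq_support_hull[OF W _ x_def]) auto
  also have "{w \<in> W. 0 < (if w \<in> S then 1 else (0::real))} = S" using S by auto
  finally have "convex_cone hull S = cell x" by simp
  moreover have "x \<in> E" unfolding x_def using face_subset[OF W] subspace_E
    by (intro subspace_sum) (auto simp: subspace_scale subspace_0)
  moreover have "S \<subseteq> Z" "independent S"
    using S W independent_mono by (auto simp: fan_faces_def)
  ultimately show ?thesis unfolding fan_faces_def by blast
qed

lemma carrier_face_subset:
  assumes "W \<in> faces" "x \<in> convex_cone hull W"
  obtains S where "S \<subseteq> W" "x \<in> open_cone S"
proof -
  obtain c where c: "\<And>w. w \<in> W \<Longrightarrow> 0 \<le> c w" "x = (\<Sum>w\<in>W. c w *\<^sub>R w)"
    using convex_cone_hullE[OF face_finite[OF assms(1)] assms(2)] by blast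
  let ?S = "{w \<in> W. 0 < c w}"
  have "x = (\<Sum>w\<in>?S. c w *\<^sub>R w)" unfolding c(2)
    by (rule sum.mono_neutral_right) (use c(1) face_finite[OF assms(1)] in force)+
  then have "x \<in> open_cone ?S" using open_coneI[of ?S c] by simp
  then show ?thesis using that[of ?S] by auto
qed

lemma face_of_cell:
  assumes "x \<in> E"
  obtains W where "W \<in> faces" "convex_cone hull W = cell x"
proof -
  obtain W where "W \<subseteq> Z" "independent W" "convex_cone hull W = cell x"
    using simplicial_cells[OF assms] by blast
  then show ?thesis using that[of W] assms unfolding fan_faces_def by blast
qed

lemma carrier_face:
  assumes "x \<in> E"
  obtains W where "W \<in> faces" "x \<in> open_cone W"
proof -
  obtain W where W: "W \<in> faces" "convex_cone hull W = cell x" using face_of_cell assms .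
  then obtain S where "S \<subseteq> W" "x \<in> open_cone S"
    using carrier_face_subset closed_cell_refl[OF assms] by metis
  then show ?thesis using that face_down_closed[OF W(1)] by blast
qed

text \<open>All generators are positive multiples of \<open>z\<close>, and \<open>Z\<close> admits
  only \<open>z\<close> itself on that ray.\<close>

lemma hull_singleton_face:
  assumes "W \<in> faces" "z \<in> Z" "convex_cone hull W = convex_cone hull {z}"
  shows "W = {z}"
proof -
  have mult: "w = z" if "w \<in> W" for w
  proof -
    have "w \<in> convex_cone hull {z}" using hull_inc[of w W convex_cone] that assms(3) by simp
    then obtain c where c: "0 \<le> c z" "w = c z *\<^sub>R z" using convex_cone_hullE[of "{z}" w] by auto
    have "w \<noteq> 0" using face_independent[OF assms(1)] that dependent_zero by blast
    then have "0 < c z" using c by (cases "c z = 0") auto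
    then show ?thesis using rays_Z[OF assms(2), of "c z"] c that face_rays[OF assms(1)] by auto
  qed
  have "W \<noteq> {}"
  proof
    assume W: "W = {}"
    have "z \<in> convex_cone hull W" using hull_inc[of z "{z}" convex_cone] assms(3) by simp
    then have "z = 0" using convex_cone_hullE[of "{}" z] unfolding W by auto
    then have "2 *\<^sub>R z \<in> Z" using assms(2) by simp
    then show False using rays_Z[OF assms(2), of 2] by simp
  qed
  then show ?thesis using mult by auto
qed

text \<open>A single generator \<open>v\<close> of one face is itself a face. Its carrier inside the
  other face generates the same ray, hence equals \<open>{v}\<close>, so the generators can be read
  off from the cone.\<close>

lemma hull_inj:
  assumes W: "W \<in> faces" and W': "W' \<in> faces" and eq: "convex_cone hull W = convex_cone hull W'"
  shows "W = W'"
proof -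
  have sub: "V \<subseteq> V'" if V: "V \<in> faces" and V': "V' \<in> faces" and VV': "convex_cone hull V = convex_cone hull V'" for V V'
  proof
    fix v assume v: "v \<in> V"
    then have vf: "{v} \<in> faces" using face_down_closed[OF V] by simp
    have "v \<in> convex_cone hull V'" using hull_inc[of v V convex_cone] v VV' by simp
    then obtain S where S: "S \<subseteq> V'" "v \<in> open_cone S" by (rule carrier_face_subset[OF V'])
    have Sf: "S \<in> faces" using S face_down_closed[OF V'] by simp
    have "v \<in> open_cone {v}" using sum_in_open_cone[of "{v}"] by simp
    then have "convex_cone hull S = convex_cone hull {v}"
      using cell_eq_hull[OF Sf S(2)] cell_eq_hull[OF vf] by simp
    then have "S = {v}" using hull_singleton_face[OF Sf] v face_rays[OF V] by blast
    then show "v \<in> V'" using S by auto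
  qed
  show ?thesis using sub[OF W W' eq] sub[OF W' W] eq by auto
qed

lemma carrier_unique:
  assumes "W \<in> faces" "W' \<in> faces" "x \<in> open_cone W" "x \<in> open_cone W'"
  shows "W = W'"
  using hull_inj[OF assms(1,2)] cell_eq_hull[OF assms(1,3)] cell_eq_hull[OF assms(2,4)] by simp

lemma face_subset_if_hull_subset:
  assumes "W \<in> faces" "W' \<in> faces" "convex_cone hull W \<subseteq> convex_cone hull W'"
  shows "W \<subseteq> W'"
proof -
  have "\<Sum>W \<in> convex_cone hull W'"
    using assms sum_in_open_cone open_cone_subset face_finite by blast
  then obtain S where S: "S \<subseteq> W'" "\<Sum>W \<in> open_cone S" using carrier_face_subset assms(2) by metis
  then have "S = W"
    using carrier_unique sum_in_open_cone assms face_down_closed by metis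
  then show ?thesis using S by simp
qed

lemma face_subset_carrier:
  assumes "W \<in> faces" "x \<in> open_cone W" "W' \<in> faces" "y \<in> open_cone W'" "x \<in> cell y"
  shows "W \<subseteq> W'"
  using face_subset_if_hull_subset[OF assms(1,3)] closed_cell_mono[OF assms(5)]
  by (simp add: cell_eq_hull[OF assms(1,2)] cell_eq_hull[OF assms(3,4)])

text \<open>A cell depends only on the sign vector of \<open>x\<close> on \<open>N\<close>, of which
  there are finitely many, and a face is determined by its cell.\<close>

lemma finite_faces: "finite faces"
proof -
  define G where "G = (\<lambda>s::'a \<Rightarrow> real. {y \<in> E. \<forall>a\<in>N. a \<bullet> y = 0 \<or> sgn (a \<bullet> y) = s a})"
  have "range cell \<subseteq> G ` (N \<rightarrow>\<^sub>E {-1, 0, 1})"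
  proof (rule image_subsetI)
    fix x
    have "cell x = G (restrict (\<lambda>a. sgn (a \<bullet> x)) N)"
      unfolding closed_cell_def G_def by (intro Collect_cong conj_cong ball_cong) simp_all
    moreover have "restrict (\<lambda>a. sgn (a \<bullet> x)) N \<in> N \<rightarrow>\<^sub>E {-1, 0, 1}"
      unfolding restrict_PiE_iff by (simp add: sgn_if)
    ultimately show "cell x \<in> G ` (N \<rightarrow>\<^sub>E {-1, 0, 1})" by (rule image_eqI)
  qed
  moreover have "finite (N \<rightarrow>\<^sub>E {-1, 0, 1::real})" by (rule finite_PiE[OF finite_N]) simp
  ultimately have "finite (range cell)" by (rule finite_subset[OF _ finite_imageI])
  moreover have "(\<lambda>W. convex_cone hull W) ` faces \<subseteq> range cell" 
    by (rule image_subsetI) (auto simp: fan_faces_def)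
  ultimately have "finite ((\<lambda>W. convex_cone hull W) ` faces)" by (rule finite_subset[rotated])
  then show ?thesis by (rule finite_imageD) (rule inj_onI, rule hull_inj)
qed

lemma empty_face: "{} \<in> faces"
proof -
  obtain W where "W \<in> faces" using carrier_face[OF subspace_0[OF subspace_E]] by blast
  then show ?thesis using face_down_closed by blast
qed

lemma card_face_le: "W \<in> faces \<Longrightarrow> card W \<le> dim E"
  by (rule independent_card_le_dim[OF face_subset face_independent])

end


section \<open>Chambers and their boundaries\<close>

lemma complex_dim_eqI:
  assumes "finite K" "F \<in> K" "\<And>G. G \<in> K \<Longrightarrow> card G \<le> card F"
  shows "complex_dim K = int (card F) - 1"
  unfolding complex_dim_def face_dim_def
proof (rule Max_eqI)
  fix y assume "y \<in> (\<lambda>F. int (card F) - 1) ` K"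
  then show "y \<le> int (card F) - 1" using assms(3) by force
qed (use assms in auto)

lemma closed_cell_wallD: "y \<in> closed_cell E N x \<Longrightarrow> a \<in> N \<Longrightarrow> a \<bullet> x = 0 \<Longrightarrow> a \<bullet> y = 0"
  unfolding closed_cell_def by (metis (mono_tags, lifting) mem_Collect_eq sgn_0 sgn_0_0)

lemma closed_cell_sgnD: "y \<in> closed_cell E N x \<Longrightarrow> a \<in> N \<Longrightarrow> a \<bullet> y \<noteq> 0 \<Longrightarrow> sgn (a \<bullet> y) = sgn (a \<bullet> x)"
  unfolding closed_cell_def by blast

text \<open>\<open>Q\<close> holds the normals of the walls, later those of the hyperplanes treated
  before, and \<open>p\<close> selects one of the regions that they cut out.\<close>

definition chamber_faces :: "'a::euclidean_space set \<Rightarrow> 'a set \<Rightarrow> 'a set \<Rightarrow> 'a set \<Rightarrow> 'a \<Rightarrow> 'a set set" where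
  "chamber_faces E N Z Q p = {W \<in> fan_faces E N Z. W \<subseteq> closed_cell E Q p}"

context simplicial_fan
begin

abbreviation "chamber \<equiv> chamber_faces E N Z"

section \<open>Facets, dimension and purity of a chamber\<close>

lemma open_cone_subset_cone:
  assumes "W \<in> faces" "convex_cone C" "W \<subseteq> C"
  shows "open_cone W \<subseteq> C"
  using open_cone_subset[OF face_finite[OF assms(1)]] hull_minimal[OF assms(3), of convex_cone] assms(2)
  by blast

lemma face_subset_cell: "W \<in> faces \<Longrightarrow> x \<in> open_cone W \<Longrightarrow> W \<subseteq> cell x"
  using cell_eq_hull hull_subset[of W convex_cone] by simp

text \<open>The cells of \<open>N\<close> refine those of \<open>Q\<close>, so a single interior
  point decides on which side of the walls a face lies.\<close>

lemma face_subset_chamber_iff: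
  assumes "W \<in> faces" "x \<in> open_cone W" "Q \<subseteq> N"
  shows "W \<subseteq> closed_cell E Q p \<longleftrightarrow> x \<in> closed_cell E Q p"
proof
  assume "W \<subseteq> closed_cell E Q p"
  then show "x \<in> closed_cell E Q p"
    using open_cone_subset_cone[OF assms(1) convex_cone_closed_cell[OF subspace_E]] assms(2) by blast
next
  assume x: "x \<in> closed_cell E Q p"
  have "cell x \<subseteq> closed_cell E Q x" using assms(3) by (auto simp: closed_cell_def)
  then show "W \<subseteq> closed_cell E Q p"
    using face_subset_cell[OF assms(1,2)] closed_cell_mono[OF x] by blast
qed

lemma face_subset_hyperplane_iff:
  assumes "W \<in> faces" "x \<in> open_cone W" "a \<in> N"
  shows "W \<subseteq> {y. a \<bullet> y = 0} \<longleftrightarrow> a \<bullet> x = 0"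
proof
  assume "W \<subseteq> {y. a \<bullet> y = 0}"
  then have "open_cone W \<subseteq> {y. a \<bullet> y = 0}"
    by (rule open_cone_subset_cone[OF assms(1) subspace_imp_convex_cone[OF subspace_hyperplane]])
  then show "a \<bullet> x = 0" using assms(2) by auto
next
  assume "a \<bullet> x = 0"
  then show "W \<subseteq> {y. a \<bullet> y = 0}"
    using face_subset_cell[OF assms(1,2)] closed_cell_wallD[OF _ assms(3)] by blast
qed

text \<open>From the barycentre of \<open>W\<close> a short step in a generic direction near
  \<open>p\<close> enters the interior of a full-dimensional cell. Forms nonzero at the barycentre
  keep their signs, and walls through it get the sign they have at \<open>p\<close>, so the step
  stays in the chamber.\<close>

lemma chamber_facet_exists:
  assumes Q: "Q \<subseteq> N" and p: "p \<in> E" "\<And>q. q \<in> Q \<Longrightarrow> q \<bullet> p \<noteq> 0"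
    and W: "W \<in> chamber Q p"
  obtains G where "G \<in> chamber Q p" "W \<subseteq> G" "card G = dim E"
proof -
  have WF: "W \<in> faces" and WC: "W \<subseteq> closed_cell E Q p" using W by (auto simp: chamber_faces_def)
  \<comment> \<open>Normals vanishing on all of \<open>E\<close> do occur, for instance
    \<open>b\<close> itself after restriction to its hyperplane. No point of \<open>E\<close> is
    generic for them, so they are set aside.\<close>
  define M where "M = {a \<in> N. \<exists>x\<in>E. a \<bullet> x \<noteq> 0}"
  have finM: "finite M" using finite_N by (simp add: M_def)
  have QM: "Q \<subseteq> M" using Q p by (auto simp: M_def)
  have M: "\<And>a. a \<in> M \<Longrightarrow> \<exists>x\<in>E. a \<bullet> x \<noteq> 0" by (simp add: M_def)
  have notM: "a \<bullet> v = 0" if "a \<in> N - M" "v \<in> E" for a v using that by (auto simp: M_def)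
  obtain g where g: "g \<in> E" "\<And>a. a \<in> M \<Longrightarrow> a \<bullet> g \<noteq> 0"
    "\<And>a. a \<in> M \<Longrightarrow> a \<bullet> p \<noteq> 0 \<Longrightarrow> sgn (a \<bullet> g) = sgn (a \<bullet> p)"
    using generic_point_near[OF subspace_E finM M p(1)] by metis
  define x where "x = \<Sum>W"
  have xW: "x \<in> open_cone W" unfolding x_def by (rule sum_in_open_cone)
  then have xE: "x \<in> E" using open_cone_subset_E[OF WF] by blast
  obtain t where t: "t > 0" "\<And>a. a \<in> M \<Longrightarrow> a \<bullet> x \<noteq> 0 \<Longrightarrow> sgn (a \<bullet> (x + t *\<^sub>R g)) = sgn (a \<bullet> x)"
    using sgn_inner_addE[OF finM] by metis
  define y where "y = x + t *\<^sub>R g"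
  have yE: "y \<in> E" unfolding y_def using xE g(1) subspace_E by (simp add: subspace_add subspace_scale)
  have y0: "sgn (a \<bullet> y) = sgn (a \<bullet> g)" if "a \<bullet> x = 0" for a
    using t(1) that by (simp add: y_def inner_add_right sgn_mult)
  have y1: "sgn (a \<bullet> y) = sgn (a \<bullet> x)" if "a \<in> M" "a \<bullet> x \<noteq> 0" for a
    using t(2) that by (simp add: y_def)
  have ynz: "a \<bullet> y \<noteq> 0" if "a \<in> M" for a
    using y0[of a] y1[OF that] g(2)[OF that] by (metis sgn_0_0)
  have "a \<bullet> x = 0 \<or> sgn (a \<bullet> x) = sgn (a \<bullet> y)" if "a \<in> N" for a
    using y1[of a] notM[OF _ xE, of a] that by force
  then have xy: "x \<in> cell y" using xE by (auto simp: closed_cell_def)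
  have "x \<in> closed_cell E Q p" using face_subset_chamber_iff[OF WF xW Q] WC by simp
  note xC = this
  have "sgn (q \<bullet> y) = sgn (q \<bullet> p)" if "q \<in> Q" for q
  proof (cases "q \<bullet> x = 0")
    case True
    then show ?thesis using y0[OF True] g(3)[of q] p(2)[OF that] QM that by auto
  next
    case False
    then show ?thesis using y1[of q] closed_cell_sgnD[OF xC that False] QM that by auto
  qed
  then have yC: "y \<in> closed_cell E Q p" using yE by (auto simp: closed_cell_def)
  obtain G where G: "G \<in> faces" "y \<in> open_cone G" using carrier_face[OF yE] .
  have WG: "W \<subseteq> G" by (rule face_subset_carrier[OF WF xW G xy])
  \<comment> \<open>\<open>y\<close> lies off every relevant hyperplane, so a short step in any
    direction of \<open>E\<close> stays in its cell; differences of such points fill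
    \<open>E\<close>.\<close>
  have "E \<subseteq> span G"
  proof
    fix v assume v: "v \<in> E"
    obtain s where s: "s > 0" "\<And>a. a \<in> M \<Longrightarrow> a \<bullet> y \<noteq> 0 \<Longrightarrow> sgn (a \<bullet> (y + s *\<^sub>R v)) = sgn (a \<bullet> y)"
      using sgn_inner_addE[OF finM] by metis
    have yvE: "y + s *\<^sub>R v \<in> E" using yE v subspace_E by (simp add: subspace_add subspace_scale)
    have "a \<bullet> (y + s *\<^sub>R v) = 0 \<or> sgn (a \<bullet> (y + s *\<^sub>R v)) = sgn (a \<bullet> y)" if "a \<in> N" for a
      using s(2)[of a] ynz[of a] notM[OF _ yvE, of a] that by blast
    then have "y + s *\<^sub>R v \<in> cell y" using yvE by (auto simp: closed_cell_def)
    then have "y + s *\<^sub>R v \<in> convex_cone hull G" using cell_eq_hull[OF G] by simp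
    moreover have "convex_cone hull G \<subseteq> span G"
      by (rule hull_minimal) (auto simp: span_superset convex_cone_span)
    moreover have "y \<in> span G" using open_cone_span G by blast
    ultimately have "(y + s *\<^sub>R v) - y \<in> span G" by (intro span_diff) auto
    then show "v \<in> span G" using s(1) span_scale[of "s *\<^sub>R v" G "inverse s"] by simp
  qed
  then have "card G = dim E"
    by (rule basis_card_eq_dim[OF face_subset[OF G(1)] _ face_independent[OF G(1)]])
  moreover have "G \<in> chamber Q p"
    using face_subset_chamber_iff[OF G Q] yC G(1) by (simp add: chamber_faces_def)
  ultimately show ?thesis using that WG by blast
qed

lemma empty_chamber_face: "{} \<in> chamber Q p"
  using empty_face by (simp add: chamber_faces_def)

lemma abstract_complex_chamber: "abstract_complex (chamber Q p)"
proof -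
  have "finite (chamber Q p)" using finite_faces by (simp add: chamber_faces_def)
  moreover have "finite F" if "F \<in> chamber Q p" for F
    using that face_finite by (simp add: chamber_faces_def)
  moreover have "G \<in> chamber Q p" if "F \<in> chamber Q p" "G \<subseteq> F" for F G
    using that face_down_closed unfolding chamber_faces_def by blast
  ultimately show ?thesis using empty_chamber_face unfolding abstract_complex_def by blast
qed

lemma complex_dim_chamber:
  assumes "Q \<subseteq> N" "p \<in> E" "\<And>q. q \<in> Q \<Longrightarrow> q \<bullet> p \<noteq> 0"
  shows "complex_dim (chamber Q p) = int (dim E) - 1"
proof -
  obtain G where G: "G \<in> chamber Q p" "card G = dim E"
    using chamber_facet_exists[OF assms empty_chamber_face] by metis
  have "complex_dim (chamber Q p) = int (card G) - 1"
  proof (rule complex_dim_eqI[OF _ G(1)])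
    show "finite (chamber Q p)" using finite_faces by (simp add: chamber_faces_def)
    show "card G' \<le> card G" if "G' \<in> chamber Q p" for G'
      using that card_face_le G(2) by (simp add: chamber_faces_def)
  qed
  then show ?thesis using G(2) by simp
qed

lemma pure_complex_chamber:
  assumes "Q \<subseteq> N" "p \<in> E" "\<And>q. q \<in> Q \<Longrightarrow> q \<bullet> p \<noteq> 0"
  shows "pure_complex (chamber Q p)"
  unfolding pure_complex_def
proof (intro conjI ballI)
  show "abstract_complex (chamber Q p)" by (rule abstract_complex_chamber)
  fix F assume "F \<in> chamber Q p"
  then obtain G where "G \<in> chamber Q p" "F \<subseteq> G" "card G = dim E"
    using chamber_facet_exists[OF assms] by metis
  then show "\<exists>G\<in>chamber Q p. F \<subseteq> G \<and> face_dim G = complex_dim (chamber Q p)"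
    using complex_dim_chamber[OF assms] by (auto simp: face_dim_def)
qed

text \<open>The case without walls transfers purity and dimension from chambers to the whole
  sphere.\<close>

lemma chamber_faces_no_walls: "chamber {} p = faces"
  using face_subset by (auto simp: chamber_faces_def closed_cell_def)

lemma chamber_facesD:
  assumes "W \<in> chamber Q p"
  shows "W \<in> faces" "W \<subseteq> closed_cell E Q p"
  using assms by (simp_all add: chamber_faces_def)

lemma chamber_face_down_closed:
  assumes "W \<in> chamber Q p" "F \<subseteq> W"
  shows "F \<in> chamber Q p"
  using assms face_down_closed unfolding chamber_faces_def by blast

lemma chamber_carrier:
  assumes W: "W \<in> faces" "x \<in> open_cone W" and Q: "Q \<subseteq> N" and y: "y \<in> closed_cell E Q p"
    and xy: "x \<in> cell y" and yE: "y \<in> E"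
  obtains G where "G \<in> chamber Q p" "W \<subseteq> G" "y \<in> open_cone G"
proof -
  obtain G where G: "G \<in> faces" "y \<in> open_cone G" using carrier_face[OF yE] .
  have "W \<subseteq> G" by (rule face_subset_carrier[OF W G xy])
  moreover have "G \<in> chamber Q p"
    using face_subset_chamber_iff[OF G Q] y G(1) by (simp add: chamber_faces_def)
  ultimately show ?thesis using that G by blast
qed

section \<open>The combinatorial boundary of a chamber\<close>

lemma wall_normal_exists:
  assumes "S \<subseteq> E" "dim S < dim E"
  obtains v where "v \<in> E" "v \<noteq> 0" "\<And>s. s \<in> span S \<Longrightarrow> v \<bullet> s = 0"
proof -
  have E: "span E = E" using subspace_E by (simp only: span_eq_iff)
  have "span S \<subseteq> span E" using assms(1) by (rule span_mono)
  moreover have "span S \<noteq> span E" using assms(2) dim_span by (metis less_irrefl)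
  ultimately have "span S \<subset> span E" by blast
  then obtain v where "v \<noteq> 0" "v \<in> span E" "\<And>y. y \<in> span S \<Longrightarrow> orthogonal v y"
    using orthogonal_to_subspace_exists_gen by blast
  then show ?thesis using that[of v] E by (simp add: orthogonal_def)
qed

text \<open>Short steps from the barycentre \<open>x\<close> of \<open>R\<close> in the directions
  \<open>v\<close> and \<open>- v\<close>, orthogonal to \<open>R\<close>, stay in the chamber
  because no wall contains \<open>x\<close>. If both ended in the open cone of the same
  \<open>G\<close>, their sum \<open>2 *\<^sub>R x\<close> would have positive coefficients on all
  of \<open>G\<close>, although it is a combination of \<open>R\<close> alone.\<close>

lemma interior_ridge_in_two_facets:
  assumes Q: "Q \<subseteq> N" and R: "R \<in> chamber Q p" and card: "card R < dim E"
    and int: "\<And>q. q \<in> Q \<Longrightarrow> \<not> R \<subseteq> {x. q \<bullet> x = 0}"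
  shows "\<not> (\<exists>!G. G \<in> chamber Q p \<and> R \<subset> G)"
proof
  assume ex1: "\<exists>!G. G \<in> chamber Q p \<and> R \<subset> G"
  note RF = chamber_facesD(1)[OF R]
  define x where "x = \<Sum>R"
  have xR: "x \<in> open_cone R" unfolding x_def by (rule sum_in_open_cone)
  have xE: "x \<in> E" using open_cone_subset_E[OF RF] xR by blast
  have xC: "x \<in> closed_cell E Q p"
    using face_subset_chamber_iff[OF RF xR Q] chamber_facesD(2)[OF R] by simp
  have xq: "q \<bullet> x \<noteq> 0" if "q \<in> Q" for q
    using face_subset_hyperplane_iff[OF RF xR, of q] int[OF that] Q that by blast
  have "dim R < dim E" using card dim_eq_card_independent[OF face_independent[OF RF]] by simp
  then obtain v where v: "v \<in> E" "v \<noteq> 0" "\<And>s. s \<in> span R \<Longrightarrow> v \<bullet> s = 0"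
    using wall_normal_exists[OF face_subset[OF RF]] by blast
  have "\<forall>\<^sub>F t in at_right 0. (\<forall>a\<in>N. a \<bullet> x \<noteq> 0 \<longrightarrow> sgn (a \<bullet> (x + t *\<^sub>R v)) = sgn (a \<bullet> x)) \<and>
      (\<forall>a\<in>N. a \<bullet> x \<noteq> 0 \<longrightarrow> sgn (a \<bullet> (x + t *\<^sub>R (- v))) = sgn (a \<bullet> x))"
    by (intro eventually_conj eventually_sgn_inner_add finite_N)
  then obtain t where t: "t > 0"
    "\<forall>a\<in>N. a \<bullet> x \<noteq> 0 \<longrightarrow> sgn (a \<bullet> (x + t *\<^sub>R v)) = sgn (a \<bullet> x)"
    "\<forall>a\<in>N. a \<bullet> x \<noteq> 0 \<longrightarrow> sgn (a \<bullet> (x + t *\<^sub>R (- v))) = sgn (a \<bullet> x)"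
    by (rule eventually_at_right_0E) blast
  have side: "\<exists>G. G \<in> chamber Q p \<and> R \<subset> G \<and> x + t *\<^sub>R u \<in> open_cone G"
    if u: "u \<in> E" "u \<notin> span R" and su: "\<forall>a\<in>N. a \<bullet> x \<noteq> 0 \<longrightarrow> sgn (a \<bullet> (x + t *\<^sub>R u)) = sgn (a \<bullet> x)" for u
  proof -
    let ?y = "x + t *\<^sub>R u"
    have yE: "?y \<in> E" using xE u subspace_E by (simp add: subspace_add subspace_scale)
    have xy: "x \<in> cell ?y" using xE su unfolding closed_cell_def by (intro CollectI conjI ballI) auto
    have "sgn (q \<bullet> ?y) = sgn (q \<bullet> p)" if "q \<in> Q" for q
      using su xq[OF that] closed_cell_sgnD[OF xC that xq[OF that]] that Q by auto
    then have yC: "?y \<in> closed_cell E Q p" using yE unfolding closed_cell_def by blast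
    obtain G where G: "G \<in> chamber Q p" "R \<subseteq> G" "?y \<in> open_cone G"
      using chamber_carrier[OF RF xR Q yC xy yE] .
    have "G \<noteq> R"
    proof
      assume "G = R"
      then have "?y \<in> span R" "x \<in> span R" using G(3) xR open_cone_span by blast+
      then have "?y - x \<in> span R" by (rule span_diff)
      then have "inverse t *\<^sub>R (?y - x) \<in> span R" by (rule span_scale)
      then show False using u(2) t(1) by simp
    qed
    then show ?thesis using G by blast
  qed
  have nv: "v \<notin> span R" using v(2) v(3)[of v] by auto
  then have nv': "- v \<notin> span R" using span_neg by force
  obtain G where G: "G \<in> chamber Q p" "R \<subset> G" "x + t *\<^sub>R v \<in> open_cone G"
    using side[OF v(1) nv t(2)] by blast
  obtain G' where G': "G' \<in> chamber Q p" "R \<subset> G'" "x + t *\<^sub>R (- v) \<in> open_cone G'"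
    using side[OF subspace_neg[OF subspace_E v(1)] nv' t(3)] by blast
  have GG': "G' = G" using ex1 G G' by blast
  note GF = chamber_facesD(1)[OF G(1)]
  obtain c where c: "\<And>w. w \<in> G \<Longrightarrow> 0 < c w" "x + t *\<^sub>R v = (\<Sum>w\<in>G. c w *\<^sub>R w)"
    using open_coneE[OF G(3)] by blast
  obtain d where d: "\<And>w. w \<in> G \<Longrightarrow> 0 < d w" "x + t *\<^sub>R (- v) = (\<Sum>w\<in>G. d w *\<^sub>R w)"
    using open_coneE[OF G'(3)[unfolded GG']] by blast
  have "(\<Sum>w\<in>G. (c w + d w) *\<^sub>R w) = (x + t *\<^sub>R v) + (x + t *\<^sub>R (- v))"
    unfolding c(2) d(2) by (simp add: scaleR_add_left sum.distrib)
  also have "\<dots> = 2 *\<^sub>R x" by (simp add: scaleR_2)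
  also have "\<dots> = (\<Sum>w\<in>R. 2 *\<^sub>R w)" by (simp add: x_def scaleR_sum_right)
  also have "\<dots> = (\<Sum>w\<in>G. (if w \<in> R then 2 else 0) *\<^sub>R w)"
    using G(2) by (intro sum.mono_neutral_cong_left) (auto simp: face_finite[OF GF])
  finally have eq: "(\<Sum>w\<in>G. (c w + d w) *\<^sub>R w) = (\<Sum>w\<in>G. (if w \<in> R then 2 else 0) *\<^sub>R w)" .
  obtain w where w: "w \<in> G" "w \<notin> R" using G(2) by blast
  have "c w + d w = 0"
    using independent_sum_eqD[OF face_independent[OF GF] face_finite[OF GF] eq w(1)] w(2) by simp
  then show False using c(1)[OF w(1)] d(1)[OF w(1)] by simp
qed

text \<open>By dimension \<open>R\<close> spans the wall, and each facet adds one vertex,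
  \<open>w\<close> or \<open>w'\<close>, on the same side. Hence \<open>w'\<close> is a positive
  multiple of \<open>w\<close> plus a vector of \<open>span R\<close>, and a point close to the
  barycentre of \<open>R\<close>, moved towards \<open>w'\<close>, lies in both open cones.\<close>

lemma wall_ridge_in_one_facet:
  assumes R: "R \<in> faces" and card: "card R + 1 = dim E" and q: "q \<in> N" "R \<subseteq> {x. q \<bullet> x = 0}"
    and G: "G \<in> faces" "R \<subset> G" and G': "G' \<in> faces" "R \<subset> G'"
    and side: "\<And>w. w \<in> G \<Longrightarrow> 0 \<le> s * (q \<bullet> w)" "\<And>w. w \<in> G' \<Longrightarrow> 0 \<le> s * (q \<bullet> w)"
    and s: "s \<noteq> 0" and E: "e \<in> E" "q \<bullet> e \<noteq> 0"
  shows "G = G'"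
proof -
  let ?H = "E \<inter> {x. q \<bullet> x = 0}"
  have H: "?H \<subseteq> span R"
  proof (rule card_ge_dim_independent[OF _ face_independent[OF R]])
    show "R \<subseteq> ?H" using face_subset[OF R] q by blast
    show "dim ?H \<le> card R" using dim_Int_hyperplane[OF subspace_E E] card by simp
  qed
  have facet: "\<exists>w. F = insert w R \<and> w \<notin> R \<and> q \<bullet> w \<noteq> 0" if F: "F \<in> faces" "R \<subset> F" for F
  proof -
    obtain w where w: "w \<in> F" "w \<notin> R" using F(2) by blast
    have fin: "finite F" using face_finite[OF F(1)] .
    have "card (insert w R) = dim E" using w card finite_subset[OF psubset_imp_subset[OF F(2)] fin] by simp
    moreover have "card F \<le> dim E" by (rule card_face_le[OF F(1)])
    ultimately have "insert w R = F" using card_seteq[OF fin, of "insert w R"] w F(2) by auto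
    moreover have "q \<bullet> w \<noteq> 0"
    proof
      assume "q \<bullet> w = 0"
      then have "w \<in> span R" using H w face_subset[OF F(1)] by blast
      moreover have "independent (insert w R)" using face_independent[OF F(1)] \<open>insert w R = F\<close> by simp
      ultimately show False using w(2) by (simp add: independent_insert)
    qed
    ultimately show ?thesis using w(2) by blast
  qed
  obtain w where w: "G = insert w R" "w \<notin> R" "q \<bullet> w \<noteq> 0" using facet[OF G] by blast
  obtain w' where w': "G' = insert w' R" "w' \<notin> R" "q \<bullet> w' \<noteq> 0" using facet[OF G'] by blast
  have finR: "finite R" by (rule face_finite[OF R])
  define k where "k = (q \<bullet> w') / (q \<bullet> w)"
  have s0: "0 \<le> s * (q \<bullet> w)" "0 \<le> s * (q \<bullet> w')" using side w(1) w'(1) by auto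
  have k: "k > 0"
    using s s0 w(3) w'(3) unfolding k_def by (auto simp: zero_less_divide_iff zero_le_mult_iff)
  have wE: "w \<in> E" "w' \<in> E" using face_subset[OF G(1)] face_subset[OF G'(1)] w(1) w'(1) by auto
  have "q \<bullet> (w' - k *\<^sub>R w) = 0" using w(3) by (simp add: k_def inner_diff_right)
  moreover have "w' - k *\<^sub>R w \<in> E" using wE subspace_E by (simp add: subspace_diff subspace_scale)
  ultimately have "w' - k *\<^sub>R w \<in> span R" using H by blast
  then obtain r where r: "w' - k *\<^sub>R w = (\<Sum>v\<in>R. r v *\<^sub>R v)" using span_finite[OF finR] by auto
  \<comment> \<open>Small enough that \<open>\<bar>t * r v\<bar> < 1\<close> for all
    \<open>v\<close>, so that the coefficients \<open>1 + t * r v\<close> on \<open>R\<close> stay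
    positive.\<close>
  define t where "t = 1 / (1 + (\<Sum>v\<in>R. \<bar>r v\<bar>))"
  have S0: "0 \<le> (\<Sum>v\<in>R. \<bar>r v\<bar>)" by (intro sum_nonneg) simp
  then have "0 < 1 + (\<Sum>v\<in>R. \<bar>r v\<bar>)" by linarith
  then have t: "t > 0" by (simp only: t_def zero_less_divide_1_iff)
  have pos: "0 < 1 + t * r v" if "v \<in> R" for v
  proof -
    have "\<bar>r v\<bar> \<le> (\<Sum>v\<in>R. \<bar>r v\<bar>)" using that finR by (intro member_le_sum) auto
    then have "t * \<bar>r v\<bar> \<le> t * (\<Sum>v\<in>R. \<bar>r v\<bar>)" using t by (intro mult_left_mono) auto
    moreover have "t + t * (\<Sum>v\<in>R. \<bar>r v\<bar>) = 1"
      using \<open>0 < 1 + (\<Sum>v\<in>R. \<bar>r v\<bar>)\<close> unfolding t_def by (simp add: field_simps)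
    moreover have "\<bar>t * r v\<bar> = t * \<bar>r v\<bar>" using t by (simp add: abs_mult)
    ultimately show ?thesis using t by linarith
  qed
  define y where "y = \<Sum>R + t *\<^sub>R w'"
  have "y = (\<Sum>v\<in>G'. (if v = w' then t else 1) *\<^sub>R v)"
  proof -
    have "(\<Sum>v\<in>R. (if v = w' then t else 1) *\<^sub>R v) = \<Sum>R" using w'(2) by (intro sum.cong) auto
    then show ?thesis unfolding y_def w'(1) using finR w'(2) by simp
  qed
  then have yG': "y \<in> open_cone G'" using open_coneI[of G' "\<lambda>v. if v = w' then t else 1"] t by simp
  have "y = (\<Sum>v\<in>G. (if v = w then t * k else 1 + t * r v) *\<^sub>R v)"
  proof -
    have "(\<Sum>v\<in>R. (if v = w then t * k else 1 + t * r v) *\<^sub>R v) = (\<Sum>v\<in>R. v + t *\<^sub>R (r v *\<^sub>R v))"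
      using w(2) by (intro sum.cong) (auto simp: scaleR_add_left)
    also have "\<dots> = \<Sum>R + t *\<^sub>R (w' - k *\<^sub>R w)" unfolding r by (simp add: sum.distrib scaleR_sum_right)
    finally show ?thesis unfolding y_def w(1) using finR w(2) by (simp add: scaleR_diff_right)
  qed
  moreover have "0 < (if v = w then t * k else 1 + t * r v)" if "v \<in> G" for v
    using t k pos[of v] that w(1) by auto
  ultimately have yG: "y \<in> open_cone G"
    using open_coneI[of G "\<lambda>v. if v = w then t * k else 1 + t * r v"] by presburger
  show ?thesis by (rule carrier_unique[OF G(1) G'(1) yG yG'])
qed

text \<open>
  If the face \<open>R\<close> had codimension at least two in the span, moving from its barycentre towards a
  combination of \<open>p\<close> and \<open>- p\<close> that is slightly tilted in a direction orthogonal to \<open>p\<close> and \<open>R\<close>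
  would meet the boundary of the chamber outside the span of \<open>R\<close>.
\<close>

lemma maximal_wall_face_card:
  assumes Q: "Q \<subseteq> N" and p: "p \<in> E" "\<And>q. q \<in> Q \<Longrightarrow> q \<bullet> p \<noteq> 0"
    and R: "R \<in> chamber Q p" and q0: "q0 \<in> Q" "R \<subseteq> {x. q0 \<bullet> x = 0}"
    and max: "\<And>G q. G \<in> chamber Q p \<Longrightarrow> q \<in> Q \<Longrightarrow> R \<subseteq> G \<Longrightarrow> G \<subseteq> {x. q \<bullet> x = 0} \<Longrightarrow> G = R"
  shows "card R + 1 = dim E"
proof (rule ccontr)
  assume neq: "card R + 1 \<noteq> dim E"
  note RF = chamber_facesD(1)[OF R]
  have finQ: "finite Q" using Q finite_N by (rule finite_subset)
  have "card R \<le> dim (E \<inter> {x. q0 \<bullet> x = 0})"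
    by (rule independent_card_le_dim[OF _ face_independent[OF RF]]) (use face_subset[OF RF] q0 in blast)
  then have lt: "card R + 1 < dim E" using dim_Int_hyperplane[OF subspace_E p(1) p(2)[OF q0(1)]] neq by simp
  have "dim (insert p R) \<le> card (insert p R)" using face_finite[OF RF] by (intro dim_le_card') simp
  also have "\<dots> \<le> card R + 1" using face_finite[OF RF] by (simp add: card_insert_if)
  finally have "dim (insert p R) < dim E" using lt by simp
  moreover have "insert p R \<subseteq> E" using p(1) face_subset[OF RF] by simp
  ultimately obtain v where v: "v \<in> E" "v \<noteq> 0" "\<And>s. s \<in> span (insert p R) \<Longrightarrow> v \<bullet> s = 0"
    using wall_normal_exists by blast
  have vp: "v \<bullet> p = 0" using v(3)[of p] by (simp add: span_base)
  have vR: "v \<bullet> z = 0" if "z \<in> span R" for z using v(3) span_mono[of R "insert p R"] that by blast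
  obtain e where e: "e > 0" "\<And>a. a \<in> Q \<Longrightarrow> a \<bullet> p \<noteq> 0 \<Longrightarrow> sgn (a \<bullet> (p + e *\<^sub>R v)) = sgn (a \<bullet> p)"
    using sgn_inner_addE[OF finQ] by blast
  \<comment> \<open>\<open>p'\<close> has the same signs on \<open>Q\<close> as \<open>p\<close>,
    but a positive product with \<open>v\<close>, while \<open>p\<close> and \<open>R\<close> are
    orthogonal to \<open>v\<close>.\<close>
  define p' where "p' = p + e *\<^sub>R v"
  have p'E: "p' \<in> E" unfolding p'_def using p v subspace_E by (simp add: subspace_add subspace_scale)
  define \<alpha> where "\<alpha> q = \<bar>q \<bullet> p'\<bar>" for q
  define \<beta> where "\<beta> q = \<bar>q \<bullet> p\<bar>" for q
  have \<alpha>: "q \<bullet> p' = sgn (q \<bullet> p) * \<alpha> q" if "q \<in> Q" for q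
    unfolding \<alpha>_def using e(2)[OF that p(2)[OF that]] mult_sgn_abs[of "q \<bullet> p'"] by (simp add: p'_def)
  have \<beta>: "q \<bullet> p = sgn (q \<bullet> p) * \<beta> q" for q
    unfolding \<beta>_def by (simp add: mult_sgn_abs)
  have \<alpha>0: "\<alpha> q > 0" if "q \<in> Q" for q
    unfolding \<alpha>_def p'_def using e(2)[OF that p(2)[OF that]] p(2)[OF that] by (metis sgn_0_0 zero_less_abs_iff)
  have \<beta>0: "\<beta> q > 0" if "q \<in> Q" for q unfolding \<beta>_def using p(2)[OF that] by simp
  define x where "x = \<Sum>R"
  have xR: "x \<in> open_cone R" unfolding x_def by (rule sum_in_open_cone)
  have xE: "x \<in> E" using open_cone_subset_E[OF RF] xR by blast
  have xC: "x \<in> closed_cell E Q p"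
    using face_subset_chamber_iff[OF RF xR Q] chamber_facesD(2)[OF R] by simp
  define Q0 where "Q0 = {q \<in> Q. q \<bullet> x = 0}"
  have "q0 \<bullet> x = 0" using face_subset_hyperplane_iff[OF RF xR, of q0] q0 Q by blast
  then have "Q0 \<noteq> {}" "finite Q0" using finQ q0 by (auto simp: Q0_def)
  \<comment> \<open>The value of \<open>s\<close> at which \<open>q\<close> vanishes on
    \<open>s *\<^sub>R p' - (1 - s) *\<^sub>R p\<close>. The largest threshold among the walls
    through \<open>x\<close> puts the direction on one of these walls and on the right side of, or
    on, all the others.\<close>
  define thr where "thr q = \<beta> q / (\<alpha> q + \<beta> q)" for q
  have "Max (thr ` Q0) \<in> thr ` Q0" using \<open>Q0 \<noteq> {}\<close> \<open>finite Q0\<close> by simp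
  then obtain q1 where q1: "q1 \<in> Q0" "thr q1 = Max (thr ` Q0)" by auto
  define s where "s = thr q1"
  have s_ge: "thr q \<le> s" if "q \<in> Q0" for q unfolding s_def q1(2) using that \<open>finite Q0\<close> by simp
  have q1Q: "q1 \<in> Q" "q1 \<bullet> x = 0" using q1(1) by (auto simp: Q0_def)
  have s0: "s > 0" unfolding s_def thr_def using \<alpha>0[OF q1Q(1)] \<beta>0[OF q1Q(1)] by simp
  define u where "u = s *\<^sub>R p' - (1 - s) *\<^sub>R p"
  have uE: "u \<in> E" unfolding u_def using p p'E subspace_E by (simp add: subspace_diff subspace_scale)
  have qu: "q \<bullet> u = sgn (q \<bullet> p) * (s * (\<alpha> q + \<beta> q) - \<beta> q)" if "q \<in> Q" for q
  proof -
    have "q \<bullet> u = s * (q \<bullet> p') - (1 - s) * (q \<bullet> p)" by (simp add: u_def inner_diff_right)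
    also have "\<dots> = s * (sgn (q \<bullet> p) * \<alpha> q) - (1 - s) * (sgn (q \<bullet> p) * \<beta> q)"
      using \<alpha>[OF that] \<beta>[of q] by simp
    finally show ?thesis by (simp add: algebra_simps)
  qed
  have nonneg: "0 \<le> s * (\<alpha> q + \<beta> q) - \<beta> q" if "q \<in> Q0" for q
    using s_ge[OF that] \<alpha>0[of q] \<beta>0[of q] that by (simp add: thr_def divide_simps Q0_def split: if_splits)
  have "s * (\<alpha> q1 + \<beta> q1) - \<beta> q1 = 0"
    using \<alpha>0[OF q1Q(1)] \<beta>0[OF q1Q(1)] by (simp add: s_def thr_def)
  then have q1u: "q1 \<bullet> u = 0" using qu[OF q1Q(1)] by simp
  obtain t where t: "t > 0" "\<And>a. a \<in> N \<Longrightarrow> a \<bullet> x \<noteq> 0 \<Longrightarrow> sgn (a \<bullet> (x + t *\<^sub>R u)) = sgn (a \<bullet> x)"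
    using sgn_inner_addE[OF finite_N] by blast
  define y where "y = x + t *\<^sub>R u"
  have yE: "y \<in> E" unfolding y_def using xE uE subspace_E by (simp add: subspace_add subspace_scale)
  have xy: "x \<in> cell y" using xE t(2) unfolding closed_cell_def y_def by force
  have "q \<bullet> y = 0 \<or> sgn (q \<bullet> y) = sgn (q \<bullet> p)" if "q \<in> Q" for q
  proof (cases "q \<bullet> x = 0")
    case True
    define k where "k = t * (s * (\<alpha> q + \<beta> q) - \<beta> q)"
    have "0 \<le> k" unfolding k_def using nonneg[of q] True that t(1) by (simp add: Q0_def)
    moreover have "q \<bullet> y = sgn (q \<bullet> p) * k"
      using qu[OF that] True by (simp add: y_def k_def inner_add_right)
    ultimately show ?thesis by (cases "k = 0") (auto simp: sgn_mult)
  next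
    case False
    then show ?thesis using t(2)[of q] closed_cell_sgnD[OF xC that False] that Q by (auto simp: y_def)
  qed
  then have yC: "y \<in> closed_cell E Q p" using yE unfolding closed_cell_def by blast
  obtain G where G: "G \<in> chamber Q p" "R \<subseteq> G" "y \<in> open_cone G"
    using chamber_carrier[OF RF xR Q yC xy yE] .
  have "q1 \<bullet> y = 0" using q1Q q1u by (simp add: y_def inner_add_right)
  then have "G \<subseteq> {x. q1 \<bullet> x = 0}"
    using face_subset_hyperplane_iff[OF chamber_facesD(1)[OF G(1)] G(3)] q1Q Q by blast
  then have "G = R" using max[OF G(1) q1Q(1) G(2)] by simp
  \<comment> \<open>By maximality the step has not left the span of \<open>R\<close>, so
    \<open>v\<close> must vanish on the direction \<open>u\<close>. But only the tilt of
    \<open>p'\<close> contributes to \<open>v \<bullet> u\<close>, and its contribution is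
    positive.\<close>
  then have "v \<bullet> y = 0" "v \<bullet> x = 0" using vR G(3) xR open_cone_span by blast+
  then have "v \<bullet> u = 0" using t(1) by (simp add: y_def inner_add_right)
  moreover have "v \<bullet> u = s * e * (v \<bullet> v)"
    using vp by (simp add: u_def p'_def inner_diff_right inner_add_right)
  ultimately show False using s0 e(1) v(2) by simp
qed

text \<open>A ridge off the walls lies in several facets, so boundary ridges lie on walls.
  Conversely, a face on a wall extends to a maximal one among such faces, which has codimension one
  and, since the chamber stays on one side of the wall, lies in exactly one facet.\<close>

lemma ball_boundary_chamber:
  assumes Q: "Q \<subseteq> N" and p: "p \<in> E" "\<And>q. q \<in> Q \<Longrightarrow> q \<bullet> p \<noteq> 0"
  shows "ball_boundary (chamber Q p) =
    {W \<in> chamber Q p. \<exists>q\<in>Q. W \<subseteq> {x. q \<bullet> x = 0}}" (is "ball_boundary ?D = ?B")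
proof
  have ridge: "face_dim R = complex_dim ?D - 1 \<longleftrightarrow> card R + 1 = dim E" for R
    using complex_dim_chamber[OF assms] unfolding face_dim_def by auto
  show "ball_boundary ?D \<subseteq> ?B"
  proof
    fix F assume "F \<in> ball_boundary ?D"
    then have "\<exists>R\<in>?D. F \<subseteq> R \<and> card R + 1 = dim E \<and> (\<exists>!G. G \<in> ?D \<and> R \<subset> G)"
      unfolding ball_boundary_def ridge by (rule CollectD)
    then obtain R where R: "R \<in> ?D" "F \<subseteq> R" "card R + 1 = dim E" and R1: "\<exists>!G. G \<in> ?D \<and> R \<subset> G"
      by (elim bexE conjE) (rule that)
    have "\<exists>q\<in>Q. R \<subseteq> {x. q \<bullet> x = 0}"
    proof (rule ccontr)
      assume "\<not> ?thesis"
      then have "\<not> R \<subseteq> {x. q \<bullet> x = 0}" if "q \<in> Q" for q using that by blast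
      moreover have "card R < dim E" using R(3) by simp
      ultimately show False using interior_ridge_in_two_facets[OF Q R(1)] R1 by simp
    qed
    then show "F \<in> ?B" using chamber_face_down_closed[OF R(1,2)] R(2) by blast
  qed
  show "?B \<subseteq> ball_boundary ?D"
  proof
    fix W assume "W \<in> ?B"
    then obtain q' where W: "W \<in> ?D" "q' \<in> Q" "W \<subseteq> {x. q' \<bullet> x = 0}" by blast
    have "finite ?B" using abstract_complex_chamber unfolding abstract_complex_def by simp
    from finite_has_maximal2[OF this \<open>W \<in> ?B\<close>]
    obtain R where R: "R \<in> ?B" "W \<subseteq> R" and maxB: "\<forall>G\<in>?B. R \<subseteq> G \<longrightarrow> R = G"
      by (elim bexE conjE) (rule that)
    then obtain q where q: "q \<in> Q" "R \<subseteq> {x. q \<bullet> x = 0}" by blast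
    have RD: "R \<in> ?D" using R(1) by blast
    have maxR: "G = R" if "G \<in> ?D" "q \<in> Q" "R \<subseteq> G" "G \<subseteq> {x. q \<bullet> x = 0}" for G q
      using maxB that by blast
    have card: "card R + 1 = dim E"
      by (rule maximal_wall_face_card[OF Q p RD q]) (use maxR in blast)+
    obtain G where G: "G \<in> ?D" "R \<subseteq> G" "card G = dim E" using chamber_facet_exists[OF assms RD] .
    have RG: "R \<subset> G" using G card by auto
    have side: "0 \<le> sgn (q \<bullet> p) * (q \<bullet> w)" if "F \<in> ?D" "w \<in> F" for F w
    proof (cases "q \<bullet> w = 0")
      case False
      have "w \<in> closed_cell E Q p" using that chamber_facesD(2) by blast
      then have "sgn (q \<bullet> p) = sgn (q \<bullet> w)" using closed_cell_sgnD[OF _ q(1) False] by simp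
      then show ?thesis by (simp add: sgn_if)
    qed simp
    have "G' = G" if "G' \<in> ?D" "R \<subset> G'" for G'
    proof -
      have qN: "q \<in> N" using q(1) Q by blast
      have s0: "sgn (q \<bullet> p) \<noteq> 0" using p(2)[OF q(1)] by (simp only: sgn_0_0 not_False_eq_True)
      show ?thesis
      proof (rule wall_ridge_in_one_facet[OF chamber_facesD(1)[OF RD] card qN q(2) chamber_facesD(1)[OF that(1)]
            that(2) chamber_facesD(1)[OF G(1)] RG _ _ s0 p(1) p(2)[OF q(1)]])
        fix w assume "w \<in> G'" then show "0 \<le> sgn (q \<bullet> p) * (q \<bullet> w)" by (rule side[OF that(1)])
      next
        fix w assume "w \<in> G" then show "0 \<le> sgn (q \<bullet> p) * (q \<bullet> w)" by (rule side[OF G(1)])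
      qed
    qed
    note uniq = this
    have "\<exists>!G. G \<in> ?D \<and> R \<subset> G"
    proof (rule ex1I)
      show "G \<in> ?D \<and> R \<subset> G" by (rule conjI[OF G(1) RG])
      show "G' = G" if "G' \<in> ?D \<and> R \<subset> G'" for G'
        by (rule uniq[OF conjunct1[OF that] conjunct2[OF that]])
    qed
    with RD R(2) card show "W \<in> ball_boundary ?D"
      unfolding ball_boundary_def ridge by (intro CollectI bexI[of _ R] conjI)
  qed
qed

end


section \<open>Polytopality\<close>

context simplicial_fan
begin

text \<open>
  The sum of the \<open>\<bar>a \<bullet> x\<bar>\<close> is the support function of a zonotope, linear on every cell of the fan; its
  unit ball, the polar of the zonotope, is a polytope whose boundary is triangulated by the fan.
\<close>

definition zonorm :: "'a \<Rightarrow> real" where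
  "zonorm x = (\<Sum>a\<in>N. \<bar>a \<bullet> x\<bar>)"

text \<open>The linear functional that agrees with \<open>zonorm\<close> on the cell of
  \<open>x\<close>. Since \<open>sgn 0 = 0\<close>, it is the centre of the zonotope face that is
  extreme in direction \<open>x\<close>.\<close>

definition supporting :: "'a \<Rightarrow> 'a" where
  "supporting x = (\<Sum>a\<in>N. sgn (a \<bullet> x) *\<^sub>R a)"

definition polar_ball :: "'a set" where
  "polar_ball = {x \<in> E. zonorm x \<le> 1}"

definition unit_ray :: "'a \<Rightarrow> 'a" where
  "unit_ray w = (1 / zonorm w) *\<^sub>R w"

section \<open>The zonotopal norm and its linearity on cells\<close>

lemma zonorm_nonneg: "0 \<le> zonorm x"
  unfolding zonorm_def by (intro sum_nonneg) simp

lemma zonorm_scale: "0 \<le> c \<Longrightarrow> zonorm (c *\<^sub>R x) = c * zonorm x"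
  unfolding zonorm_def by (simp add: abs_mult sum_distrib_left)

lemma zonorm_zero: "zonorm 0 = 0"
  by (simp add: zonorm_def)

lemma zonorm_minus: "zonorm (- x) = zonorm x"
  by (simp add: zonorm_def)

lemma zonorm_add: "zonorm (x + y) \<le> zonorm x + zonorm y"
  unfolding zonorm_def sum.distrib[symmetric] by (intro sum_mono) (simp add: inner_add_right)

lemma zonorm_pos: "x \<in> E \<Longrightarrow> x \<noteq> 0 \<Longrightarrow> 0 < zonorm x"
proof (rule ccontr)
  assume x: "x \<in> E" "x \<noteq> 0" "\<not> 0 < zonorm x"
  then have "(\<Sum>a\<in>N. \<bar>a \<bullet> x\<bar>) = 0" using zonorm_nonneg[of x] unfolding zonorm_def by linarith
  then have "a \<bullet> x = 0" if "a \<in> N" for a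
    using that sum_nonneg_eq_0_iff[OF finite_N, of "\<lambda>a. \<bar>a \<bullet> x\<bar>"] by simp
  then show False using essential_N[OF x(1)] x(2) by blast
qed

text \<open>Termwise \<open>sgn u * v \<le> \<bar>v\<bar>\<close>, and equality in every term is
  exactly the sign condition that defines the cell of \<open>x\<close>.\<close>

lemma supporting_le: "supporting x \<bullet> y \<le> zonorm y"
  and supporting_eq_iff: "y \<in> E \<Longrightarrow> supporting x \<bullet> y = zonorm y \<longleftrightarrow> y \<in> cell x"
proof -
  have s: "supporting x \<bullet> y = (\<Sum>a\<in>N. sgn (a \<bullet> x) * (a \<bullet> y))"
    by (simp add: supporting_def inner_sum_left)
  have le: "sgn u * v \<le> \<bar>v\<bar>" for u v :: real by (auto simp: sgn_if)
  have eq: "\<bar>v\<bar> - sgn u * v = 0 \<longleftrightarrow> v = 0 \<or> sgn v = sgn u" for u v :: real by (auto simp: sgn_if)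
  show "supporting x \<bullet> y \<le> zonorm y" unfolding s zonorm_def by (intro sum_mono le)
  assume "y \<in> E"
  have "supporting x \<bullet> y = zonorm y \<longleftrightarrow> (\<Sum>a\<in>N. \<bar>a \<bullet> y\<bar> - sgn (a \<bullet> x) * (a \<bullet> y)) = 0"
    unfolding s zonorm_def sum_subtractf by auto
  also have "\<dots> \<longleftrightarrow> (\<forall>a\<in>N. \<bar>a \<bullet> y\<bar> - sgn (a \<bullet> x) * (a \<bullet> y) = 0)"
    using le by (intro sum_nonneg_eq_0_iff finite_N) simp
  also have "\<dots> \<longleftrightarrow> y \<in> cell x" unfolding eq closed_cell_def using \<open>y \<in> E\<close> by simp
  finally show "supporting x \<bullet> y = zonorm y \<longleftrightarrow> y \<in> cell x" .
qed

lemma face_zonorm_pos: "W \<in> faces \<Longrightarrow> w \<in> W \<Longrightarrow> 0 < zonorm w"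
  using zonorm_pos face_subset face_independent dependent_zero by blast

lemma sum_unit_ray:
  assumes "W \<in> faces"
  shows "(\<Sum>w\<in>W. c w *\<^sub>R w) = (\<Sum>w\<in>W. (c w * zonorm w) *\<^sub>R unit_ray w)"
  using face_zonorm_pos[OF assms] by (intro sum.cong) (auto simp: unit_ray_def less_imp_neq[THEN not_sym])

text \<open>On one cell the norm coincides with a single linear functional, so it is additive
  there.\<close>

lemma zonorm_sum:
  assumes "W \<in> faces" "\<And>w. w \<in> W \<Longrightarrow> 0 \<le> c w"
  shows "zonorm (\<Sum>w\<in>W. c w *\<^sub>R w) = (\<Sum>w\<in>W. c w * zonorm w)"
proof -
  obtain x where x: "x \<in> E" "convex_cone hull W = cell x" using assms(1) by (auto simp: fan_faces_def)
  have w: "supporting x \<bullet> w = zonorm w" if "w \<in> W" for w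
    using supporting_eq_iff[of w x] x hull_inc[OF that, of convex_cone] by (simp add: closed_cell_def)
  have "(\<Sum>w\<in>W. c w *\<^sub>R w) \<in> cell x"
    using convex_cone_hull_sumI[OF face_finite[OF assms(1)] assms(2)] x by simp
  then have "zonorm (\<Sum>w\<in>W. c w *\<^sub>R w) = supporting x \<bullet> (\<Sum>w\<in>W. c w *\<^sub>R w)"
    using supporting_eq_iff[of "\<Sum>w\<in>W. c w *\<^sub>R w" x] by (simp add: closed_cell_def)
  also have "\<dots> = (\<Sum>w\<in>W. c w * zonorm w)" by (simp add: inner_sum_right w)
  finally show ?thesis .
qed

section \<open>The proper faces of the polar ball are the simplices over the faces of the
  fan\<close>

lemma convex_polar_ball: "convex polar_ball"
proof (rule convexI)
  fix x y :: 'a and u v :: real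
  assume *: "x \<in> polar_ball" "y \<in> polar_ball" "0 \<le> u" "0 \<le> v" "u + v = 1"
  have "zonorm (u *\<^sub>R x + v *\<^sub>R y) \<le> u * zonorm x + v * zonorm y"
    using zonorm_add[of "u *\<^sub>R x" "v *\<^sub>R y"] * by (simp add: zonorm_scale)
  also have "\<dots> \<le> u * 1 + v * 1" using * by (intro add_mono mult_left_mono) (auto simp: polar_ball_def)
  finally have "zonorm (u *\<^sub>R x + v *\<^sub>R y) \<le> 1" using * by simp
  then show "u *\<^sub>R x + v *\<^sub>R y \<in> polar_ball"
    using * subspace_E by (auto simp: polar_ball_def subspace_add subspace_scale)
qed

text \<open>On the ball \<open>supporting x \<bullet> y \<le> zonorm y \<le> 1\<close>. Equality
  throughout forces \<open>y\<close> into the cell with norm 1, and additivity of the norm then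
  makes the coefficients over the unit rays sum to 1.\<close>

lemma hull_unit_rays:
  assumes W: "W \<in> faces" and x: "convex_cone hull W = cell x"
  shows "convex hull (unit_ray ` W) = polar_ball \<inter> {y. supporting x \<bullet> y = 1}"
proof
  show "convex hull (unit_ray ` W) \<subseteq> polar_ball \<inter> {y. supporting x \<bullet> y = 1}"
  proof (rule hull_minimal)
    show "convex (polar_ball \<inter> {y. supporting x \<bullet> y = 1})"
      by (intro convex_Int convex_polar_ball convex_hyperplane)
    show "unit_ray ` W \<subseteq> polar_ball \<inter> {y. supporting x \<bullet> y = 1}"
    proof
      fix y assume "y \<in> unit_ray ` W"
      then obtain w where w: "w \<in> W" "y = unit_ray w" by blast
      have pos: "0 < zonorm w" by (rule face_zonorm_pos[OF W w(1)])
      have "y \<in> convex_cone hull W"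
        unfolding w(2) unit_ray_def using pos by (intro convex_cone_hull_mul hull_inc w) simp
      then have yc: "y \<in> cell x" using x by simp
      have yE: "y \<in> E" using yc by (simp add: closed_cell_def)
      have "zonorm y = 1" using pos by (simp add: w(2) unit_ray_def zonorm_scale)
      then show "y \<in> polar_ball \<inter> {y. supporting x \<bullet> y = 1}"
        using yE yc supporting_eq_iff[OF yE, of x] by (simp add: polar_ball_def)
    qed
  qed
  show "polar_ball \<inter> {y. supporting x \<bullet> y = 1} \<subseteq> convex hull (unit_ray ` W)"
  proof
    fix y assume y: "y \<in> polar_ball \<inter> {y. supporting x \<bullet> y = 1}"
    then have yE: "y \<in> E" and le: "zonorm y \<le> 1" and one: "supporting x \<bullet> y = 1"
      by (auto simp: polar_ball_def)
    have fy: "zonorm y = 1" using le one supporting_le[of x y] by simp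
    then have "y \<in> convex_cone hull W" using supporting_eq_iff[OF yE] one x by simp
    then obtain c where c: "\<And>w. w \<in> W \<Longrightarrow> 0 \<le> c w" "y = (\<Sum>w\<in>W. c w *\<^sub>R w)"
      using convex_cone_hullE[OF face_finite[OF W]] by blast
    have "(\<Sum>w\<in>W. c w * zonorm w) = 1" using zonorm_sum[OF W c(1)] fy c(2) by simp
    then have "(\<Sum>w\<in>W. (c w * zonorm w) *\<^sub>R unit_ray w) \<in> convex hull (unit_ray ` W)"
      using c(1) zonorm_nonneg by (intro convex_sum face_finite[OF W]) (auto intro: hull_inc)
    then show "y \<in> convex hull (unit_ray ` W)" using c(2) sum_unit_ray[OF W, of c] by simp
  qed
qed

lemma hull_unit_rays_face:
  assumes "W \<in> faces"
  shows "convex hull (unit_ray ` W) face_of polar_ball"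
proof -
  obtain x where x: "convex_cone hull W = cell x" using assms by (auto simp: fan_faces_def)
  have "supporting x \<bullet> y \<le> 1" if "y \<in> polar_ball" for y
    using that supporting_le[of x y] by (simp add: polar_ball_def)
  then show ?thesis
    unfolding hull_unit_rays[OF assms x]
    by (rule face_of_Int_supporting_hyperplane_le[OF convex_polar_ball])
qed

lemma inj_on_unit_ray: "inj_on unit_ray (\<Union>faces)"
proof (rule inj_onI)
  fix v w assume v: "v \<in> \<Union>faces" and w: "w \<in> \<Union>faces" and eq: "unit_ray v = unit_ray w"
  have pos: "0 < zonorm v" "0 < zonorm w" using v w face_zonorm_pos by auto
  have "zonorm w *\<^sub>R unit_ray v = zonorm w *\<^sub>R unit_ray w" using eq by simp
  then have "w = (zonorm w / zonorm v) *\<^sub>R v" using pos by (simp add: unit_ray_def)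
  moreover have "v \<in> Z" "w \<in> Z" using v w face_rays by auto
  ultimately show "v = w" using rays_Z[of v "zonorm w / zonorm v"] pos by auto
qed

lemma inj_on_unit_ray_face: "W \<in> faces \<Longrightarrow> inj_on unit_ray W"
  using inj_on_unit_ray inj_on_subset by blast

lemma unit_rays_affine_independent:
  assumes W: "W \<in> faces"
  shows "\<not> affine_dependent (unit_ray ` W)"
proof -
  have fin: "finite W" by (rule face_finite[OF W])
  have "W \<subseteq> span (unit_ray ` W)"
  proof
    fix w assume w: "w \<in> W"
    have "zonorm w *\<^sub>R unit_ray w \<in> span (unit_ray ` W)" using w by (intro span_scale span_base) simp
    then show "w \<in> span (unit_ray ` W)" using face_zonorm_pos[OF W w] by (simp add: unit_ray_def)
  qed
  then have "card W \<le> dim (span (unit_ray ` W))"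
    by (rule independent_card_le_dim[OF _ face_independent[OF W]])
  then have "card (unit_ray ` W) \<le> dim (span (unit_ray ` W))"
    using card_image_le[OF fin, of unit_ray] by simp
  then have "independent (unit_ray ` W)"
    by (intro card_le_dim_spanning[of _ "span (unit_ray ` W)"]) (auto simp: span_superset fin)
  then show ?thesis using affine_dependent_imp_dependent by blast
qed

lemma open_cone_rel_interior:
  assumes W: "W \<in> faces" and x: "x \<in> open_cone W" "zonorm x = 1"
  shows "x \<in> rel_interior (convex hull (unit_ray ` W))"
proof -
  obtain c where c: "\<And>w. w \<in> W \<Longrightarrow> 0 < c w" "x = (\<Sum>w\<in>W. c w *\<^sub>R w)"
    using open_coneE[OF x(1)] by blast
  define r where "r = the_inv_into W unit_ray"
  have inj: "inj_on unit_ray W" by (rule inj_on_unit_ray_face[OF W])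
  have r: "r (unit_ray w) = w" if "w \<in> W" for w
    unfolding r_def by (rule the_inv_into_f_f[OF inj that])
  define u where "u y = c (r y) * zonorm (r y)" for y
  have "\<forall>y\<in>unit_ray ` W. 0 < u y" using c(1) face_zonorm_pos[OF W] by (auto simp: u_def r)
  moreover have "sum u (unit_ray ` W) = 1"
  proof -
    have "sum u (unit_ray ` W) = (\<Sum>w\<in>W. c w * zonorm w)"
      unfolding sum.reindex[OF inj] by (intro sum.cong) (auto simp: u_def r)
    then show ?thesis using zonorm_sum[OF W, of c] c x(2) by (simp add: less_imp_le)
  qed
  moreover have "(\<Sum>y\<in>unit_ray ` W. u y *\<^sub>R y) = x"
  proof -
    have "(\<Sum>y\<in>unit_ray ` W. u y *\<^sub>R y) = (\<Sum>w\<in>W. (c w * zonorm w) *\<^sub>R unit_ray w)"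
      unfolding sum.reindex[OF inj] by (intro sum.cong) (auto simp: u_def r)
    then show ?thesis using sum_unit_ray[OF W, of c] c(2) by simp
  qed
  ultimately show ?thesis
    unfolding rel_interior_convex_hull_explicit[OF unit_rays_affine_independent[OF W]] by blast
qed

text \<open>A face containing a point of norm less than 1 is the whole ball, as a segment from any
  \<open>y\<close> can be prolonged beyond that point. So a relative interior point of a proper
  nonempty face has norm 1; the simplex of its carrier is a face with the same relative interior
  point, and two such faces coincide.\<close>

lemma proper_face_polar_ball:
  assumes F: "F face_of polar_ball" "F \<noteq> polar_ball"
  obtains W where "W \<in> faces" "F = convex hull (unit_ray ` W)"
proof (cases "F = {}")
  case True
  then show ?thesis using that[OF empty_face] by simp
next
  case False
  have "convex F" by (rule face_of_imp_convex[OF F(1)])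
  then obtain x where x: "x \<in> rel_interior F" using False rel_interior_eq_empty by blast
  then have xF: "x \<in> F" using rel_interior_subset by blast
  then have xP: "x \<in> E" "zonorm x \<le> 1" using face_of_imp_subset[OF F(1)] by (auto simp: polar_ball_def)
  have "zonorm x = 1"
  proof (rule ccontr)
    assume "zonorm x \<noteq> 1"
    then have lt: "zonorm x < 1" using xP by simp
    have "y \<in> F" if y: "y \<in> polar_ball" for y
    proof (cases "y = x")
      case False
      have yP: "y \<in> E" "zonorm y \<le> 1" using y by (auto simp: polar_ball_def)
      \<comment> \<open>Half the slack: \<open>z\<close> overshoots \<open>x\<close> by
        \<open>e\<close> times \<open>x - y\<close>, which raises the norm by at most
        \<open>2 * e\<close>.\<close>
      define e where "e = (1 - zonorm x) / 2"
      have e: "0 < e" using lt by (simp add: e_def)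
      define z where "z = (1 + e) *\<^sub>R x - e *\<^sub>R y"
      have zE: "z \<in> E" unfolding z_def using xP yP subspace_E by (simp add: subspace_diff subspace_scale)
      have "zonorm z \<le> zonorm ((1 + e) *\<^sub>R x) + zonorm (e *\<^sub>R y)"
        unfolding z_def using zonorm_add[of "(1 + e) *\<^sub>R x" "- (e *\<^sub>R y)"] zonorm_minus[of "e *\<^sub>R y"] by simp
      also have "\<dots> = (1 + e) * zonorm x + e * zonorm y" using e by (simp add: zonorm_scale)
      also have "\<dots> = zonorm x + e * zonorm x + e * zonorm y" by (simp add: algebra_simps)
      also have "\<dots> \<le> zonorm x + e * 1 + e * 1"
        using e yP xP by (intro add_mono mult_left_mono order_refl) auto
      also have "\<dots> = 1" by (simp add: e_def)
      finally have zP: "z \<in> polar_ball" using zE by (simp add: polar_ball_def)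
      have xeq: "x = (1 - 1 / (1 + e)) *\<^sub>R y + (1 / (1 + e)) *\<^sub>R z"
      proof -
        have "(1 / (1 + e)) *\<^sub>R z = x - (e / (1 + e)) *\<^sub>R y"
          using e by (simp add: z_def scaleR_diff_right)
        moreover have "1 - 1 / (1 + e) = e / (1 + e)" using e by (simp add: field_simps)
        ultimately show ?thesis by simp
      qed
      have "y \<noteq> z"
      proof
        assume "y = z"
        then have "x = y" using xeq by (simp flip: scaleR_add_left)
        then show False using False by simp
      qed
      then have "x \<in> open_segment y z"
        unfolding in_segment using xeq e by (intro conjI exI[of _ "1 / (1 + e)"]) auto
      then show "y \<in> F" using face_ofD[OF F(1) _ y zP xF] by blast
    qed (use xF in simp)
    then show False using F face_of_imp_subset[OF F(1)] by blast
  qed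
  moreover obtain W where W: "W \<in> faces" "x \<in> open_cone W" using carrier_face[OF xP(1)] .
  ultimately have "x \<in> rel_interior (convex hull (unit_ray ` W))" by (intro open_cone_rel_interior)
  then have "F = convex hull (unit_ray ` W)"
    using face_of_eq[OF F(1) hull_unit_rays_face[OF W(1)]] x by blast
  then show ?thesis using that W(1) by blast
qed

lemma zero_in_polar_ball: "0 \<in> polar_ball"
  using subspace_0[OF subspace_E] by (simp add: polar_ball_def zonorm_zero)

lemma normalized_in_polar_ball:
  assumes "y \<in> E" "y \<noteq> 0"
  shows "(1 / zonorm y) *\<^sub>R y \<in> polar_ball"
  using assms zonorm_pos[OF assms] subspace_E by (simp add: polar_ball_def zonorm_scale subspace_scale)

lemma polytope_polar_ball: "polytope polar_ball"
proof -
  \<comment> \<open>The origin is listed among the generators: a point of smaller norm is a mixture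
    of 0 and its normalization, and for \<open>E = {0}\<close> there are no rays at all.\<close>
  have "polar_ball = convex hull (insert 0 (unit_ray ` \<Union>faces))" (is "_ = ?H")
  proof
    show "?H \<subseteq> polar_ball"
    proof (rule hull_minimal)
      have "unit_ray w \<in> polar_ball" if "w \<in> \<Union>faces" for w
      proof -
        obtain W where W: "W \<in> faces" "w \<in> W" using \<open>w \<in> \<Union>faces\<close> by blast
        have "w \<in> E" "w \<noteq> 0" using face_subset W face_independent[OF W(1)] dependent_zero by blast+
        then show ?thesis unfolding unit_ray_def by (rule normalized_in_polar_ball)
      qed
      then show "insert 0 (unit_ray ` \<Union>faces) \<subseteq> polar_ball" using zero_in_polar_ball by blast
    qed (rule convex_polar_ball)
    show "polar_ball \<subseteq> ?H"
    proof
      fix y assume "y \<in> polar_ball"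
      then have yP: "y \<in> E" "zonorm y \<le> 1" by (auto simp: polar_ball_def)
      show "y \<in> ?H"
      proof (cases "y = 0")
        case True
        then show ?thesis by (simp add: hull_inc)
      next
        case False
        then have pos: "0 < zonorm y" using zonorm_pos yP by blast
        define z where "z = (1 / zonorm y) *\<^sub>R y"
        have zE: "z \<in> E" "zonorm z = 1"
          unfolding z_def using yP pos subspace_E by (simp_all add: subspace_scale zonorm_scale)
        obtain W where W: "W \<in> faces" "z \<in> open_cone W" using carrier_face[OF zE(1)] .
        have "z \<in> convex hull (unit_ray ` W)"
          using open_cone_rel_interior[OF W zE(2)] rel_interior_subset by blast
        then have "z \<in> ?H" using hull_mono[of "unit_ray ` W" "insert 0 (unit_ray ` \<Union>faces)" convex] W(1) by blast
        moreover have "0 \<in> ?H" by (simp add: hull_inc)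
        ultimately have "(1 - zonorm y) *\<^sub>R 0 + zonorm y *\<^sub>R z \<in> ?H"
          using yP pos by (intro convexD convex_convex_hull) auto
        then show ?thesis using pos by (simp add: z_def)
      qed
    qed
  qed
  moreover have "finite (\<Union>faces)" using finite_faces face_finite by blast
  ultimately show ?thesis unfolding polytope_def by (metis finite.insertI finite_imageI)
qed

lemma aff_dim_polar_ball: "aff_dim polar_ball = int (dim E)"
proof -
  have "E \<subseteq> span polar_ball"
  proof
    fix y assume y: "y \<in> E"
    show "y \<in> span polar_ball"
    proof (cases "y = 0")
      case False
      have "zonorm y *\<^sub>R ((1 / zonorm y) *\<^sub>R y) \<in> span polar_ball"
        by (intro span_scale span_base normalized_in_polar_ball y False)
      then show ?thesis using zonorm_pos[OF y False] by simp
    qed (simp add: span_zero)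
  qed
  moreover have "polar_ball \<subseteq> E" by (auto simp: polar_ball_def)
  ultimately have "dim polar_ball = dim E"
    using dim_subset[of E "span polar_ball"] dim_subset[of polar_ball E] by simp
  then show ?thesis using aff_dim_zero[of polar_ball] zero_in_polar_ball by (simp add: hull_inc)
qed

lemma simplicial_polytope_polar_ball: "simplicial_polytope (dim E) polar_ball"
  unfolding simplicial_polytope_def
proof (intro conjI allI impI)
  fix F assume "F face_of polar_ball \<and> F \<noteq> polar_ball"
  then obtain W where W: "W \<in> faces" "F = convex hull (unit_ray ` W)"
    using proper_face_polar_ball by blast
  then have "(int (card (unit_ray ` W)) - 1) simplex F"
    unfolding simplex_def using unit_rays_affine_independent[OF W(1)] by (intro exI[of _ "unit_ray ` W"]) auto
  then show "\<exists>k. k simplex F" by blast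
qed (rule polytope_polar_ball, rule aff_dim_polar_ball)

lemma boundary_complex_polar_ball: "boundary_complex polar_ball = (\<lambda>W. unit_ray ` W) ` faces"
proof -
  have ext: "{v. v extreme_point_of convex hull (unit_ray ` W)} = unit_ray ` W" if "W \<in> faces" for W
    using extreme_point_of_convex_hull_affine_independent[OF unit_rays_affine_independent[OF that]] by blast
  have proper: "convex hull (unit_ray ` W) \<noteq> polar_ball" if W: "W \<in> faces" for W
  proof -
    obtain x where x: "convex_cone hull W = cell x" using W by (auto simp: fan_faces_def)
    have "0 \<notin> convex hull (unit_ray ` W)" unfolding hull_unit_rays[OF W x] by simp
    then show ?thesis using zero_in_polar_ball by metis
  qed
  show ?thesis
  proof
    show "boundary_complex polar_ball \<subseteq> (\<lambda>W. unit_ray ` W) ` faces"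
    proof
      fix X assume "X \<in> boundary_complex polar_ball"
      then obtain F where F: "F face_of polar_ball" "F \<noteq> polar_ball" "X = {v. v extreme_point_of F}"
        unfolding boundary_complex_def by blast
      then obtain W where W: "W \<in> faces" "F = convex hull (unit_ray ` W)" using proper_face_polar_ball by blast
      then have "X = unit_ray ` W" using ext F(3) by simp
      then show "X \<in> (\<lambda>W. unit_ray ` W) ` faces" using W(1) by simp
    qed
    show "(\<lambda>W. unit_ray ` W) ` faces \<subseteq> boundary_complex polar_ball"
      unfolding boundary_complex_def using ext proper hull_unit_rays_face by fastforce
  qed
qed

lemma complex_iso_subcomplex:
  assumes "D \<subseteq> faces"
  shows "complex_iso D ((\<lambda>W. unit_ray ` W) ` D)"
  unfolding complex_iso_def using inj_on_unit_ray assms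
  by (intro exI[of _ unit_ray] conjI refl) (erule inj_on_subset, blast)

lemma proper_subcomplex_polar_ball:
  assumes "D \<subset> faces"
  shows "(\<lambda>W. unit_ray ` W) ` D \<subset> boundary_complex polar_ball"
proof -
  have "inj_on (\<lambda>W. unit_ray ` W) faces"
    using inj_on_image_Pow[OF inj_on_unit_ray] by (rule inj_on_subset) blast
  moreover obtain X where X: "X \<in> faces" "X \<notin> D" using assms by blast
  ultimately have "unit_ray ` X \<notin> (\<lambda>W. unit_ray ` W) ` D"
    using inj_on_image_mem_iff[of "\<lambda>W. unit_ray ` W" faces X D] assms by simp
  moreover have "(\<lambda>W. unit_ray ` W) ` D \<subseteq> (\<lambda>W. unit_ray ` W) ` faces" using assms by (intro image_mono) simp
  ultimately show ?thesis unfolding boundary_complex_polar_ball using X(1) by blast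
qed

end


section \<open>Chambers are balls\<close>

lemma geometric_realization_top_of_set:
  "geometric_realization K =
     top_of_set {x. (\<forall>v. 0 \<le> x v) \<and> {v. x v \<noteq> 0} \<in> K \<and> (\<Sum>v | x v \<noteq> 0. x v) = 1}"
  unfolding geometric_realization_def euclidean_product_topology ..

lemma sum_support:
  assumes "finite F" "{v. x v \<noteq> 0} \<subseteq> F"
  shows "(\<Sum>v | x v \<noteq> 0. x v) = (\<Sum>v\<in>F. x v :: real)"
  using assms by (intro sum.mono_neutral_left) auto

text \<open>The realization is a finite union of closed simplices. Each is the closed condition
  \<open>C F\<close> inside the box \<open>B F\<close>, a product of intervals and singletons that
  is compact by Tychonoff even for infinitely many labels.\<close>

lemma compact_geometric_realization:
  fixes K :: "'v set set"
  assumes "abstract_complex K"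
  shows "compact {x. (\<forall>v. 0 \<le> x v) \<and> {v. x v \<noteq> 0} \<in> K \<and> (\<Sum>v | x v \<noteq> 0. x v) = (1::real)}" (is "compact ?S")
proof -
  have finK: "finite K" and finF: "\<And>F. F \<in> K \<Longrightarrow> finite F"
    and down: "\<And>F G. F \<in> K \<Longrightarrow> G \<subseteq> F \<Longrightarrow> G \<in> K"
    using assms unfolding abstract_complex_def by blast+
  define B :: "'v set \<Rightarrow> ('v \<Rightarrow> real) set" where "B F = PiE UNIV (\<lambda>v. if v \<in> F then {0..1} else {0})" for F
  define C :: "'v set \<Rightarrow> ('v \<Rightarrow> real) set" where "C F = {x. (\<Sum>v\<in>F. x v) = 1}" for F
  have "compact (B F)" for F
  proof -
    have "compactin (product_topology (\<lambda>i::'v. euclidean :: real topology) UNIV) (B F)"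
      unfolding B_def compactin_PiE by auto
    then show ?thesis unfolding euclidean_product_topology by simp
  qed
  moreover have "closed (C F)" for F
    unfolding C_def by (intro closed_Collect_eq continuous_intros continuous_on_product_coordinates)
  ultimately have "compact (\<Union>F\<in>K. B F \<inter> C F)" using finK by (intro compact_UN) auto
  moreover have "?S = (\<Union>F\<in>K. B F \<inter> C F)"
  proof (intro equalityI subsetI)
    fix x assume "x \<in> ?S"
    then have x: "\<And>v. 0 \<le> x v" "{v. x v \<noteq> 0} \<in> K" "(\<Sum>v | x v \<noteq> 0. x v) = 1" by auto
    have "x v \<le> 1" if "x v \<noteq> 0" for v
      unfolding x(3)[symmetric] using that finF[OF x(2)] x(1) by (intro member_le_sum) auto
    then have "x \<in> B {v. x v \<noteq> 0}" using x(1) unfolding B_def by (auto simp: PiE_iff)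
    then show "x \<in> (\<Union>F\<in>K. B F \<inter> C F)" using x(2,3) by (auto simp: C_def)
  next
    fix x assume "x \<in> (\<Union>F\<in>K. B F \<inter> C F)"
    then obtain F where F: "F \<in> K" "x \<in> B F" "x \<in> C F" by blast
    have xv: "x v \<in> (if v \<in> F then {0..1} else {0})" for v using F(2) unfolding B_def by (auto simp: PiE_iff)
    have supp: "{v. x v \<noteq> 0} \<subseteq> F"
    proof
      fix v assume "v \<in> {v. x v \<noteq> 0}" then show "v \<in> F" using xv[of v] by (auto split: if_splits)
    qed
    have "0 \<le> x v" for v using xv[of v] by (auto split: if_splits)
    then show "x \<in> ?S" using down[OF F(1) supp] sum_support[OF finF[OF F(1)] supp] F(3) by (auto simp: C_def)
  qed
  ultimately show ?thesis by simp
qed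

section \<open>Convex models for balls and stereographic projection\<close>

lemma homeomorphic_imp_homeomorphic_space:
  assumes "S homeomorphic T"
  shows "top_of_set S homeomorphic_space top_of_set T"
proof -
  obtain f g where "homeomorphism S T f g" using assms unfolding homeomorphic_def by blast
  then have "homeomorphic_maps (top_of_set S) (top_of_set T) f g"
    unfolding homeomorphism_def homeomorphic_maps_def by (auto simp: continuous_map_in_subtopology)
  then show ?thesis unfolding homeomorphic_space_def by blast
qed

text \<open>Compact convex sets of equal affine dimension are homeomorphic, so \<open>S\<close> is
  compared with the unit ball in the span of \<open>n\<close> basis vectors, which norm-preserving
  coordinates identify with \<open>nball n\<close>.\<close>

lemma convex_compact_homeomorphic_nball:
  fixes S :: "'a::euclidean_space set"
  assumes S: "convex S" "compact S" "aff_dim S = int n"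
  shows "top_of_set S homeomorphic_space nball n"
proof -
  have "n \<le> card (Basis :: 'a set)" using aff_dim_le_DIM[of S] S(3) by simp
  then obtain B where B: "card B = n" "B \<subseteq> (Basis :: 'a set)" by (meson obtain_subset_with_card_n)
  have ind: "independent B" using B(2) independent_Basis independent_mono by blast
  have orth: "pairwise orthogonal B" using B(2) orthogonal_Basis pairwise_mono by blast
  have norm1: "\<And>u. u \<in> B \<Longrightarrow> norm u = 1" using B(2) norm_Basis by blast
  obtain f g where fg: "homeomorphic_maps (Euclidean_space n) (top_of_set (span B)) f g"
    and nf: "\<And>x. x \<in> topspace (Euclidean_space n) \<Longrightarrow> (norm (f x))\<^sup>2 = (\<Sum>i<n. (x i)\<^sup>2)"
    using homeomorphic_maps_Euclidean_space_euclidean_gen[OF ind orth B(1) norm1] by blast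
  have hf: "homeomorphic_map (Euclidean_space n) (top_of_set (span B)) f"
    using fg homeomorphic_map_maps by blast
  define D where "D = span B \<inter> cball 0 1"
  have "homeomorphic_map (nball n) (subtopology (top_of_set (span B)) (cball 0 1)) f"
    unfolding nball_def
  proof (rule homeomorphic_map_subtopologies[OF hf])
    have img: "f ` topspace (Euclidean_space n) = span B" using homeomorphic_imp_surjective_map[OF hf] by simp
    have iff: "norm (f x) \<le> 1 \<longleftrightarrow> (\<Sum>i<n. (x i)\<^sup>2) \<le> 1" if "x \<in> topspace (Euclidean_space n)" for x
      unfolding nf[OF that, symmetric] by (simp add: abs_square_le_1)
    show "f ` (topspace (Euclidean_space n) \<inter> {x. (\<Sum>i<n. (x i)\<^sup>2) \<le> 1}) =
        topspace (top_of_set (span B)) \<inter> cball 0 1"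
    proof (intro equalityI subsetI)
      fix y assume "y \<in> f ` (topspace (Euclidean_space n) \<inter> {x. (\<Sum>i<n. (x i)\<^sup>2) \<le> 1})"
      then obtain x where x: "x \<in> topspace (Euclidean_space n)" "(\<Sum>i<n. (x i)\<^sup>2) \<le> 1" "y = f x" by blast
      then show "y \<in> topspace (top_of_set (span B)) \<inter> cball 0 1" using iff[OF x(1)] img by auto
    next
      fix y assume "y \<in> topspace (top_of_set (span B)) \<inter> cball 0 1"
      then have y: "y \<in> span B" "norm y \<le> 1" by auto
      then obtain x where x: "x \<in> topspace (Euclidean_space n)" "y = f x" using img by blast
      then show "y \<in> f ` (topspace (Euclidean_space n) \<inter> {x. (\<Sum>i<n. (x i)\<^sup>2) \<le> 1})"
        using iff[OF x(1)] y(2) by blast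
    qed
  qed
  then have "nball n homeomorphic_space top_of_set D"
    unfolding D_def subtopology_subtopology by (rule homeomorphic_map_imp_homeomorphic_space)
  moreover have "S homeomorphic D"
  proof (rule homeomorphic_convex_compact_sets[OF S(1,2)])
    show "convex D" unfolding D_def by (intro convex_Int subspace_imp_convex subspace_span convex_cball)
    show "compact D" unfolding D_def by (intro closed_Int_compact closed_span compact_cball)
    have "0 \<in> D" by (simp add: D_def span_zero)
    then have "aff_dim D = int (dim D)" by (intro aff_dim_zero hull_inc)
    moreover have "B \<subseteq> D" using norm1 by (auto simp: D_def span_base)
    then have "dim D = n"
      using dim_subset[of B D] dim_subset[of D "span B"] dim_eq_card_independent[OF ind] B(1) by (auto simp: D_def)
    ultimately show "aff_dim S = aff_dim D" using S(3) by simp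
  qed
  ultimately show ?thesis
    using homeomorphic_imp_homeomorphic_space[of S D] homeomorphic_space_sym homeomorphic_space_trans by blast
qed

text \<open>For unit \<open>y\<close> the vector \<open>u\<close> is the projection of
  \<open>y\<close> from \<open>- e\<close>. The formulas are made homogeneous so that they apply to
  any vector on the ray of \<open>y\<close>; the last identity recovers this ray from
  \<open>u\<close>.\<close>

lemma stereographic_inverse:
  fixes e y :: "'a::real_inner"
  assumes e: "norm e = 1" and s: "s = norm y + e \<bullet> y" "s \<noteq> 0" and u: "u = (1 / s) *\<^sub>R (y - (e \<bullet> y) *\<^sub>R e)"
  shows "e \<bullet> u = 0" "2 *\<^sub>R u + (1 - u \<bullet> u) *\<^sub>R e = (2 / s) *\<^sub>R y"
proof -
  have ee: "e \<bullet> e = 1" using e by (simp add: dot_square_norm)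
  show "e \<bullet> u = 0" unfolding u by (simp add: inner_diff_right ee)
  have "(y - (e \<bullet> y) *\<^sub>R e) \<bullet> (y - (e \<bullet> y) *\<^sub>R e) = (norm y)\<^sup>2 - (e \<bullet> y)\<^sup>2"
    unfolding power2_norm_eq_inner
    by (simp add: inner_diff_left inner_diff_right ee power2_eq_square inner_commute[of y e])
  also have "\<dots> = s * (norm y - e \<bullet> y)" by (simp add: s(1) power2_eq_square algebra_simps)
  finally have ss: "(y - (e \<bullet> y) *\<^sub>R e) \<bullet> (y - (e \<bullet> y) *\<^sub>R e) = s * (norm y - e \<bullet> y)" .
  have "u \<bullet> u = (1 / s) * ((1 / s) * ((y - (e \<bullet> y) *\<^sub>R e) \<bullet> (y - (e \<bullet> y) *\<^sub>R e)))"
    unfolding u by (simp only: inner_scaleR_left inner_scaleR_right)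
  also have "\<dots> = (norm y - e \<bullet> y) / s" unfolding ss using s(2) by simp
  finally have "u \<bullet> u = (norm y - e \<bullet> y) / s" .
  then have "1 - u \<bullet> u = 2 * (e \<bullet> y) / s" using s by (simp add: field_simps)
  then have "2 *\<^sub>R u + (1 - u \<bullet> u) *\<^sub>R e = (2 / s) *\<^sub>R (y - (e \<bullet> y) *\<^sub>R e) + (2 * (e \<bullet> y) / s) *\<^sub>R e"
    by (simp add: u)
  also have "\<dots> = (2 / s) *\<^sub>R y" by (simp add: scaleR_diff_right)
  finally show "2 *\<^sub>R u + (1 - u \<bullet> u) *\<^sub>R e = (2 / s) *\<^sub>R y" .
qed

text \<open>The inequality says that the ray recovered from \<open>u\<close> lies in the half-space
  of \<open>b\<close>. Dividing by \<open>b \<bullet> e\<close> and completing the square gives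
  centre \<open>b / (b \<bullet> e)\<close>; positivity of \<open>b \<bullet> e\<close> yields a
  ball rather than the complement of one.\<close>

lemma quadratic_region_cball:
  fixes b e :: "'a::euclidean_space"
  assumes "0 < b \<bullet> e"
  shows "\<exists>c r. {u. 0 \<le> 2 * (b \<bullet> u) + (1 - u \<bullet> u) * (b \<bullet> e)} = cball c r"
proof -
  define k where "k = b \<bullet> e"
  have k: "0 < k" using assms by (simp add: k_def)
  define c where "c = (1 / k) *\<^sub>R b"
  have bc: "b = k *\<^sub>R c" using k by (simp add: c_def)
  have "0 \<le> 2 * (b \<bullet> u) + (1 - u \<bullet> u) * k \<longleftrightarrow> u \<in> cball c (sqrt (1 + c \<bullet> c))" for u
  proof -
    have "u \<in> cball c (sqrt (1 + c \<bullet> c)) \<longleftrightarrow> norm (c - u) \<le> sqrt (1 + c \<bullet> c)" by (simp add: dist_norm)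
    also have "\<dots> \<longleftrightarrow> (c - u) \<bullet> (c - u) \<le> 1 + c \<bullet> c" by (simp add: norm_eq_sqrt_inner)
    also have "\<dots> \<longleftrightarrow> 0 \<le> 2 * (c \<bullet> u) + (1 - u \<bullet> u)"
      by (auto simp: inner_diff_left inner_diff_right inner_commute)
    also have "\<dots> \<longleftrightarrow> 0 \<le> k * (2 * (c \<bullet> u) + (1 - u \<bullet> u))" using k by (simp add: zero_le_mult_iff)
    also have "k * (2 * (c \<bullet> u) + (1 - u \<bullet> u)) = 2 * (b \<bullet> u) + (1 - u \<bullet> u) * k"
      by (simp add: bc algebra_simps)
    finally show ?thesis by simp
  qed
  then show ?thesis unfolding k_def by blast
qed

context simplicial_fan
begin

lemma open_cone_scale:
  assumes "y \<in> open_cone W" "0 < k"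
  shows "k *\<^sub>R y \<in> open_cone W"
proof -
  obtain c where c: "\<And>w. w \<in> W \<Longrightarrow> 0 < c w" "y = (\<Sum>w\<in>W. c w *\<^sub>R w)"
    using open_coneE[OF assms(1)] by blast
  have "k *\<^sub>R y = (\<Sum>w\<in>W. (k * c w) *\<^sub>R w)" by (simp add: c(2) scaleR_sum_right)
  then show ?thesis using open_coneI[of W "\<lambda>w. k * c w"] c(1) assms(2) by simp
qed

lemma zero_notin_open_cone:
  assumes "W \<in> faces" "W \<noteq> {}"
  shows "0 \<notin> open_cone W"
proof
  assume "0 \<in> open_cone W"
  moreover have "(0::'a) \<in> open_cone {}" using sum_in_open_cone[of "{}::'a set"] by simp
  ultimately show False using carrier_unique[OF assms(1) empty_face] assms(2) by blast
qed

text \<open>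
  Stereographic projection from \<open>- e\<close>, where \<open>e\<close> is a point inside the chamber, maps the half-spheres
  cut out by the walls to balls.  Hence the spherical chamber is mapped onto a compact convex set.
\<close>

lemma simplicial_ball_chamber:
  assumes Q: "Q \<subseteq> N" "Q \<noteq> {}" and p: "p \<in> E" "\<And>q. q \<in> Q \<Longrightarrow> q \<bullet> p \<noteq> 0"
  shows "simplicial_ball (chamber Q p)" (is "simplicial_ball ?D")
proof -
  have finQ: "finite Q" using Q(1) finite_N by (rule finite_subset)
  obtain q0 where q0: "q0 \<in> Q" using Q(2) by blast
  have p0: "p \<noteq> 0" using p(2)[OF q0] by auto
  define e where "e = (1 / norm p) *\<^sub>R p"
  have ne: "norm e = 1" using p0 by (simp add: e_def)
  have ee: "e \<bullet> e = 1" using ne by (simp add: dot_square_norm)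
  have eE: "e \<in> E" unfolding e_def by (rule subspace_scale[OF subspace_E p(1)])
  \<comment> \<open>The wall normals turned towards the chamber, so that \<open>e\<close> is
    strictly on their positive side.\<close>
  define b where "b q = sgn (q \<bullet> p) *\<^sub>R q" for q
  have be: "0 < b q \<bullet> e" if "q \<in> Q" for q
  proof -
    have "b q \<bullet> e = \<bar>q \<bullet> p\<bar> / norm p" by (simp add: b_def e_def sgn_mult_self_eq abs_sgn mult.commute)
    then show ?thesis using p(2)[OF that] p0 by simp
  qed
  let ?C = "closed_cell E Q p"
  have C_iff: "x \<in> ?C \<longleftrightarrow> x \<in> E \<and> (\<forall>q\<in>Q. 0 \<le> b q \<bullet> x)" for x
  proof -
    have "q \<bullet> x = 0 \<or> sgn (q \<bullet> x) = sgn (q \<bullet> p) \<longleftrightarrow> 0 \<le> b q \<bullet> x" if "q \<in> Q" for q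
      using p(2)[OF that] by (auto simp: b_def sgn_if)
    then show ?thesis unfolding closed_cell_def by blast
  qed
  \<comment> \<open>The projection is undefined only on the ray of \<open>- e\<close>, and any wall
    keeps this ray out of the chamber; hence the requirement that \<open>Q\<close> is
    nonempty.\<close>
  have den: "0 < norm y + e \<bullet> y" if "y \<in> ?C" "y \<noteq> 0" for y
  proof (rule ccontr)
    assume neg: "\<not> 0 < norm y + e \<bullet> y"
    have "(y + norm y *\<^sub>R e) \<bullet> (y + norm y *\<^sub>R e) = 2 * norm y * (norm y + e \<bullet> y)"
      using power2_norm_eq_inner[of y]
      by (simp add: inner_add_left inner_add_right ee inner_commute[of y e] power2_eq_square algebra_simps)
    moreover have "2 * norm y * (norm y + e \<bullet> y) \<le> 0" using neg by (intro mult_nonneg_nonpos) auto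
    ultimately have "y + norm y *\<^sub>R e = 0" by (metis inner_ge_zero inner_eq_zero_iff order_antisym)
    then have "y = - (norm y *\<^sub>R e)" by (simp add: eq_neg_iff_add_eq_0)
    then have "b q0 \<bullet> y = - (norm y * (b q0 \<bullet> e))" by (metis inner_minus_right inner_scaleR_right)
    moreover have "0 < norm y * (b q0 \<bullet> e)" using that(2) be[OF q0] by simp
    ultimately show False using that(1) q0 unfolding C_iff by force
  qed
  define H where "H = E \<inter> {u. e \<bullet> u = 0}"
  have H: "subspace H" unfolding H_def by (intro subspace_inter subspace_E subspace_hyperplane)
  have dimH: "dim H + 1 = dim E" unfolding H_def by (rule dim_Int_hyperplane[OF subspace_E eE]) (simp add: ee)
  define B where "B q = {u. 0 \<le> 2 * (b q \<bullet> u) + (1 - u \<bullet> u) * (b q \<bullet> e)}" for q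
  define T where "T = H \<inter> (\<Inter>q\<in>Q. B q)"
  have B_cball: "\<exists>c r. B q = cball c r" if "q \<in> Q" for q
    unfolding B_def by (rule quadratic_region_cball[OF be[OF that]])
  have "convex (B q)" if "q \<in> Q" for q using B_cball[OF that] by auto
  then have convT: "convex T"
    unfolding T_def by (intro convex_Int[OF subspace_imp_convex[OF H]] convex_INT)
  have "compact (B q)" if "q \<in> Q" for q using B_cball[OF that] by auto
  then have "compact (\<Inter>q\<in>Q. B q)" using q0 by (intro compact_Inter) auto
  then have compT: "compact T" unfolding T_def by (intro closed_Int_compact closed_subspace H)
  have T0: "0 \<in> T" using be less_imp_le by (auto simp: T_def B_def subspace_0[OF H])
  \<comment> \<open>At the origin every inequality of \<open>T\<close> reads
    \<open>0 < b q \<bullet> e\<close>, so small multiples of any vector of \<open>H\<close> belong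
    to \<open>T\<close>.\<close>
  have "H \<subseteq> span T"
  proof
    fix u assume u: "u \<in> H"
    have "\<forall>\<^sub>F t in at_right 0. \<forall>q\<in>Q. 0 < 2 * (b q \<bullet> (t *\<^sub>R u)) + (1 - (t *\<^sub>R u) \<bullet> (t *\<^sub>R u)) * (b q \<bullet> e)"
    proof (rule eventually_ball_finite[OF finQ], rule ballI)
      fix q assume "q \<in> Q"
      have "((\<lambda>t. 2 * (b q \<bullet> (t *\<^sub>R u)) + (1 - (t *\<^sub>R u) \<bullet> (t *\<^sub>R u)) * (b q \<bullet> e)) \<longlongrightarrow>
          2 * (b q \<bullet> (0 *\<^sub>R u)) + (1 - (0 *\<^sub>R u) \<bullet> (0 *\<^sub>R u)) * (b q \<bullet> e)) (at_right 0)"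
        by (intro tendsto_intros)
      then show "\<forall>\<^sub>F t in at_right 0. 0 < 2 * (b q \<bullet> (t *\<^sub>R u)) + (1 - (t *\<^sub>R u) \<bullet> (t *\<^sub>R u)) * (b q \<bullet> e)"
        by (rule order_tendstoD) (use be[OF \<open>q \<in> Q\<close>] in simp)
    qed
    then obtain t where t: "t > 0"
      "\<forall>q\<in>Q. 0 < 2 * (b q \<bullet> (t *\<^sub>R u)) + (1 - (t *\<^sub>R u) \<bullet> (t *\<^sub>R u)) * (b q \<bullet> e)"
      by (rule eventually_at_right_0E) blast
    then have "t *\<^sub>R u \<in> T" using u H by (auto simp: T_def B_def subspace_scale less_imp_le)
    then have "(1 / t) *\<^sub>R (t *\<^sub>R u) \<in> span T" by (intro span_scale span_base)
    then show "u \<in> span T" using t(1) by simp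
  qed
  then have "dim T = dim H" using dim_subset[of H "span T"] dim_subset[of T H] by (auto simp: T_def)
  moreover have "aff_dim T = int (dim T)" using T0 by (intro aff_dim_zero hull_inc)
  ultimately have affT: "aff_dim T = int (dim E - 1)" using dimH by simp
  define S where "S = {x. (\<forall>v. 0 \<le> x v) \<and> {v. x v \<noteq> 0} \<in> ?D \<and> (\<Sum>v | x v \<noteq> 0. x v) = (1::real)}"
  define V where "V = \<Union>?D"
  have finD: "finite ?D" "\<And>F. F \<in> ?D \<Longrightarrow> finite F"
    using abstract_complex_chamber[of Q p] unfolding abstract_complex_def by blast+
  then have finV: "finite V" by (auto simp: V_def)
  \<comment> \<open>\<open>Y\<close> turns barycentric coordinates into a vector of the cone, one
    for each ray of the chamber, and \<open>\<Phi>\<close> projects that ray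
    stereographically.\<close>
  define Y where "Y x = (\<Sum>v\<in>V. x v *\<^sub>R v)" for x :: "'a \<Rightarrow> real"
  define \<Phi> where "\<Phi> x = (1 / (norm (Y x) + e \<bullet> Y x)) *\<^sub>R (Y x - (e \<bullet> Y x) *\<^sub>R e)" for x :: "'a \<Rightarrow> real"
  have Y_supp: "Y x = (\<Sum>v | x v \<noteq> 0. x v *\<^sub>R v)" if "{v. x v \<noteq> 0} \<in> ?D" for x
    unfolding Y_def using that finV by (intro sum.mono_neutral_right) (auto simp: V_def)
  have YS: "Y x \<in> open_cone {v. x v \<noteq> 0}" "Y x \<in> ?C" "Y x \<noteq> 0" if x: "x \<in> S" for x
  proof -
    have F: "{v. x v \<noteq> 0} \<in> ?D" "\<And>v. 0 \<le> x v" "(\<Sum>v | x v \<noteq> 0. x v) = 1"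
      using x by (auto simp: S_def)
    show oc: "Y x \<in> open_cone {v. x v \<noteq> 0}"
      unfolding Y_supp[OF F(1)] by (rule open_coneI) (use F(2) in \<open>auto simp: less_le\<close>)
    then show "Y x \<in> ?C"
      using face_subset_chamber_iff[OF chamber_facesD(1)[OF F(1)] oc Q(1)] chamber_facesD(2)[OF F(1)] by simp
    have "{v. x v \<noteq> 0} \<noteq> {}" using F(3) by force
    then show "Y x \<noteq> 0" using zero_notin_open_cone[OF chamber_facesD(1)[OF F(1)]] oc by metis
  qed
  have inv: "e \<bullet> \<Phi> x = 0"
    "2 *\<^sub>R \<Phi> x + (1 - \<Phi> x \<bullet> \<Phi> x) *\<^sub>R e = (2 / (norm (Y x) + e \<bullet> Y x)) *\<^sub>R Y x" if "x \<in> S" for x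
    using stereographic_inverse[OF ne refl _ \<Phi>_def] den[OF YS(2,3)[OF that]] by auto
  have contY: "continuous_on A Y" for A
    unfolding Y_def by (intro continuous_intros continuous_on_subset[OF continuous_on_product_coordinates]) auto
  have cont: "continuous_on S \<Phi>"
    unfolding \<Phi>_def using den[OF YS(2,3)] by (intro continuous_intros contY) force
  have img: "\<Phi> ` S = T"
  proof (intro equalityI subsetI)
    fix u assume "u \<in> \<Phi> ` S"
    then obtain x where x: "x \<in> S" "u = \<Phi> x" by blast
    have yE: "Y x \<in> E" "\<And>q. q \<in> Q \<Longrightarrow> 0 \<le> b q \<bullet> Y x" using YS(2)[OF x(1)] unfolding C_iff by auto
    have "u \<in> E" unfolding x(2) \<Phi>_def using yE eE subspace_E by (simp add: subspace_scale subspace_diff)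
    moreover have "u \<in> B q" if "q \<in> Q" for q
    proof -
      have "2 * (b q \<bullet> u) + (1 - u \<bullet> u) * (b q \<bullet> e) = b q \<bullet> (2 *\<^sub>R u + (1 - u \<bullet> u) *\<^sub>R e)"
        by (simp add: inner_add_right)
      also have "\<dots> = (2 / (norm (Y x) + e \<bullet> Y x)) * (b q \<bullet> Y x)" unfolding x(2) inv(2)[OF x(1)] by simp
      also have "\<dots> \<ge> 0" using yE(2)[OF that] den[OF YS(2,3)[OF x(1)]] by (intro mult_nonneg_nonneg) auto
      finally show ?thesis by (simp add: B_def)
    qed
    ultimately show "u \<in> T" using inv(1)[OF x(1)] x(2) by (simp add: T_def H_def)
  next
    fix u assume u: "u \<in> T"
    then have uE: "u \<in> E" "e \<bullet> u = 0" and uB: "\<And>q. q \<in> Q \<Longrightarrow> u \<in> B q" by (auto simp: T_def H_def)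
    \<comment> \<open>A vector on the ray that projects to \<open>u\<close>; dividing its
      coefficients over the carrier by their sum gives the barycentric coordinates.\<close>
    define z where "z = 2 *\<^sub>R u + (1 - u \<bullet> u) *\<^sub>R e"
    have ez: "e \<bullet> z = 1 - u \<bullet> u" by (simp add: z_def inner_add_right uE ee)
    have "(norm z)\<^sup>2 = (1 + u \<bullet> u)\<^sup>2"
      unfolding power2_norm_eq_inner z_def
      by (simp add: inner_add_left inner_add_right uE ee inner_commute[of u e] power2_eq_square algebra_simps)
    then have nz: "norm z = 1 + u \<bullet> u" by (simp add: power2_eq_iff_nonneg)
    have zE: "z \<in> E" unfolding z_def using uE eE subspace_E by (simp add: subspace_add subspace_scale)
    have zC: "z \<in> ?C" unfolding C_iff
      using zE uB by (auto simp: B_def z_def inner_add_right)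
    have z0: "z \<noteq> 0" using nz inner_ge_zero[of u] by (metis add.commute add_less_same_cancel2 less_irrefl norm_zero not_le zero_less_one)
    obtain W where W: "W \<in> faces" "z \<in> open_cone W" using carrier_face[OF zE] .
    have WD: "W \<in> ?D" using face_subset_chamber_iff[OF W Q(1)] zC W(1) by (simp add: chamber_faces_def)
    obtain c where c: "\<And>w. w \<in> W \<Longrightarrow> 0 < c w" "z = (\<Sum>w\<in>W. c w *\<^sub>R w)"
      using open_coneE[OF W(2)] by blast
    define K where "K = (\<Sum>w\<in>W. c w)"
    have "W \<noteq> {}" using c(2) z0 by auto
    then have K: "0 < K" unfolding K_def using c(1) finD(2)[OF WD] by (intro sum_pos) auto
    define x where "x v = (if v \<in> W then c v / K else 0)" for v
    have supp: "{v. x v \<noteq> 0} = W" using c(1) K by (auto simp: x_def less_imp_neq[THEN not_sym])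
    have "sum x W = 1" using K by (simp add: x_def K_def flip: sum_divide_distrib)
    moreover have "0 \<le> x v" for v using c(1)[of v] K by (simp add: x_def less_imp_le)
    ultimately have xS: "x \<in> S" using supp WD by (simp add: S_def)
    have "Y x = (\<Sum>v\<in>W. x v *\<^sub>R v)" using Y_supp[of x] supp WD by simp
    also have "\<dots> = (1 / K) *\<^sub>R z" unfolding c(2) scaleR_sum_right by (intro sum.cong) (auto simp: x_def)
    finally have Yx: "Y x = (1 / K) *\<^sub>R z" .
    have "norm (Y x) + e \<bullet> Y x = 2 / K" using K by (simp add: Yx nz ez add_divide_distrib[symmetric])
    moreover have "Y x - (e \<bullet> Y x) *\<^sub>R e = (2 / K) *\<^sub>R u"
      by (simp add: Yx ez) (simp add: z_def scaleR_add_right)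
    ultimately have "\<Phi> x = u" unfolding \<Phi>_def using K by simp
    then show "u \<in> \<Phi> ` S" using xS by blast
  qed
  \<comment> \<open>Equal projections mean that \<open>Y x\<close> and \<open>Y x'\<close> span the
    same ray. Uniqueness of carriers gives equal supports, independence gives proportional
    coordinates, and the coordinate sum 1 makes the factor 1.\<close>
  have inj: "inj_on \<Phi> S"
  proof (rule inj_onI)
    fix x x' assume x: "x \<in> S" "x' \<in> S" and eq: "\<Phi> x = \<Phi> x'"
    define s s' where "s = norm (Y x) + e \<bullet> Y x" and "s' = norm (Y x') + e \<bullet> Y x'"
    have s: "0 < s" "0 < s'" unfolding s_def s'_def using den YS(2,3) x by blast+
    have "(2 / s) *\<^sub>R Y x = (2 / s') *\<^sub>R Y x'"
      unfolding s_def s'_def inv(2)[OF x(1), symmetric] inv(2)[OF x(2), symmetric] eq ..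
    then have "(s' / 2) *\<^sub>R ((2 / s) *\<^sub>R Y x) = (s' / 2) *\<^sub>R ((2 / s') *\<^sub>R Y x')" by simp
    then have Y': "Y x' = (s' / s) *\<^sub>R Y x" using s by simp
    define k where "k = s' / s"
    have k: "0 < k" using s by (simp add: k_def)
    let ?F = "{v. x v \<noteq> 0}" and ?F' = "{v. x' v \<noteq> 0}"
    have F: "?F \<in> ?D" "?F' \<in> ?D" using x by (auto simp: S_def)
    have "Y x' \<in> open_cone ?F" unfolding Y' using open_cone_scale[OF YS(1)[OF x(1)] k] by (simp add: k_def)
    then have FF': "?F' = ?F"
      using carrier_unique[OF chamber_facesD(1)[OF F(2)] chamber_facesD(1)[OF F(1)] YS(1)[OF x(2)]] by simp
    have eqF: "(\<Sum>v\<in>?F. x' v *\<^sub>R v) = (\<Sum>v\<in>?F. (k * x v) *\<^sub>R v)"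
      using Y' Y_supp[OF F(1)] Y_supp[OF F(2)] FF' by (simp add: k_def scaleR_sum_right)
    have xk: "x' v = k * x v" if "v \<in> ?F" for v
      by (rule independent_sum_eqD[OF face_independent[OF chamber_facesD(1)[OF F(1)]] finD(2)[OF F(1)] eqF that])
    have "1 = (\<Sum>v\<in>?F. x' v)" using x(2) FF' by (simp add: S_def)
    also have "\<dots> = k * (\<Sum>v\<in>?F. x v)" unfolding sum_distrib_left by (intro sum.cong) (use xk in auto)
    also have "\<dots> = k" using x(1) by (simp add: S_def)
    finally have k1: "k = 1" by simp
    show "x = x'"
    proof
      fix v
      show "x v = x' v" using xk[of v] k1 FF' by (cases "v \<in> ?F") auto
    qed
  qed
  have "homeomorphic_map (top_of_set S) (top_of_set T) \<Phi>"
  proof (rule continuous_imp_homeomorphic_map)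
    show "continuous_map (top_of_set S) (top_of_set T) \<Phi>"
      using cont img by (auto simp: continuous_map_in_subtopology)
    show "compact_space (top_of_set S)"
      using compact_geometric_realization[OF abstract_complex_chamber]
      by (intro compact_space_subtopology) (simp add: S_def)
    show "Hausdorff_space (top_of_set T)" by (simp add: Hausdorff_space_subtopology)
  qed (use img inj in auto)
  then have "geometric_realization ?D homeomorphic_space top_of_set T"
    unfolding geometric_realization_top_of_set S_def[symmetric]
    by (rule homeomorphic_map_imp_homeomorphic_space)
  then have "geometric_realization ?D homeomorphic_space nball (dim E - 1)"
    using convex_compact_homeomorphic_nball[OF convT compT affT] by (rule homeomorphic_space_trans)
  moreover have "complex_dim ?D = int (dim E - 1)"
    using complex_dim_chamber[OF Q(1) p] dimH by auto
  ultimately show ?thesis unfolding simplicial_ball_def by blast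
qed

end


section \<open>Ear decompositions of unions of hyperplanes\<close>

lemma convex_ear_decomposition_snoc:
  fixes T :: "'b::euclidean_space itself"
  assumes ced: "convex_ear_decomposition T d K Ks"
    and D: "pure_complex D" "complex_dim D = int d - 1" "simplicial_ball D"
    and P: "\<exists>(P::'b set) L. simplicial_polytope d P \<and> L \<subset> boundary_complex P \<and> complex_iso D L"
    and bd: "D \<inter> K = ball_boundary D"
  shows "convex_ear_decomposition T d (K \<union> D) (Ks @ [D])"
proof -
  have ne: "Ks \<noteq> []" and all: "\<And>C. C \<in> set Ks \<Longrightarrow> C \<subseteq> K \<and> pure_complex C \<and> complex_dim C = int d - 1"
    and first: "\<exists>P::'b set. simplicial_polytope d P \<and> complex_iso (Ks ! 0) (boundary_complex P)"
    and rest: "\<And>j. 1 \<le> j \<Longrightarrow> j < length Ks \<Longrightarrow> simplicial_ball (Ks ! j) \<and>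
        (\<exists>(P::'b set) L. simplicial_polytope d P \<and> L \<subset> boundary_complex P \<and> complex_iso (Ks ! j) L) \<and>
        Ks ! j \<inter> (\<Union>i<j. Ks ! i) = ball_boundary (Ks ! j)"
    and un: "\<Union>(set Ks) = K"
    using ced unfolding convex_ear_decomposition_def by simp_all
  have un_nth: "(\<Union>i<length Ks. Ks ! i) = K"
    unfolding un[symmetric] set_conv_nth by blast
  have prefix: "(\<Union>i<j. (Ks @ [D]) ! i) = (\<Union>i<j. Ks ! i)" if "j \<le> length Ks" for j
    using that by (intro SUP_cong) (auto simp: nth_append)
  show ?thesis unfolding convex_ear_decomposition_def
  proof (intro conjI allI impI ballI)
    show "Ks @ [D] \<noteq> []" by simp
    show "\<exists>P::'b set. simplicial_polytope d P \<and> complex_iso ((Ks @ [D]) ! 0) (boundary_complex P)"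
      using first ne by (simp add: nth_append)
    show "\<Union> (set (Ks @ [D])) = K \<union> D" using un by auto
  next
    fix C assume C: "C \<in> set (Ks @ [D])"
    show "C \<subseteq> K \<union> D" using C all by auto
    show "pure_complex C" using C all D by auto
    show "complex_dim C = int d - 1" using C all D by auto
  next
    fix j assume j: "1 \<le> j \<and> j < length (Ks @ [D])"
    show "simplicial_ball ((Ks @ [D]) ! j)"
      using rest[of j] j D by (cases "j < length Ks") (auto simp: nth_append)
    show "\<exists>(P::'b set) L. simplicial_polytope d P \<and> L \<subset> boundary_complex P \<and> complex_iso ((Ks @ [D]) ! j) L"
    proof (cases "j < length Ks")
      case True
      then show ?thesis using rest[of j] j by (simp add: nth_append)
    next
      case False
      then have "(Ks @ [D]) ! j = D" using j by (simp add: nth_append)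
      then show ?thesis using P by simp
    qed
    show "(Ks @ [D]) ! j \<inter> (\<Union>i<j. (Ks @ [D]) ! i) = ball_boundary ((Ks @ [D]) ! j)"
    proof (cases "j < length Ks")
      case True
      then show ?thesis using rest[of j] j prefix[of j] by (simp add: nth_append)
    next
      case False
      then have jl: "j = length Ks" using j by simp
      show ?thesis unfolding jl prefix[OF order_refl] un_nth using bd by simp
    qed
  qed
qed

lemma convex_ear_decomposition_complex_dim:
  assumes "convex_ear_decomposition T d K Ks" "finite K"
  shows "complex_dim K = int d - 1"
proof -
  have ne: "Ks \<noteq> []" and all: "\<And>C. C \<in> set Ks \<Longrightarrow> pure_complex C \<and> complex_dim C = int d - 1"
    and un: "\<Union>(set Ks) = K"
    using assms(1) unfolding convex_ear_decomposition_def by simp_all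
  have fin: "finite C" if "C \<in> set Ks" for C
    using all[OF that] by (simp add: pure_complex_def abstract_complex_def)
  show ?thesis unfolding complex_dim_def
  proof (rule Max_eqI)
    show "finite (face_dim ` K)" using assms(2) by simp
    fix y assume "y \<in> face_dim ` K"
    then obtain F C where F: "y = face_dim F" "C \<in> set Ks" "F \<in> C" using un by blast
    then have "y \<le> Max (face_dim ` C)" using fin by simp
    then show "y \<le> int d - 1" using all[OF F(2)] by (simp add: complex_dim_def)
  next
    have C: "hd Ks \<in> set Ks" using ne by simp
    then obtain G where "G \<in> hd Ks" "face_dim G = int d - 1"
      using all[OF C] unfolding pure_complex_def abstract_complex_def by metis
    then show "int d - 1 \<in> face_dim ` K" using un C by (metis UnionI imageI)
  qed
qed

text \<open>The degenerate case of an edgeless graph or an empty subarrangement: the complex of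
  dimension -1 is the boundary of a point, a polytope of dimension 0.\<close>

lemma has_convex_ear_decomposition_trivial:
  "has_convex_ear_decomposition (T :: 'b::euclidean_space itself) {{} :: 'v set}"
proof -
  have dim: "complex_dim {{} :: 'v set} = -1" by (simp add: complex_dim_def face_dim_def)
  have ac: "abstract_complex {{} :: 'v set}" by (auto simp: abstract_complex_def)
  have "simplicial_polytope 0 {0 :: 'b}" unfolding simplicial_polytope_def
  proof (intro conjI allI impI)
    fix F :: "'b set" assume "F face_of {0} \<and> F \<noteq> {0}"
    then have "F = {}" using face_of_imp_subset by blast
    then have "(-1) simplex F" unfolding simplex_def by (intro exI[of _ "{}"]) auto
    then show "\<exists>k. k simplex F" by blast
  qed (simp_all add: polytope_sing)
  moreover have "boundary_complex {0 :: 'b} = {{}}"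
  proof -
    have F: "F face_of {0 :: 'b} \<and> F \<noteq> {0} \<longleftrightarrow> F = {}" for F
      using face_of_imp_subset[of F "{0}"] by (auto simp: subset_singleton_iff)
    have "{v :: 'b. v extreme_point_of {}} = {}" by (simp add: extreme_point_of_def)
    then show ?thesis unfolding boundary_complex_def F by simp
  qed
  moreover have "complex_iso {{} :: 'v set} {{} :: 'b set}" by (auto simp: complex_iso_def)
  ultimately have "convex_ear_decomposition T 0 {{} :: 'v set} [{{}}]"
    unfolding convex_ear_decomposition_def
  proof (intro conjI)
    show "\<forall>D\<in>set [{{} :: 'v set}]. D \<subseteq> {{}} \<and> pure_complex D \<and> complex_dim D = int 0 - 1"
      using ac dim by (simp add: pure_complex_def face_dim_def)
    show "\<exists>P::'b set. simplicial_polytope 0 P \<and> complex_iso ([{{} :: 'v set}] ! 0) (boundary_complex P)"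
      using \<open>simplicial_polytope 0 {0 :: 'b}\<close> \<open>boundary_complex {0 :: 'b} = {{}}\<close>
        \<open>complex_iso {{} :: 'v set} {{} :: 'b set}\<close> by (intro exI[of _ "{0}"]) simp
  qed simp_all
  then show ?thesis unfolding has_convex_ear_decomposition_def using ac dim
    by (intro conjI exI[of _ 0] exI[of _ "[{{}}]"]) simp_all
qed

context simplicial_fan
begin

section \<open>Restriction to a hyperplane and attachment of chambers\<close>

lemma closed_cell_hyperplane:
  assumes "b \<in> N" "b \<bullet> x = 0"
  shows "closed_cell (E \<inter> {y. b \<bullet> y = 0}) N x = cell x"
proof -
  have "closed_cell (E \<inter> {y. b \<bullet> y = 0}) N x = cell x \<inter> {y. b \<bullet> y = 0}"
    unfolding closed_cell_def by blast
  moreover have "cell x \<subseteq> {y. b \<bullet> y = 0}" using closed_cell_wallD[OF _ assms] by blast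
  ultimately show ?thesis by blast
qed

text \<open>Only the space changes. Keeping all of \<open>N\<close>, including \<open>b\<close>,
  which vanishes on the new space, leaves the cells inside the hyperplane as they were.\<close>

lemma simplicial_fan_hyperplane:
  assumes "b \<in> N"
  shows "simplicial_fan (E \<inter> {y. b \<bullet> y = 0}) N Z"
proof
  show "subspace (E \<inter> {y. b \<bullet> y = 0})" by (intro subspace_inter subspace_E subspace_hyperplane)
  show "x = 0" if "x \<in> E \<inter> {y. b \<bullet> y = 0}" "\<And>a. a \<in> N \<Longrightarrow> a \<bullet> x = 0" for x
    using essential_N that by blast
  show "\<exists>W\<subseteq>Z. independent W \<and> convex_cone hull W = closed_cell (E \<inter> {y. b \<bullet> y = 0}) N x"
    if "x \<in> E \<inter> {y. b \<bullet> y = 0}" for x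
    using simplicial_cells[of x] closed_cell_hyperplane[OF assms, of x] that by simp
  show "c = 1" if "z \<in> Z" "0 < c" "c *\<^sub>R z \<in> Z" for z c using that by (rule rays_Z)
qed (rule finite_N)

lemma fan_faces_hyperplane:
  assumes "b \<in> N"
  shows "fan_faces (E \<inter> {y. b \<bullet> y = 0}) N Z = {W \<in> faces. W \<subseteq> {y. b \<bullet> y = 0}}"
proof (intro equalityI subsetI)
  interpret L: simplicial_fan "E \<inter> {y. b \<bullet> y = 0}" N Z by (rule simplicial_fan_hyperplane[OF assms])
  fix W assume W: "W \<in> fan_faces (E \<inter> {y. b \<bullet> y = 0}) N Z"
  then obtain x where x: "x \<in> E" "b \<bullet> x = 0" "convex_cone hull W = cell x"
    using closed_cell_hyperplane[OF assms] by (auto simp: fan_faces_def)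
  then have "W \<in> faces" using L.face_rays[OF W] L.face_independent[OF W] by (auto simp: fan_faces_def)
  then show "W \<in> {W \<in> faces. W \<subseteq> {y. b \<bullet> y = 0}}" using L.face_subset[OF W] by blast
next
  fix W assume "W \<in> {W \<in> faces. W \<subseteq> {y. b \<bullet> y = 0}}"
  then have W: "W \<in> faces" "W \<subseteq> {y. b \<bullet> y = 0}" by auto
  then obtain x where x: "x \<in> E" "convex_cone hull W = cell x" by (auto simp: fan_faces_def)
  have "convex_cone hull W \<subseteq> {y. b \<bullet> y = 0}"
    by (rule hull_minimal[OF W(2)]) (rule subspace_imp_convex_cone[OF subspace_hyperplane])
  then have "b \<bullet> x = 0" using x closed_cell_refl by blast
  then show "W \<in> fan_faces (E \<inter> {y. b \<bullet> y = 0}) N Z"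
    using closed_cell_hyperplane[OF assms, of x] x face_rays[OF W(1)] face_independent[OF W(1)]
    by (auto simp: fan_faces_def)
qed

text \<open>The subcomplex is proper because the carrier of the antipode \<open>- p\<close> lies on
  the wrong side of every wall.\<close>

lemma chamber_convex_ear:
  assumes Q: "Q \<subseteq> N" "Q \<noteq> {}" and p: "p \<in> E" "\<And>q. q \<in> Q \<Longrightarrow> q \<bullet> p \<noteq> 0"
  shows "\<exists>(P::'a set) L. simplicial_polytope (dim E) P \<and> L \<subset> boundary_complex P \<and>
    complex_iso (chamber Q p) L"
proof -
  let ?D = "chamber Q p"
  obtain q where q: "q \<in> Q" using Q(2) by blast
  have mE: "- p \<in> E" using p(1) subspace_E by (rule subspace_neg[rotated])
  obtain W where W: "W \<in> faces" "- p \<in> open_cone W" using carrier_face[OF mE] .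
  have "- p \<notin> closed_cell E Q p"
  proof
    assume "- p \<in> closed_cell E Q p"
    then have "sgn (q \<bullet> (- p)) = sgn (q \<bullet> p)" using closed_cell_sgnD q p(2)[OF q] by fastforce
    then show False using p(2)[OF q] by (simp add: sgn_if split: if_splits)
  qed
  then have "W \<notin> ?D" using face_subset_chamber_iff[OF W Q(1)] by (simp add: chamber_faces_def)
  then have sub: "?D \<subset> faces" using W(1) by (auto simp: chamber_faces_def)
  show ?thesis
    by (intro exI conjI, rule simplicial_polytope_polar_ball, rule proper_subcomplex_polar_ball[OF sub],
        rule complex_iso_subcomplex[OF psubset_imp_subset[OF sub]])
qed

lemma chamber_faces_cong:
  assumes "\<And>q. q \<in> Q \<Longrightarrow> sgn (q \<bullet> p) = sgn (q \<bullet> p')"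
  shows "chamber Q p = chamber Q p'"
  using assms by (simp add: chamber_faces_def closed_cell_def)

text \<open>Distinct chambers have different signs on some \<open>q\<close>, and a point of both
  closures must vanish on it.\<close>

lemma chamber_faces_Int:
  assumes W: "W \<in> chamber Q p" "W \<in> chamber Q p'"
    and ne: "chamber Q p \<noteq> chamber Q p'"
  shows "\<exists>q\<in>Q. W \<subseteq> {x. q \<bullet> x = 0}"
proof -
  obtain q where q: "q \<in> Q" "sgn (q \<bullet> p) \<noteq> sgn (q \<bullet> p')" using chamber_faces_cong ne by blast
  have "q \<bullet> w = 0" if "w \<in> W" for w
    using closed_cell_sgnD[OF _ q(1), of w E p] closed_cell_sgnD[OF _ q(1), of w E p'] q(2)
      chamber_facesD(2)[OF W(1)] chamber_facesD(2)[OF W(2)] that by force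
  then show ?thesis using q(1) by blast
qed

text \<open>Perturbing the barycentre of \<open>W\<close> to a point off the walls names a chamber
  whose closure contains \<open>W\<close>.\<close>

lemma chamber_covering:
  assumes Q: "Q \<subseteq> N" "\<And>q. q \<in> Q \<Longrightarrow> \<exists>x\<in>E. q \<bullet> x \<noteq> 0" and W: "W \<in> faces"
  obtains p where "p \<in> E" "\<And>q. q \<in> Q \<Longrightarrow> q \<bullet> p \<noteq> 0" "W \<in> chamber Q p"
proof -
  have xW: "\<Sum>W \<in> open_cone W" by (rule sum_in_open_cone)
  have xE: "\<Sum>W \<in> E" using open_cone_subset_E[OF W] xW by blast
  obtain p where p: "p \<in> E" "\<And>q. q \<in> Q \<Longrightarrow> q \<bullet> p \<noteq> 0"
    "\<And>q. q \<in> Q \<Longrightarrow> q \<bullet> \<Sum>W \<noteq> 0 \<Longrightarrow> sgn (q \<bullet> p) = sgn (q \<bullet> \<Sum>W)"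
    using generic_point_near[OF subspace_E finite_subset[OF Q(1) finite_N] Q(2) xE] by blast
  have "q \<bullet> \<Sum>W = 0 \<or> sgn (q \<bullet> \<Sum>W) = sgn (q \<bullet> p)" if "q \<in> Q" for q
    using p(3)[OF that] by (cases "q \<bullet> \<Sum>W = 0") simp_all
  then have "\<Sum>W \<in> closed_cell E Q p" using xE unfolding closed_cell_def by blast
  then have "W \<in> chamber Q p"
    using face_subset_chamber_iff[OF W xW Q(1)] W by (simp add: chamber_faces_def)
  then show ?thesis using that p by blast
qed

text \<open>Outer induction over the hyperplanes, inner induction over the chambers of the new one.
  The last assumption says that no hyperplane of \<open>B\<close> contains another within
  \<open>E\<close>, so each earlier one cuts the new one properly. From the second hyperplane on
  there is at least one wall, as required for balls.\<close>

lemma faces_in_hyperplanes_convex_ear_decomposition: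
  assumes "finite B" "B \<noteq> {}" "B \<subseteq> N"
    and "\<And>b. b \<in> B \<Longrightarrow> \<exists>x\<in>E. b \<bullet> x \<noteq> 0"
    and "\<And>b c. b \<in> B \<Longrightarrow> c \<in> B \<Longrightarrow> b \<noteq> c \<Longrightarrow> \<exists>x\<in>E. b \<bullet> x = 0 \<and> c \<bullet> x \<noteq> 0"
  shows "\<exists>Ks. convex_ear_decomposition TYPE('a) (dim E - 1) {W \<in> faces. \<exists>b\<in>B. W \<subseteq> {x. b \<bullet> x = 0}} Ks"
  using assms
proof (induction B rule: finite_ne_induct)
  case (singleton b)
  let ?E = "E \<inter> {y. b \<bullet> y = 0}"
  have bN: "b \<in> N" using singleton by simp
  interpret L: simplicial_fan ?E N Z by (rule simplicial_fan_hyperplane[OF bN])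
  obtain v where v: "v \<in> E" "b \<bullet> v \<noteq> 0" using singleton.prems(2) by blast
  have d: "dim ?E = dim E - 1" using dim_Int_hyperplane[OF subspace_E v] by simp
  have K: "{W \<in> faces. \<exists>b\<in>{b}. W \<subseteq> {x. b \<bullet> x = 0}} = L.faces"
    using fan_faces_hyperplane[OF bN] by simp
  have "0 \<in> ?E" by (rule subspace_0[OF L.subspace_E])
  then have pd: "pure_complex L.faces" "complex_dim L.faces = int (dim E - 1) - 1"
    using L.pure_complex_chamber[of "{}" 0] L.complex_dim_chamber[of "{}" 0]
    by (simp_all add: L.chamber_faces_no_walls d)
  have P: "simplicial_polytope (dim E - 1) L.polar_ball"
    using L.simplicial_polytope_polar_ball unfolding d .
  have iso: "complex_iso L.faces (boundary_complex L.polar_ball)"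
    unfolding L.boundary_complex_polar_ball by (rule L.complex_iso_subcomplex) simp
  have "convex_ear_decomposition TYPE('a) (dim E - 1) L.faces [L.faces]"
    unfolding convex_ear_decomposition_def using pd P iso by auto
  then show ?case unfolding K by blast
next
  case (insert b B)
  let ?E = "E \<inter> {y. b \<bullet> y = 0}"
  define d where "d = dim E - 1"
  define KB where "KB = {W \<in> faces. \<exists>b\<in>B. W \<subseteq> {x. b \<bullet> x = 0}}"
  have bN: "b \<in> N" and BN: "B \<subseteq> N" using insert.prems(1) by auto
  interpret L: simplicial_fan ?E N Z by (rule simplicial_fan_hyperplane[OF bN])
  obtain v where v: "v \<in> E" "b \<bullet> v \<noteq> 0" using insert.prems(2) by blast
  have dE: "dim ?E = d" using dim_Int_hyperplane[OF subspace_E v] by (simp add: d_def)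
  have Lfaces: "L.faces = {W \<in> faces. W \<subseteq> {x. b \<bullet> x = 0}}" by (rule fan_faces_hyperplane[OF bN])
  have "\<exists>Ks. convex_ear_decomposition TYPE('a) d KB Ks"
    unfolding d_def KB_def
  proof (rule insert.IH[OF BN])
    show "\<exists>x\<in>E. c \<bullet> x \<noteq> 0" if "c \<in> B" for c using insert.prems(2) that by simp
    show "\<exists>x\<in>E. c \<bullet> x = 0 \<and> c' \<bullet> x \<noteq> 0" if "c \<in> B" "c' \<in> B" "c \<noteq> c'" for c c'
      using insert.prems(3) that by simp
  qed
  then obtain Ks where Ks: "convex_ear_decomposition TYPE('a) d KB Ks" by blast
  have Lnz: "\<exists>x\<in>?E. q \<bullet> x \<noteq> 0" if "q \<in> B" for q
  proof -
    have "b \<noteq> q" using that insert.hyps by blast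
    then show ?thesis using insert.prems(3)[of b q] that by auto
  qed
  \<comment> \<open>Collected as a set, so that points \<open>p\<close> of the same chamber
    contribute it only once.\<close>
  define Ch where "Ch = {chamber_faces ?E N Z B p | p. p \<in> ?E \<and> (\<forall>q\<in>B. q \<bullet> p \<noteq> 0)}"
  have "Ch \<subseteq> Pow L.faces" by (auto simp: Ch_def chamber_faces_def)
  then have finCh: "finite Ch" using L.finite_faces finite_subset by auto
  have "\<exists>Ks. convex_ear_decomposition TYPE('a) d (KB \<union> \<Union>S) Ks" if "finite S" "S \<subseteq> Ch" for S
    using that
  proof (induction S rule: finite_induct)
    case empty
    then show ?case using Ks by auto
  next
    case (insert D S)
    then obtain Ks where Ks: "convex_ear_decomposition TYPE('a) d (KB \<union> \<Union>S) Ks" by auto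
    obtain p where D: "D = chamber_faces ?E N Z B p" and p: "p \<in> ?E" "\<And>q. q \<in> B \<Longrightarrow> q \<bullet> p \<noteq> 0"
      using insert.prems by (auto simp: Ch_def)
    note ear = BN p
    \<comment> \<open>A face shared with another chamber lies on a wall by difference of signs, and
      a face shared with \<open>KB\<close> does so by definition. Conversely faces on walls are
      already in \<open>KB\<close>, so the order of the chambers does not matter.\<close>
    have "D \<inter> (KB \<union> \<Union>S) = ball_boundary D"
    proof -
      have "\<exists>q\<in>B. W \<subseteq> {x. q \<bullet> x = 0}" if W: "W \<in> D" "W \<in> KB \<union> \<Union>S" for W
      proof (cases "W \<in> KB")
        case False
        then obtain D' where D': "D' \<in> S" "W \<in> D'" using W by blast
        then have "D' \<in> Ch" "D' \<noteq> D" using insert.prems insert.hyps by auto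
        then obtain p' where "D' = chamber_faces ?E N Z B p'" by (auto simp: Ch_def)
        then show ?thesis using L.chamber_faces_Int[of W B p p'] W D' \<open>D' \<noteq> D\<close> D by simp
      qed (simp add: KB_def)
      moreover have "W \<in> KB" if "W \<in> D" "\<exists>q\<in>B. W \<subseteq> {x. q \<bullet> x = 0}" for W
        using that Lfaces by (auto simp: D KB_def chamber_faces_def)
      ultimately have "D \<inter> (KB \<union> \<Union>S) = {W \<in> D. \<exists>q\<in>B. W \<subseteq> {x. q \<bullet> x = 0}}" by blast
      then show ?thesis using L.ball_boundary_chamber[OF ear] D by simp
    qed
    then have "convex_ear_decomposition TYPE('a) d (KB \<union> \<Union>S \<union> D) (Ks @ [D])"
      using convex_ear_decomposition_snoc[OF Ks, of D] L.pure_complex_chamber[OF ear]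
        L.complex_dim_chamber[OF ear] L.simplicial_ball_chamber[OF BN \<open>B \<noteq> {}\<close> p]
        L.chamber_convex_ear[OF BN \<open>B \<noteq> {}\<close> p] by (simp add: D dE)
    moreover have "KB \<union> \<Union>S \<union> D = KB \<union> \<Union>(insert D S)" by auto
    ultimately have "convex_ear_decomposition TYPE('a) d (KB \<union> \<Union>(insert D S)) (Ks @ [D])" by simp
    then show ?case by (rule exI)
  qed
  then obtain Ks' where Ks': "convex_ear_decomposition TYPE('a) d (KB \<union> \<Union>Ch) Ks'" using finCh by blast
  have "L.faces \<subseteq> \<Union>Ch"
  proof
    fix W assume "W \<in> L.faces"
    then obtain p where "p \<in> ?E" "\<And>q. q \<in> B \<Longrightarrow> q \<bullet> p \<noteq> 0" "W \<in> chamber_faces ?E N Z B p"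
      using L.chamber_covering[OF BN Lnz] by blast
    then show "W \<in> \<Union>Ch" unfolding Ch_def by blast
  qed
  then have "\<Union>Ch = L.faces" using \<open>Ch \<subseteq> Pow L.faces\<close> by blast
  then have "KB \<union> \<Union>Ch = {W \<in> faces. \<exists>c\<in>insert b B. W \<subseteq> {x. c \<bullet> x = 0}}"
    unfolding KB_def Lfaces by auto
  then have "convex_ear_decomposition TYPE('a) d {W \<in> faces. \<exists>c\<in>insert b B. W \<subseteq> {x. c \<bullet> x = 0}} Ks'"
    using Ks' by simp
  then show ?case unfolding d_def by (rule exI)
qed

theorem has_convex_ear_decomposition_faces_in_hyperplanes:
  assumes B: "B \<subseteq> N" "B \<noteq> {}"
    and nz: "\<And>b. b \<in> B \<Longrightarrow> \<exists>x\<in>E. b \<bullet> x \<noteq> 0"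
    and distinct: "\<And>b c. b \<in> B \<Longrightarrow> c \<in> B \<Longrightarrow> b \<noteq> c \<Longrightarrow> \<exists>x\<in>E. b \<bullet> x = 0 \<and> c \<bullet> x \<noteq> 0"
  shows "has_convex_ear_decomposition TYPE('a) {W \<in> faces. \<exists>b\<in>B. W \<subseteq> {x. b \<bullet> x = 0}}" (is "has_convex_ear_decomposition _ ?K")
proof -
  obtain Ks where Ks: "convex_ear_decomposition TYPE('a) (dim E - 1) ?K Ks"
    using faces_in_hyperplanes_convex_ear_decomposition[OF finite_subset[OF B(1) finite_N] B(2,1) nz distinct] by blast
  have fin: "finite ?K" using finite_faces by simp
  have "F \<in> ?K" if "W \<in> ?K" "F \<subseteq> W" for F W
    using that face_down_closed by blast
  moreover have "{} \<in> ?K" using B(2) empty_face by auto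
  moreover have "finite W" if "W \<in> ?K" for W using that face_finite by simp
  ultimately have "abstract_complex ?K"
    unfolding abstract_complex_def using fin by (intro conjI ballI allI impI)
  then show ?thesis
    unfolding has_convex_ear_decomposition_def
    using Ks convex_ear_decomposition_complex_dim[OF Ks fin] by (intro conjI exI)
qed

end


section \<open>Hyperplane arrangements\<close>

lemma parallel_normals:
  fixes a n :: "'a::euclidean_space"
  assumes "{z. n \<bullet> z = 0} \<subseteq> {z. a \<bullet> z = 0}"
  shows "\<exists>c. a = c *\<^sub>R n"
proof (cases "n = 0")
  case True
  then have "a \<in> {z. n \<bullet> z = 0}" by simp
  then have "a \<bullet> a = 0" using assms by blast
  then show ?thesis by auto
next
  case False
  define c where "c = (a \<bullet> n) / (n \<bullet> n)"
  define v where "v = a - c *\<^sub>R n"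
  have nv: "n \<bullet> v = 0" using False by (simp add: v_def c_def inner_diff_right inner_commute)
  then have "a \<bullet> v = 0" using assms by blast
  then have "v \<bullet> v = 0" using nv by (simp add: v_def inner_diff_left)
  then show ?thesis by (auto simp: v_def)
qed

lemma convex_cone_eqI_sphere:
  fixes C D :: "'a::euclidean_space set"
  assumes "convex_cone C" "convex_cone D" "C \<inter> sphere 0 1 = D \<inter> sphere 0 1"
  shows "C = D"
proof -
  have sub: "C \<subseteq> D" if C: "convex_cone C" and D: "convex_cone D" and eq: "C \<inter> sphere 0 1 = D \<inter> sphere 0 1"
    for C D :: "'a set"
  proof
    fix y assume y: "y \<in> C"
    show "y \<in> D"
    proof (cases "y = 0")
      case True
      then show ?thesis using convex_cone_contains_0[OF D] by simp
    next
      case False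
      have "(1 / norm y) *\<^sub>R y \<in> C \<inter> sphere 0 1"
        using False convex_cone_scaleR[OF C _ y, of "1 / norm y"] by simp
      then have "(1 / norm y) *\<^sub>R y \<in> D" using eq by blast
      then have "norm y *\<^sub>R ((1 / norm y) *\<^sub>R y) \<in> D"
        by (rule convex_cone_scaleR[OF D norm_ge_zero])
      then show ?thesis using False by simp
    qed
  qed
  show ?thesis using sub[OF assms] sub[OF assms(2,1) assms(3)[symmetric]] by blast
qed

text \<open>Any other equation of \<open>H\<close> has constant term 0 and a normal parallel to
  \<open>n\<close>, so it multiplies both signs by the same factor.\<close>

lemma same_side_iff:
  fixes n :: "'a::euclidean_space"
  assumes "H = {z. n \<bullet> z = 0}"
  shows "same_side H x y \<longleftrightarrow> sgn (n \<bullet> x) = sgn (n \<bullet> y)"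
proof
  assume "same_side H x y"
  then have "sgn (n \<bullet> x - 0) = sgn (n \<bullet> y - 0)" unfolding same_side_def using assms by blast
  then show "sgn (n \<bullet> x) = sgn (n \<bullet> y)" by simp
next
  assume eq: "sgn (n \<bullet> x) = sgn (n \<bullet> y)"
  show "same_side H x y" unfolding same_side_def
  proof (intro allI impI)
    fix a b assume ab: "H = {z. a \<bullet> z = b}"
    have "0 \<in> H" using assms by simp
    then have b: "b = 0" using ab by simp
    obtain c where "a = c *\<^sub>R n" using parallel_normals[of n a] assms ab b by auto
    then show "sgn (a \<bullet> x - b) = sgn (a \<bullet> y - b)" using b eq by (simp add: sgn_mult)
  qed
qed

text \<open>If \<open>y\<close> lies in the closed cell, then \<open>y + t *\<^sub>R x\<close> lies
  in the open one for every \<open>t > 0\<close>: vanishing forms take the sign of \<open>x\<close>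
  and the others agree with it already.\<close>

lemma closure_open_cell:
  fixes x :: "'a::euclidean_space"
  shows "closure {y. \<forall>a\<in>N. sgn (a \<bullet> x) = sgn (a \<bullet> y)} = closed_cell UNIV N x" (is "closure ?O = _")
proof
  have "closed {y. a \<bullet> y = 0 \<or> sgn (a \<bullet> y) = sgn (a \<bullet> x)}" for a
    by (rule sgn_region_cases) (simp_all add: closed_hyperplane closed_halfspace_ge closed_halfspace_le)
  moreover have "closed_cell UNIV N x = (\<Inter>a\<in>N. {y. a \<bullet> y = 0 \<or> sgn (a \<bullet> y) = sgn (a \<bullet> x)})"
    unfolding closed_cell_def by blast
  ultimately have "closed (closed_cell UNIV N x)" by auto
  then show "closure ?O \<subseteq> closed_cell UNIV N x"
    by (rule closure_minimal[rotated]) (auto simp: closed_cell_def)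
  show "closed_cell UNIV N x \<subseteq> closure ?O"
  proof
    fix y assume y: "y \<in> closed_cell UNIV N x"
    have mem: "y + t *\<^sub>R x \<in> ?O" if t: "t > 0" for t
    proof (intro CollectI ballI)
      fix a assume a: "a \<in> N"
      show "sgn (a \<bullet> x) = sgn (a \<bullet> (y + t *\<^sub>R x))"
      proof (cases "a \<bullet> y = 0")
        case True
        then show ?thesis using t by (simp add: inner_add_right sgn_mult)
      next
        case False
        then have "sgn (a \<bullet> y) = sgn (a \<bullet> x)" using closed_cell_sgnD[OF y a] by simp
        moreover have "sgn (u + t * v) = sgn u" if "sgn u = sgn v" for u v :: real
        proof (cases u "0 :: real" rule: linorder_cases)
          case less
          then have "v < 0" using that by (auto simp: sgn_if split: if_splits)
          then have "t * v < 0" using t by (simp add: mult_pos_neg)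
          then show ?thesis using less by simp
        next
          case greater
          then have "v > 0" using that by (auto simp: sgn_if split: if_splits)
          then have "t * v > 0" using t by simp
          then show ?thesis using greater by simp
        qed (use that in \<open>auto simp: sgn_zero_iff\<close>)
        ultimately show ?thesis by (simp add: inner_add_right)
      qed
    qed
    show "y \<in> closure ?O" unfolding closure_approachable
    proof (intro allI impI)
      fix e :: real assume e: "e > 0"
      \<comment> \<open>The summand 1 covers \<open>x = 0\<close>, where \<open>norm x\<close> could
        not be divided by.\<close>
      define t where "t = e / (norm x + 1)"
      have pos: "0 < norm x + 1" using norm_ge_zero[of x] by linarith
      have "t > 0" using e pos by (simp add: t_def)
      moreover have "dist (y + t *\<^sub>R x) y < e"
      proof -
        have "dist (y + t *\<^sub>R x) y = t * norm x" using \<open>t > 0\<close> by (simp add: dist_norm)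
        also have "\<dots> < t * (norm x + 1)" using \<open>t > 0\<close> by simp
        also have "\<dots> = e" using pos by (simp add: t_def)
        finally show ?thesis .
      qed
      ultimately show "\<exists>z\<in>?O. dist z y < e" using mem by blast
    qed
  qed
qed

text \<open>\<open>induced_subcomplex\<close> asks for cells inside the union of \<open>B\<close>,
  the fan theorem for faces inside one hyperplane. These agree: the member of \<open>B\<close>
  through the normalized barycentre of a nonempty face contains the whole face.\<close>

theorem induced_subcomplex_convex_ear_decomposition:
  fixes A B :: "'a::euclidean_space set set"
  assumes A: "arrangement A" "essential A" "central A" "simplicial_arrangement A" and B: "B \<subseteq> A"
  shows "has_convex_ear_decomposition TYPE('a) (induced_subcomplex A B)"
proof -
  have "\<exists>n. n \<noteq> 0 \<and> H = {z. n \<bullet> z = 0}" if H: "H \<in> A" for H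
  proof -
    obtain a b where ab: "a \<noteq> 0" "H = {x. a \<bullet> x = b}"
      using A(1) H unfolding arrangement_def is_hyperplane_def by blast
    moreover have "0 \<in> H" using A(3) H by (simp add: central_def)
    ultimately show ?thesis by auto
  qed
  then obtain n where n: "\<And>H. H \<in> A \<Longrightarrow> n H \<noteq> 0 \<and> H = {z. n H \<bullet> z = 0}" by metis
  have n0: "n H \<noteq> 0" if "H \<in> B" for H using n[of H] that B by blast
  have nH: "{z. n H \<bullet> z = 0} = H" if "H \<in> B" for H using n[of H] that B by blast
  define N where "N = n ` A"
  let ?S = "sphere (0::'a) 1"
  have cells: "arrangement_cells A = range (\<lambda>x. {y. \<forall>a\<in>N. sgn (a \<bullet> x) = sgn (a \<bullet> y)})"
  proof -
    have "same_side H x y \<longleftrightarrow> sgn (n H \<bullet> x) = sgn (n H \<bullet> y)" if "H \<in> A" for H x y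
      using same_side_iff n[OF that] by blast
    then have "{y. \<forall>H\<in>A. same_side H x y} = {y. \<forall>a\<in>N. sgn (a \<bullet> x) = sgn (a \<bullet> y)}" for x
      by (simp add: N_def)
    then show ?thesis unfolding arrangement_cells_def by simp
  qed
  have sphere_cells: "sphere_cells A = range (\<lambda>x. closed_cell UNIV N x \<inter> ?S)"
    unfolding sphere_cells_def cells closure_open_cell[symmetric] by blast
  have simplex_iff: "spherical_simplex W (closed_cell UNIV N x \<inter> ?S) \<longleftrightarrow>
      W \<subseteq> ?S \<and> independent W \<and> convex_cone hull W = closed_cell UNIV N x" for W x
    unfolding spherical_simplex_def
    using convex_cone_eqI_sphere[OF convex_cone_convex_cone_hull[of W] convex_cone_closed_cell[OF subspace_UNIV, of N x]]
    by auto
  interpret simplicial_fan UNIV N ?S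
  proof
    show "finite N" using A(1) by (simp add: N_def arrangement_def)
    show "x = 0" if "\<And>a. a \<in> N \<Longrightarrow> a \<bullet> x = 0" for x
    proof -
      obtain p where p: "\<Inter>A = {p}" using A(2) by (auto simp: essential_def)
      have "0 \<in> \<Inter>A" using A(3) by (simp add: central_def)
      moreover have "x \<in> \<Inter>A"
      proof
        fix H assume H: "H \<in> A"
        have "n H \<bullet> x = 0" using that H by (simp add: N_def)
        then show "x \<in> H" using n[OF H] by blast
      qed
      ultimately show ?thesis using p by auto
    qed
    show "c = 1" if "z \<in> ?S" "0 < c" "c *\<^sub>R z \<in> ?S" for z c using that by simp
    show "\<exists>W\<subseteq>?S. independent W \<and> convex_cone hull W = closed_cell UNIV N x" for x
    proof -
      obtain W where "spherical_simplex W (closed_cell UNIV N x \<inter> ?S)"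
        using A(4) unfolding simplicial_arrangement_def sphere_cells by blast
      then show ?thesis unfolding simplex_iff by blast
    qed
  qed simp
  have induced: "W \<in> induced_subcomplex A B \<longleftrightarrow>
      W \<in> faces \<and> convex_cone hull W \<inter> ?S \<subseteq> \<Union>B" for W
  proof -
    have "W \<in> induced_subcomplex A B \<longleftrightarrow> (\<exists>x. cell x \<inter> ?S \<subseteq> \<Union>B \<and> spherical_simplex W (cell x \<inter> ?S))"
      unfolding induced_subcomplex_def sphere_cells by blast
    also have "\<dots> \<longleftrightarrow> W \<subseteq> ?S \<and> independent W \<and> (\<exists>x. convex_cone hull W = cell x) \<and> convex_cone hull W \<inter> ?S \<subseteq> \<Union>B"
      unfolding simplex_iff by metis
    finally show ?thesis by (simp add: fan_faces_def)
  qed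
  \<comment> \<open>The sum of \<open>W\<close> is scaled to the unit sphere because containment in
    the union of \<open>B\<close> is only tested there.\<close>
  have bary: "(1 / norm (\<Sum>W)) *\<^sub>R \<Sum>W \<in> convex_cone hull W \<inter> ?S" "\<Sum>W \<noteq> 0" if W: "W \<in> faces" "W \<noteq> {}" for W
  proof -
    show ne: "\<Sum>W \<noteq> 0" using zero_notin_open_cone[OF W] sum_in_open_cone[of W] by metis
    have "\<Sum>W \<in> convex_cone hull W" using open_cone_subset[OF face_finite[OF W(1)]] sum_in_open_cone by blast
    then show "(1 / norm (\<Sum>W)) *\<^sub>R \<Sum>W \<in> convex_cone hull W \<inter> ?S"
      using ne by (simp add: convex_cone_hull_mul)
  qed
  show ?thesis
  proof (cases "B = {}")
    case True
    have "induced_subcomplex A B = {{}}"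
    proof (intro equalityI subsetI)
      fix W assume "W \<in> induced_subcomplex A B"
      then have "W \<in> faces" "convex_cone hull W \<inter> ?S = {}" using induced True by auto
      then show "W \<in> {{}}" using bary(1)[of W] by (cases "W = {}") auto
    next
      fix W :: "'a set" assume "W \<in> {{}}"
      moreover have "convex_cone hull {} \<inter> ?S = {}" by (auto simp: convex_cone_hull_finite)
      ultimately show "W \<in> induced_subcomplex A B" using induced[of "{}"] empty_face by auto
    qed
    then show ?thesis using has_convex_ear_decomposition_trivial by simp
  next
    case False
    have "induced_subcomplex A B = {W \<in> faces. \<exists>b\<in>n ` B. W \<subseteq> {x. b \<bullet> x = 0}}"
    proof (intro equalityI subsetI)
      fix W assume W: "W \<in> induced_subcomplex A B"
      then have WF: "W \<in> faces" and sub: "convex_cone hull W \<inter> ?S \<subseteq> \<Union>B" using induced by auto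
      have "\<exists>b\<in>n ` B. W \<subseteq> {x. b \<bullet> x = 0}"
      proof (cases "W = {}")
        case True
        then show ?thesis using False by auto
      next
        case ne: False
        obtain H where H: "H \<in> B" "(1 / norm (\<Sum>W)) *\<^sub>R \<Sum>W \<in> H" using bary(1)[OF WF ne] sub by blast
        then have "n H \<bullet> ((1 / norm (\<Sum>W)) *\<^sub>R \<Sum>W) = 0" using nH[OF H(1)] by blast
        then have "n H \<bullet> \<Sum>W = 0" using bary(2)[OF WF ne] by simp
        moreover have "n H \<in> N" using H(1) B by (auto simp: N_def)
        ultimately have "W \<subseteq> {x. n H \<bullet> x = 0}"
          using face_subset_hyperplane_iff[OF WF sum_in_open_cone] by simp
        then show ?thesis using H(1) by blast
      qed
      then show "W \<in> {W \<in> faces. \<exists>b\<in>n ` B. W \<subseteq> {x. b \<bullet> x = 0}}" using WF by simp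
    next
      fix W assume "W \<in> {W \<in> faces. \<exists>b\<in>n ` B. W \<subseteq> {x. b \<bullet> x = 0}}"
      then obtain H where W: "W \<in> faces" "H \<in> B" "W \<subseteq> {x. n H \<bullet> x = 0}" by blast
      have "convex_cone hull W \<subseteq> {x. n H \<bullet> x = 0}"
        by (rule hull_minimal[OF W(3)]) (rule subspace_imp_convex_cone[OF subspace_hyperplane])
      also have "\<dots> = H" by (rule nH[OF W(2)])
      finally show "W \<in> induced_subcomplex A B" using W induced by blast
    qed
    moreover have "has_convex_ear_decomposition TYPE('a) {W \<in> faces. \<exists>b\<in>n ` B. W \<subseteq> {x. b \<bullet> x = 0}}"
    proof (rule has_convex_ear_decomposition_faces_in_hyperplanes)
      show "n ` B \<subseteq> N" "n ` B \<noteq> {}" using B False by (auto simp: N_def)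
      show "\<exists>x\<in>UNIV. b \<bullet> x \<noteq> 0" if b: "b \<in> n ` B" for b
      proof -
        have "b \<noteq> 0" using b n0 by auto
        then have "b \<bullet> b \<noteq> 0" by simp
        then show ?thesis by blast
      qed
      show "\<exists>x\<in>UNIV. b \<bullet> x = 0 \<and> c \<bullet> x \<noteq> 0" if bc: "b \<in> n ` B" "c \<in> n ` B" "b \<noteq> c" for b c
      proof (rule ccontr)
        assume "\<not> ?thesis"
        then have "{x. b \<bullet> x = 0} \<subseteq> {x. c \<bullet> x = 0}" by blast
        then obtain k where k: "c = k *\<^sub>R b" using parallel_normals by blast
        obtain H H' where H: "H \<in> B" "b = n H" "H' \<in> B" "c = n H'" using bc by blast
        have "c \<noteq> 0" using n0[OF H(3)] H(4) by simp
        then have "k \<noteq> 0" using k by auto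
        then have "{x. b \<bullet> x = 0} = {x. c \<bullet> x = 0}" using k by auto
        then have "H = H'" using nH[OF H(1)] nH[OF H(3)] H(2,4) by simp
        then show False using H bc(3) by simp
      qed
    qed
    ultimately show ?thesis by simp
  qed
qed


section \<open>Relabelling the vertices\<close>

text \<open>The fan produces complexes on vectors, whereas the vertices of the coloring complex are
  subsets of \<open>V\<close>. Since ears are subcomplexes and not isomorphism types, the whole
  decomposition has to be transported along one injection.\<close>

definition relabel :: "('v \<Rightarrow> 'w) \<Rightarrow> 'v set set \<Rightarrow> 'w set set" where
  "relabel h K = (\<lambda>F. h ` F) ` K"

lemma relabel_mono: "K \<subseteq> L \<Longrightarrow> relabel h K \<subseteq> relabel h L"
  unfolding relabel_def by (rule image_mono)

lemma relabel_Union: "relabel h (\<Union>\<K>) = (\<Union>K\<in>\<K>. relabel h K)"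
  unfolding relabel_def by blast

text \<open>As a cardinality, unique existence of a facet passes through the bijection on faces by
  \<open>card_image\<close>.\<close>

lemma ex1_iff_card: "(\<exists>!x. P x) \<longleftrightarrow> card {x. P x} = 1"
  by (simp add: card_1_singleton_iff) (metis mem_Collect_eq singletonD singletonI Collect_cong singleton_conv)

context
  fixes h :: "'v \<Rightarrow> 'w" and K :: "'v set set"
  assumes inj: "inj_on h (\<Union>K)" and K: "abstract_complex K"
begin

lemma relabel_inj: "inj_on (\<lambda>F. h ` F) K"
  using inj_on_image_Pow[OF inj] by (rule inj_on_subset) blast

lemma relabel_Int:
  assumes "A \<subseteq> K" "B \<subseteq> K"
  shows "relabel h (A \<inter> B) = relabel h A \<inter> relabel h B"
  unfolding relabel_def by (rule inj_on_image_Int[OF relabel_inj assms])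

lemma relabel_face_dim: "F \<in> K \<Longrightarrow> face_dim (h ` F) = face_dim F"
proof -
  assume "F \<in> K"
  then have "inj_on h F" using inj by (rule_tac inj_on_subset) auto
  then show ?thesis by (simp add: face_dim_def card_image)
qed

lemma relabel_complex_dim: "complex_dim (relabel h K) = complex_dim K"
proof -
  have "face_dim ` relabel h K = face_dim ` K"
    unfolding relabel_def image_image using relabel_face_dim by (rule image_cong[OF refl])
  then show ?thesis by (simp add: complex_dim_def)
qed

lemma relabel_abstract_complex: "abstract_complex (relabel h K)"
  unfolding abstract_complex_def
proof (intro conjI ballI allI impI)
  show "finite (relabel h K)" using K by (simp add: relabel_def abstract_complex_def)
  show "{} \<in> relabel h K" using K by (force simp: relabel_def abstract_complex_def)
next
  fix F assume "F \<in> relabel h K"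
  then obtain F0 where F0: "F0 \<in> K" "F = h ` F0" by (auto simp: relabel_def)
  show "finite F" using F0 K by (simp add: abstract_complex_def)
  fix G assume "G \<subseteq> F"
  then obtain G0 where G0: "G0 \<subseteq> F0" "G = h ` G0" unfolding F0(2) by (meson subset_imageE)
  then have "G0 \<in> K" using K F0(1) unfolding abstract_complex_def by blast
  then show "G \<in> relabel h K" using G0 by (auto simp: relabel_def)
qed

lemma relabel_pure_complex:
  assumes "pure_complex K"
  shows "pure_complex (relabel h K)"
  unfolding pure_complex_def
proof (intro conjI ballI)
  show "abstract_complex (relabel h K)" by (rule relabel_abstract_complex)
  fix F assume "F \<in> relabel h K"
  then obtain F0 where F0: "F0 \<in> K" "F = h ` F0" by (auto simp: relabel_def)
  obtain G where G: "G \<in> K" "F0 \<subseteq> G" "face_dim G = complex_dim K"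
    using assms F0(1) unfolding pure_complex_def by blast
  show "\<exists>G\<in>relabel h K. F \<subseteq> G \<and> face_dim G = complex_dim (relabel h K)"
  proof (intro bexI conjI)
    show "h ` G \<in> relabel h K" using G(1) by (simp add: relabel_def)
    show "F \<subseteq> h ` G" using F0 G by auto
    show "face_dim (h ` G) = complex_dim (relabel h K)"
      using relabel_face_dim[OF G(1)] G(3) by (simp add: relabel_complex_dim)
  qed
qed

lemma relabel_complex_iso:
  assumes "complex_iso K L"
  shows "complex_iso (relabel h K) L"
proof -
  obtain f where f: "inj_on f (\<Union>K)" "L = (\<lambda>F. f ` F) ` K" using assms unfolding complex_iso_def by blast
  let ?r = "inv_into (\<Union>K) h"
  have r: "?r ` h ` F = F" if "F \<subseteq> \<Union>K" for F using inv_into_image_cancel[OF inj that] .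
  have "\<Union>(relabel h K) = h ` \<Union>K" by (auto simp: relabel_def)
  moreover have "inj_on (f \<circ> ?r) (h ` \<Union>K)"
    by (rule comp_inj_on) (simp_all add: inj_on_inv_into r f(1))
  moreover have "L = (\<lambda>F. (f \<circ> ?r) ` F) ` relabel h K"
  proof -
    have eq: "(f \<circ> ?r) ` (h ` F) = f ` F" if "F \<in> K" for F
    proof -
      have "F \<subseteq> \<Union>K" using that by blast
      then show ?thesis unfolding image_comp[symmetric] by (simp only: r)
    qed
    have "(\<lambda>F. (f \<circ> ?r) ` F) ` relabel h K = ((\<lambda>F. (f \<circ> ?r) ` F) \<circ> (\<lambda>F. h ` F)) ` K"
      unfolding relabel_def by (rule image_comp)
    also have "\<dots> = (\<lambda>F. f ` F) ` K" by (rule image_cong[OF refl]) (simp only: comp_apply[of "\<lambda>F. (f \<circ> ?r) ` F"] eq)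
    finally show ?thesis using f(2) by simp
  qed
  ultimately show ?thesis unfolding complex_iso_def by (intro exI[of _ "f \<circ> ?r"]) simp
qed

lemma relabel_ball_boundary: "ball_boundary (relabel h K) = relabel h (ball_boundary K)"
proof -
  have sub: "h ` R \<subset> h ` G \<longleftrightarrow> R \<subset> G" if "R \<in> K" "G \<in> K" for R G
  proof -
    have *: "R \<subseteq> \<Union>K" "G \<subseteq> \<Union>K" using that by auto
    show ?thesis
      unfolding psubset_eq inj_on_image_subset_iff[OF inj *] inj_on_image_eq_iff[OF inj *] ..
  qed
  have ex1: "(\<exists>!G. G \<in> relabel h K \<and> h ` R \<subset> G) \<longleftrightarrow> (\<exists>!G. G \<in> K \<and> R \<subset> G)" if R: "R \<in> K" for R
  proof -
    have "{G \<in> relabel h K. h ` R \<subset> G} = (\<lambda>F. h ` F) ` {G \<in> K. R \<subset> G}"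
    proof (intro equalityI subsetI)
      fix G assume "G \<in> {G \<in> relabel h K. h ` R \<subset> G}"
      then obtain G0 where "G0 \<in> K" "G = h ` G0" "h ` R \<subset> G" unfolding relabel_def by blast
      then show "G \<in> (\<lambda>F. h ` F) ` {G \<in> K. R \<subset> G}" using sub[OF R] by simp
    next
      fix G assume "G \<in> (\<lambda>F. h ` F) ` {G \<in> K. R \<subset> G}"
      then obtain G0 where G0: "G0 \<in> K" "R \<subset> G0" "G = h ` G0" by blast
      then have "h ` R \<subset> G" using sub[OF R] by simp
      then show "G \<in> {G \<in> relabel h K. h ` R \<subset> G}" using G0 unfolding relabel_def by blast
    qed
    moreover have "inj_on (\<lambda>F. h ` F) {G \<in> K. R \<subset> G}" using relabel_inj by (rule inj_on_subset) auto
    ultimately have "card {G \<in> relabel h K. h ` R \<subset> G} = card {G \<in> K. R \<subset> G}" by (simp add: card_image)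
    then show ?thesis unfolding ex1_iff_card by simp
  qed
  show ?thesis
  proof (intro equalityI subsetI)
    fix F assume "F \<in> ball_boundary (relabel h K)"
    then have "\<exists>R\<in>relabel h K. F \<subseteq> R \<and> face_dim R = complex_dim K - 1 \<and> (\<exists>!G. G \<in> relabel h K \<and> R \<subset> G)"
      unfolding ball_boundary_def relabel_complex_dim by (rule CollectD)
    then obtain R where R: "R \<in> relabel h K" "F \<subseteq> R" "face_dim R = complex_dim K - 1"
      and "\<exists>!G. G \<in> relabel h K \<and> R \<subset> G"
      by (elim bexE conjE) (rule that)
    moreover obtain R0 where "R0 \<in> K" "R = h ` R0" using R(1) unfolding relabel_def by blast
    ultimately have R0: "R0 \<in> K" "F \<subseteq> h ` R0" "face_dim (h ` R0) = complex_dim K - 1"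
      and R1: "\<exists>!G. G \<in> relabel h K \<and> h ` R0 \<subset> G" by simp_all
    obtain F0 where F0: "F0 \<subseteq> R0" "F = h ` F0" using R0(2) by (meson subset_imageE)
    have "F0 \<in> ball_boundary K" unfolding ball_boundary_def
      using R0 F0 R1[unfolded ex1[OF R0(1)]] relabel_face_dim[OF R0(1)]
      by (intro CollectI bexI[of _ R0] conjI) simp_all
    then show "F \<in> relabel h (ball_boundary K)" using F0(2) by (simp add: relabel_def)
  next
    fix F assume "F \<in> relabel h (ball_boundary K)"
    then obtain F0 where F0: "F0 \<in> ball_boundary K" "F = h ` F0" by (auto simp: relabel_def)
    have "\<exists>R\<in>K. F0 \<subseteq> R \<and> face_dim R = complex_dim K - 1 \<and> (\<exists>!G. G \<in> K \<and> R \<subset> G)"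
      using F0(1) unfolding ball_boundary_def by (rule CollectD)
    then obtain R0 where R0: "R0 \<in> K" "F0 \<subseteq> R0" "face_dim R0 = complex_dim K - 1"
      and R1: "\<exists>!G. G \<in> K \<and> R0 \<subset> G"
      by (elim bexE conjE) (rule that)
    have "h ` R0 \<in> relabel h K" using R0(1) by (simp add: relabel_def)
    then show "F \<in> ball_boundary (relabel h K)" unfolding ball_boundary_def relabel_complex_dim
      using R0 F0(2) R1[folded ex1[OF R0(1)]] relabel_face_dim[OF R0(1)]
      by (intro CollectI bexI[of _ "h ` R0"] conjI) (simp_all add: image_mono)
  qed
qed

lemma relabel_geometric_realization:
  "geometric_realization K homeomorphic_space geometric_realization (relabel h K)"
proof -
  define V where "V = \<Union>K"
  have injV: "inj_on h V" using inj by (simp add: V_def)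
  define S where "S = {x :: 'v \<Rightarrow> real. (\<forall>v. 0 \<le> x v) \<and> {v. x v \<noteq> 0} \<in> K \<and> (\<Sum>v | x v \<noteq> 0. x v) = 1}"
  define S' where "S' = {x :: 'w \<Rightarrow> real. (\<forall>v. 0 \<le> x v) \<and> {v. x v \<noteq> 0} \<in> relabel h K \<and> (\<Sum>v | x v \<noteq> 0. x v) = 1}"
  \<comment> \<open>Coordinates off the image of \<open>V\<close> must be 0 for the support to be a
    face; the same default in \<open>g\<close> makes the two maps mutually inverse.\<close>
  define f where "f x w = (if w \<in> h ` V then x (inv_into V h w) else 0)" for x :: "'v \<Rightarrow> real" and w
  define g where "g y v = (if v \<in> V then y (h v) else 0)" for y :: "'w \<Rightarrow> real" and v
  have fh: "f x (h v) = x v" if "v \<in> V" for x v using that injV by (simp add: f_def)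
  have f0: "f x w = 0" if "w \<notin> h ` V" for x w using that by (simp add: f_def)
  have supp_f: "{w. f x w \<noteq> 0} = h ` {v. x v \<noteq> 0}" if "{v. x v \<noteq> 0} \<subseteq> V" for x
  proof (intro equalityI subsetI)
    fix w assume w: "w \<in> {w. f x w \<noteq> 0}"
    then obtain v where "v \<in> V" "w = h v" using f0 by blast
    then show "w \<in> h ` {v. x v \<noteq> 0}" using w fh by auto
  next
    fix w assume "w \<in> h ` {v. x v \<noteq> 0}"
    then show "w \<in> {w. f x w \<noteq> 0}" using that fh by auto
  qed
  have suppS: "{v. x v \<noteq> 0} \<subseteq> V" if "x \<in> S" for x using that by (auto simp: S_def V_def)
  have suppS': "{w. y w \<noteq> 0} \<subseteq> h ` V" if "y \<in> S'" for y
  proof -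
    have "{w. y w \<noteq> 0} \<in> relabel h K" using that by (simp add: S'_def)
    then obtain F where "F \<in> K" "{w. y w \<noteq> 0} = h ` F" unfolding relabel_def by blast
    then show ?thesis unfolding V_def by blast
  qed
  have fS: "f x \<in> S'" if x: "x \<in> S" for x
  proof -
    have sv: "{v. x v \<noteq> 0} \<subseteq> V" by (rule suppS[OF x])
    have "(\<Sum>w | f x w \<noteq> 0. f x w) = (\<Sum>v | x v \<noteq> 0. f x (h v))"
      unfolding supp_f[OF sv] using sum.reindex[OF inj_on_subset[OF injV sv], of "f x"] by simp
    also have "\<dots> = (\<Sum>v | x v \<noteq> 0. x v)" using sv fh by (intro sum.cong) auto
    finally have "(\<Sum>w | f x w \<noteq> 0. f x w) = 1" using x by (simp add: S_def)
    moreover have "0 \<le> f x w" for w using x by (simp add: f_def S_def)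
    moreover have "{w. f x w \<noteq> 0} \<in> relabel h K"
      unfolding supp_f[OF sv] using x by (simp add: S_def relabel_def)
    ultimately show ?thesis by (simp add: S'_def)
  qed
  have gf: "g (f x) = x" if x: "x \<in> S" for x
  proof
    fix v show "g (f x) v = x v" using suppS[OF x] fh by (cases "v \<in> V") (auto simp: g_def)
  qed
  have fg: "f (g y) = y" if y: "y \<in> S'" for y
  proof
    fix w
    show "f (g y) w = y w"
    proof (cases "w \<in> h ` V")
      case True
      then obtain v where "v \<in> V" "w = h v" by blast
      then show ?thesis using fh by (simp add: g_def)
    next
      case False
      then show ?thesis using suppS'[OF y] f0 by auto
    qed
  qed
  have gS: "g y \<in> S" if y: "y \<in> S'" for y
  proof -
    have sv: "{v. g y v \<noteq> 0} \<subseteq> V" by (auto simp: g_def)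
    have "h ` {v. g y v \<noteq> 0} \<in> relabel h K"
      using supp_f[OF sv] fg[OF y] y by (simp add: S'_def)
    then obtain F where F: "F \<in> K" "h ` {v. g y v \<noteq> 0} = h ` F" by (auto simp: relabel_def)
    have "{v. g y v \<noteq> 0} = F"
      using inj_on_image_eq_iff[OF injV sv, of F] F by (auto simp: V_def)
    then have "{v. g y v \<noteq> 0} \<in> K" using F(1) by simp
    moreover have "(\<Sum>v | g y v \<noteq> 0. g y v) = 1"
    proof -
      have "(\<Sum>w | f (g y) w \<noteq> 0. f (g y) w) = (\<Sum>v | g y v \<noteq> 0. f (g y) (h v))"
        unfolding supp_f[OF sv] using sum.reindex[OF inj_on_subset[OF injV sv], of "f (g y)"] by simp
      also have "\<dots> = (\<Sum>v | g y v \<noteq> 0. g y v)" using sv fh by (intro sum.cong) auto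
      finally show ?thesis using y unfolding fg[OF y] by (simp add: S'_def)
    qed
    moreover have "0 \<le> g y v" for v using y by (simp add: g_def S'_def)
    ultimately show ?thesis by (simp add: S_def)
  qed
  have "continuous_on S f"
  proof (rule continuous_on_coordinatewise_then_product)
    fix w
    show "continuous_on S (\<lambda>x. f x w)"
      by (cases "w \<in> h ` V")
        (simp_all add: f_def continuous_on_subset[OF continuous_on_product_coordinates])
  qed
  moreover have "continuous_on S' g"
  proof (rule continuous_on_coordinatewise_then_product)
    fix v
    show "continuous_on S' (\<lambda>y. g y v)"
      by (cases "v \<in> V") (simp_all add: g_def continuous_on_subset[OF continuous_on_product_coordinates])
  qed
  ultimately have "homeomorphic_maps (top_of_set S) (top_of_set S') f g"
    unfolding homeomorphic_maps_def using fS gS fg gf by (auto simp: continuous_map_in_subtopology)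
  then show ?thesis
    unfolding geometric_realization_top_of_set S_def[symmetric] S'_def[symmetric] homeomorphic_space_def by blast
qed

lemma relabel_simplicial_ball:
  assumes "simplicial_ball K"
  shows "simplicial_ball (relabel h K)"
proof -
  obtain n where n: "complex_dim K = int n" "geometric_realization K homeomorphic_space nball n"
    using assms unfolding simplicial_ball_def by blast
  have "geometric_realization (relabel h K) homeomorphic_space nball n"
    using relabel_geometric_realization n(2) homeomorphic_space_sym homeomorphic_space_trans by blast
  then show ?thesis unfolding simplicial_ball_def using n(1) relabel_complex_dim by auto
qed

end

theorem relabel_has_convex_ear_decomposition:
  fixes T :: "'b::euclidean_space itself" and h :: "'v \<Rightarrow> 'w"
  assumes inj: "inj_on h (\<Union>K)" and K: "has_convex_ear_decomposition T K"
  shows "has_convex_ear_decomposition T (relabel h K)"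
proof -
  obtain d Ks where d: "complex_dim K = int d - 1" and ced: "convex_ear_decomposition T d K Ks"
    and aK: "abstract_complex K"
    using K unfolding has_convex_ear_decomposition_def by blast
  have ne: "Ks \<noteq> []" and all: "\<And>C. C \<in> set Ks \<Longrightarrow> C \<subseteq> K \<and> pure_complex C \<and> complex_dim C = int d - 1"
    and first: "\<exists>P::'b set. simplicial_polytope d P \<and> complex_iso (Ks ! 0) (boundary_complex P)"
    and rest: "\<And>j. 1 \<le> j \<Longrightarrow> j < length Ks \<Longrightarrow> simplicial_ball (Ks ! j) \<and>
        (\<exists>(P::'b set) L. simplicial_polytope d P \<and> L \<subset> boundary_complex P \<and> complex_iso (Ks ! j) L) \<and>
        Ks ! j \<inter> (\<Union>i<j. Ks ! i) = ball_boundary (Ks ! j)"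
    and un: "\<Union>(set Ks) = K"
    using ced unfolding convex_ear_decomposition_def by simp_all
  have sub: "C \<subseteq> K" and injC: "inj_on h (\<Union>C)" and aC: "abstract_complex C" if "C \<in> set Ks" for C
    using all[OF that] inj_on_subset[OF inj, of "\<Union>C"] by (auto simp: pure_complex_def)
  have "convex_ear_decomposition T d (relabel h K) (map (relabel h) Ks)"
    unfolding convex_ear_decomposition_def
  proof (intro conjI allI impI ballI)
    show "map (relabel h) Ks \<noteq> []" using ne by simp
    show "\<exists>P::'b set. simplicial_polytope d P \<and> complex_iso (map (relabel h) Ks ! 0) (boundary_complex P)"
    proof -
      obtain P :: "'b set" where P: "simplicial_polytope d P" "complex_iso (Ks ! 0) (boundary_complex P)"
        using first by blast
      have C: "Ks ! 0 \<in> set Ks" using ne by simp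
      show ?thesis using P relabel_complex_iso[OF injC[OF C] aC[OF C] P(2)] ne
        by (intro exI[of _ P]) simp
    qed
    show "\<Union>(set (map (relabel h) Ks)) = relabel h K" unfolding un[symmetric] relabel_Union by simp
  next
    fix D assume "D \<in> set (map (relabel h) Ks)"
    then obtain C where C: "C \<in> set Ks" "D = relabel h C" by auto
    show "D \<subseteq> relabel h K" unfolding C(2) by (rule relabel_mono[OF sub[OF C(1)]])
    show "pure_complex D" unfolding C(2)
      by (rule relabel_pure_complex[OF injC[OF C(1)] aC[OF C(1)]]) (use all[OF C(1)] in blast)
    show "complex_dim D = int d - 1" unfolding C(2) relabel_complex_dim[OF injC[OF C(1)] aC[OF C(1)]]
      using all[OF C(1)] by blast
  next
    fix j assume "1 \<le> j \<and> j < length (map (relabel h) Ks)"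
    then have j: "1 \<le> j" "j < length Ks" by auto
    have C: "Ks ! j \<in> set Ks" using j by simp
    have mj: "map (relabel h) Ks ! j = relabel h (Ks ! j)" using j by simp
    note r = rest[OF j]
    show "simplicial_ball (map (relabel h) Ks ! j)"
      unfolding mj using r by (intro relabel_simplicial_ball[OF injC[OF C] aC[OF C]]) blast
    show "\<exists>(P::'b set) L. simplicial_polytope d P \<and> L \<subset> boundary_complex P \<and> complex_iso (map (relabel h) Ks ! j) L"
    proof -
      obtain P :: "'b set" and L where P: "simplicial_polytope d P" "L \<subset> boundary_complex P" "complex_iso (Ks ! j) L"
        using r by blast
      show ?thesis unfolding mj
        by (intro exI conjI, rule P(1), rule P(2), rule relabel_complex_iso[OF injC[OF C] aC[OF C] P(3)])
    qed
    have "(\<Union>i<j. map (relabel h) Ks ! i) = (\<Union>i<j. relabel h (Ks ! i))" using j by (intro SUP_cong) auto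
    also have "\<dots> = relabel h (\<Union>i<j. Ks ! i)" unfolding relabel_def by blast
    finally have U: "(\<Union>i<j. map (relabel h) Ks ! i) = relabel h (\<Union>i<j. Ks ! i)" .
    have "(\<Union>i<j. Ks ! i) \<subseteq> K" using sub j by (intro UN_least) auto
    then show "map (relabel h) Ks ! j \<inter> (\<Union>i<j. map (relabel h) Ks ! i) = ball_boundary (map (relabel h) Ks ! j)"
      unfolding mj U relabel_ball_boundary[OF injC[OF C] aC[OF C]]
      using relabel_Int[OF inj aK sub[OF C]] r by metis
  qed
  then show ?thesis unfolding has_convex_ear_decomposition_def
    using relabel_abstract_complex[OF inj aK] relabel_complex_dim[OF inj aK] d by (intro conjI exI) simp_all
qed


section \<open>The braid arrangement\<close>

text \<open>\<open>V\<close> may be smaller than its type, hence the zero coordinates outside. The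
  sum condition removes the line common to all hyperplanes \<open>x\<^sub>u = x\<^sub>v\<close> and
  so makes the arrangement essential.\<close>

definition braid_space :: "'v::finite set \<Rightarrow> (real ^ 'v) set" where
  "braid_space V = {x. (\<forall>v. v \<notin> V \<longrightarrow> x $ v = 0) \<and> (\<Sum>v\<in>V. x $ v) = 0}"

definition braid_normals :: "'v::finite set \<Rightarrow> (real ^ 'v) set" where
  "braid_normals V = {axis u 1 - axis v 1 | u v. u \<in> V \<and> v \<in> V}"

definition proper_subsets :: "'v set \<Rightarrow> 'v set set" where
  "proper_subsets V = {S. S \<noteq> {} \<and> S \<subset> V}"

text \<open>The indicator vector of \<open>S\<close>, projected along the all-ones vector of \<open>V\<close>.\<close>

definition braid_ray :: "'v::finite set \<Rightarrow> 'v set \<Rightarrow> real ^ 'v" where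
  "braid_ray V S = (\<chi> v. if v \<in> V then indicat_real S v - card S / card V else 0)"

text \<open>The proper nonempty superlevel sets of \<open>x\<close> on \<open>V\<close>. They form
  the chain that belongs to the ordered partition of \<open>V\<close> by decreasing
  coordinates.\<close>

definition upper_sets :: "'v::finite set \<Rightarrow> real ^ 'v \<Rightarrow> 'v set set" where
  "upper_sets V x = {S \<in> proper_subsets V. \<forall>u\<in>S. \<forall>v\<in>V - S. x $ v < x $ u}"

section \<open>Rays and cells of the braid fan\<close>

lemma inner_axis_diff: "(axis u 1 - axis v 1 :: real ^ 'v::finite) \<bullet> x = x $ u - x $ v"
  by (simp add: inner_diff_left inner_axis')

lemma subspace_braid_space: "subspace (braid_space V)"
proof (rule subspaceI)
  show "x + y \<in> braid_space V" if "x \<in> braid_space V" "y \<in> braid_space V" for x y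
    using that by (simp add: braid_space_def sum.distrib)
  show "c *\<^sub>R x \<in> braid_space V" if "x \<in> braid_space V" for c x
    using that by (simp add: braid_space_def flip: sum_distrib_left)
qed (simp add: braid_space_def)

lemma finite_braid_normals: "finite (braid_normals V)"
proof -
  have "braid_normals V = (\<lambda>(u, v). axis u 1 - axis v 1) ` (V \<times> V)" unfolding braid_normals_def by auto
  then show ?thesis by simp
qed

lemma braid_space_eq_0:
  assumes "x \<in> braid_space V" "\<And>u v. u \<in> V \<Longrightarrow> v \<in> V \<Longrightarrow> x $ u = x $ v"
  shows "x = 0"
proof -
  have "x $ v = 0" if v: "v \<in> V" for v
  proof -
    have "(\<Sum>u\<in>V. x $ u) = (\<Sum>u\<in>V. x $ v)" by (intro sum.cong refl assms(2) v)
    then have "real (card V) * x $ v = 0" using assms(1) by (simp add: braid_space_def)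
    moreover have "card V \<noteq> 0" using v by auto
    ultimately show ?thesis by simp
  qed
  then show ?thesis using assms(1) by (auto simp: braid_space_def vec_eq_iff)
qed

lemma braid_ray_diff:
  assumes "u \<in> V" "v \<in> V"
  shows "braid_ray V S $ u - braid_ray V S $ v = indicat_real S u - indicat_real S v"
  using assms by (simp add: braid_ray_def)

lemma braid_ray_in_space:
  assumes "S \<subseteq> V" "V \<noteq> {}"
  shows "braid_ray V S \<in> braid_space V"
proof -
  have "(\<Sum>v\<in>V. braid_ray V S $ v) = (\<Sum>v\<in>V. indicat_real S v - card S / card V)"
    by (intro sum.cong) (auto simp: braid_ray_def)
  also have "\<dots> = (\<Sum>v\<in>V. indicat_real S v) - card V * (card S / card V)"
    by (simp add: sum_subtractf)
  also have "(\<Sum>v\<in>V. indicat_real S v) = card S"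
    using assms(1) by (simp add: indicator_def sum.If_cases Int_absorb1)
  also have "card S - card V * (card S / card V) = 0" using assms(2) by simp
  finally show ?thesis by (simp add: braid_space_def braid_ray_def)
qed

lemma proper_subsetE:
  assumes "S \<in> proper_subsets V"
  obtains u v where "u \<in> S" "u \<in> V" "v \<in> V" "v \<notin> S"
  using assms unfolding proper_subsets_def by blast

text \<open>Differences of coordinates see only indicators. For \<open>u\<close> in \<open>S\<close>
  and \<open>v\<close> outside, the positive number \<open>c\<close> is a difference of two values
  in 0 and 1; so it is 1 and \<open>u\<close> is in \<open>T\<close>.\<close>

lemma braid_ray_scale:
  assumes S: "S \<in> proper_subsets V" and T: "T \<in> proper_subsets V" and c: "0 < c" "c *\<^sub>R braid_ray V S = braid_ray V T"
  shows "c = 1" "S \<subseteq> T"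
proof -
  have diff: "c * (indicat_real S u - indicat_real S v) = indicat_real T u - indicat_real T v"
    if "u \<in> V" "v \<in> V" for u v
  proof -
    have "c * (braid_ray V S $ u - braid_ray V S $ v) = braid_ray V T $ u - braid_ray V T $ v"
      unfolding c(2)[symmetric] by (simp add: right_diff_distrib)
    then show ?thesis using braid_ray_diff[OF that] by simp
  qed
  have one: "c = 1 \<and> u \<in> T" if "u \<in> S" for u
  proof -
    obtain v where v: "v \<in> V" "v \<notin> S" using proper_subsetE[OF S] by blast
    have uV: "u \<in> V" using that S by (auto simp: proper_subsets_def)
    have "c = indicat_real T u - indicat_real T v" using diff[OF uV v(1)] that v(2) by simp
    then show ?thesis using c(1) by (auto simp: indicator_def split: if_splits)
  qed
  obtain u where "u \<in> S" using proper_subsetE[OF S] by blast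
  then show "c = 1" using one by blast
  show "S \<subseteq> T" using one by blast
qed

lemma inj_on_braid_ray: "inj_on (braid_ray V) (proper_subsets V)"
proof (rule inj_onI)
  fix S T assume *: "S \<in> proper_subsets V" "T \<in> proper_subsets V" "braid_ray V S = braid_ray V T"
  show "S = T"
    using braid_ray_scale(2)[OF *(1,2), of 1] braid_ray_scale(2)[OF *(2,1), of 1] *(3) by simp
qed

text \<open>The cell consists of the vectors weakly ordered as \<open>x\<close> is. Applying the
  condition in both directions shows that ties of \<open>x\<close> persist.\<close>

lemma braid_cell_iff:
  "y \<in> closed_cell (braid_space V) (braid_normals V) x \<longleftrightarrow>
    y \<in> braid_space V \<and> (\<forall>u\<in>V. \<forall>v\<in>V. x $ u \<le> x $ v \<longrightarrow> y $ u \<le> y $ v)"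
proof
  assume y: "y \<in> closed_cell (braid_space V) (braid_normals V) x"
  have "y $ u \<le> y $ v" if uv: "u \<in> V" "v \<in> V" "x $ u \<le> x $ v" for u v
  proof -
    have "axis u 1 - axis v 1 \<in> braid_normals V" using uv by (auto simp: braid_normals_def)
    then have "y $ u - y $ v = 0 \<or> sgn (y $ u - y $ v) = sgn (x $ u - x $ v)"
      using y unfolding closed_cell_def by (auto simp: inner_axis_diff simp del: right_minus_eq)
    then show ?thesis using uv(3) by (auto simp: sgn_if split: if_splits)
  qed
  then show "y \<in> braid_space V \<and> (\<forall>u\<in>V. \<forall>v\<in>V. x $ u \<le> x $ v \<longrightarrow> y $ u \<le> y $ v)"
    using y by (simp add: closed_cell_def)
next
  assume y: "y \<in> braid_space V \<and> (\<forall>u\<in>V. \<forall>v\<in>V. x $ u \<le> x $ v \<longrightarrow> y $ u \<le> y $ v)"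
  have "a \<bullet> y = 0 \<or> sgn (a \<bullet> y) = sgn (a \<bullet> x)" if a: "a \<in> braid_normals V" for a
  proof -
    obtain u v where uv: "a = axis u 1 - axis v 1" "u \<in> V" "v \<in> V" 
      using a unfolding braid_normals_def by blast
    have "x $ v < x $ u \<or> y $ u \<le> y $ v" "x $ u < x $ v \<or> y $ v \<le> y $ u" using y uv by force+
    then show ?thesis unfolding uv(1) inner_axis_diff by (auto simp: sgn_if)
  qed
  then show "y \<in> closed_cell (braid_space V) (braid_normals V) x" using y by (simp add: closed_cell_def)
qed

lemma upper_sets_chain:
  assumes "S \<in> upper_sets V x" "T \<in> upper_sets V x"
  shows "S \<subseteq> T \<or> T \<subseteq> S"
proof (rule ccontr)
  assume "\<not> (S \<subseteq> T \<or> T \<subseteq> S)"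
  then obtain s t where st: "s \<in> S" "s \<notin> T" "t \<in> T" "t \<notin> S" by blast
  then have "s \<in> V" "t \<in> V" using assms by (auto simp: upper_sets_def proper_subsets_def)
  then have "x $ t < x $ s" "x $ s < x $ t" using assms st unfolding upper_sets_def by blast+
  then show False by simp
qed

text \<open>
  Functionals dual to the rays of the cell of \<open>x\<close>: the difference of the coordinates at the lowest
  vertex of \<open>S\<close> and the highest vertex outside \<open>S\<close>.
\<close>

lemma upper_set_gap:
  assumes S: "S \<in> upper_sets V x"
  obtains u w where "u \<in> S" "u \<in> V" "w \<in> V" "w \<notin> S" "x $ w < x $ u"
    "\<And>v. v \<in> V - S \<Longrightarrow> x $ v \<le> x $ w"
    "\<And>T. T \<in> upper_sets V x \<Longrightarrow> indicat_real T u - indicat_real T w = (if T = S then 1 else 0)"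
proof -
  have SV: "S \<noteq> {}" "S \<subseteq> V" "V - S \<noteq> {}" using S by (auto simp: upper_sets_def proper_subsets_def)
  have fin: "finite ((\<lambda>v. x $ v) ` S)" "finite ((\<lambda>v. x $ v) ` (V - S))" by simp_all
  have "Min ((\<lambda>v. x $ v) ` S) \<in> (\<lambda>v. x $ v) ` S" using SV by (intro Min_in) simp_all
  then obtain u where u: "u \<in> S" "x $ u = Min ((\<lambda>v. x $ v) ` S)" by auto
  have "Max ((\<lambda>v. x $ v) ` (V - S)) \<in> (\<lambda>v. x $ v) ` (V - S)" using SV by (intro Max_in) simp_all
  then obtain w where w: "w \<in> V - S" "x $ w = Max ((\<lambda>v. x $ v) ` (V - S))" by auto
  have minu: "x $ u \<le> x $ v" if "v \<in> S" for v unfolding u(2) using that by (intro Min_le) auto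
  have maxw: "x $ v \<le> x $ w" if "v \<in> V - S" for v unfolding w(2) using that by (intro Max_ge) auto
  have dual: "indicat_real T u - indicat_real T w = (if T = S then 1 else 0)" if T: "T \<in> upper_sets V x" for T
  proof (cases "T = S")
    case True
    then show ?thesis using u w by simp
  next
    case False
    have TV: "T \<subseteq> V" using T by (auto simp: upper_sets_def proper_subsets_def)
    have Tup: "x $ v < x $ t" if "t \<in> T" "v \<in> V" "v \<notin> T" for t v using T that unfolding upper_sets_def by blast
    from upper_sets_chain[OF S T] have "u \<in> T \<longleftrightarrow> w \<in> T"
    proof
      assume "S \<subseteq> T"
      then obtain t where t: "t \<in> T" "t \<notin> S" using False by blast
      have "w \<in> T"
      proof (rule ccontr)
        assume "w \<notin> T"
        then have "x $ w < x $ t" using Tup[OF t(1)] w(1) by blast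
        then show False using maxw[of t] t TV by force
      qed
      then show ?thesis using u(1) \<open>S \<subseteq> T\<close> by blast
    next
      assume "T \<subseteq> S"
      then obtain t where t: "t \<in> S" "t \<notin> T" using False by blast
      have "u \<notin> T"
      proof
        assume "u \<in> T"
        then have "x $ t < x $ u" using Tup[of u t] t SV by blast
        then show False using minu[OF t(1)] by simp
      qed
      then show ?thesis using w(1) \<open>T \<subseteq> S\<close> by blast
    qed
    then show ?thesis using False by (simp add: indicator_def)
  qed
  have "x $ w < x $ u" using S u(1) w(1) unfolding upper_sets_def by blast
  then show ?thesis using that[of u w] u(1) w(1) SV maxw dual by blast
qed

lemma braid_ray_in_cell:
  assumes "S \<in> upper_sets V x"
  shows "braid_ray V S \<in> closed_cell (braid_space V) (braid_normals V) x"
  unfolding braid_cell_iff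
proof (intro conjI ballI impI)
  have S: "S \<subseteq> V" "V \<noteq> {}" using assms by (auto simp: upper_sets_def proper_subsets_def)
  show "braid_ray V S \<in> braid_space V" by (rule braid_ray_in_space[OF S])
  fix u v assume uv: "u \<in> V" "v \<in> V" "x $ u \<le> x $ v"
  have "x $ v < x $ u" if "u \<in> S" "v \<notin> S" using assms uv that unfolding upper_sets_def by blast
  then have "u \<in> S \<longrightarrow> v \<in> S" using uv(3) by fastforce
  then have "indicat_real S u - indicat_real S v \<le> 0" by (simp add: indicator_def)
  then show "braid_ray V S $ u \<le> braid_ray V S $ v" using braid_ray_diff[OF uv(1,2), of S] by simp
qed

text \<open>One gap functional is chosen per upper set, giving a system dual to the rays and
  nonnegative on the cell. The last property keeps what its vanishing means: no jump between
  \<open>S\<close> and the highest level outside \<open>S\<close>.\<close>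

lemma upper_sets_dual:
  obtains L :: "'v::finite set \<Rightarrow> real ^ 'v \<Rightarrow> real"
  where "\<And>S. S \<in> upper_sets V x \<Longrightarrow> linear (L S)"
    "\<And>S T. S \<in> upper_sets V x \<Longrightarrow> T \<in> upper_sets V x \<Longrightarrow> L S (braid_ray V T) = (if T = S then 1 else 0)"
    "\<And>S y. S \<in> upper_sets V x \<Longrightarrow> y \<in> closed_cell (braid_space V) (braid_normals V) x \<Longrightarrow> 0 \<le> L S y"
    "\<And>S z. S \<in> upper_sets V x \<Longrightarrow> L S z = 0 \<Longrightarrow>
      \<exists>u\<in>S. \<exists>w\<in>V - S. (\<forall>v\<in>V - S. x $ v \<le> x $ w) \<and> z $ u = z $ w"
proof -
  define P where "P S p \<longleftrightarrow> fst p \<in> S \<and> fst p \<in> V \<and> snd p \<in> V \<and> snd p \<notin> S \<and> x $ snd p < x $ fst p \<and>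
    (\<forall>v\<in>V - S. x $ v \<le> x $ snd p) \<and>
    (\<forall>T\<in>upper_sets V x. indicat_real T (fst p) - indicat_real T (snd p) = (if T = S then 1 else 0))" for S p
  have "\<exists>p. P S p" if S: "S \<in> upper_sets V x" for S
  proof -
    obtain u w where "u \<in> S" "u \<in> V" "w \<in> V" "w \<notin> S" "x $ w < x $ u" "\<And>v. v \<in> V - S \<Longrightarrow> x $ v \<le> x $ w"
      "\<And>T. T \<in> upper_sets V x \<Longrightarrow> indicat_real T u - indicat_real T w = (if T = S then 1 else 0)"
      using upper_set_gap[OF S] by blast
    then have "P S (u, w)" unfolding P_def by simp
    then show ?thesis by blast
  qed
  then obtain p where p: "\<And>S. S \<in> upper_sets V x \<Longrightarrow> P S (p S)" by metis
  define L where "L S y = y $ fst (p S) - y $ snd (p S)" for S and y :: "real ^ 'v"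
  show ?thesis
  proof (rule that[of L])
    fix S assume S: "S \<in> upper_sets V x"
    note pS = p[OF S, unfolded P_def]
    show "linear (L S)" unfolding L_def by (rule linearI) (simp_all add: algebra_simps)
    show "L S (braid_ray V T) = (if T = S then 1 else 0)" if "T \<in> upper_sets V x" for T
      using braid_ray_diff[of "fst (p S)" V "snd (p S)" T] pS that unfolding L_def by simp
    show "0 \<le> L S y" if "y \<in> closed_cell (braid_space V) (braid_normals V) x" for y
      using that pS unfolding braid_cell_iff L_def by simp
    show "\<exists>u\<in>S. \<exists>w\<in>V - S. (\<forall>v\<in>V - S. x $ v \<le> x $ w) \<and> z $ u = z $ w" if "L S z = 0" for z
      using that pS unfolding L_def by (intro bexI[of _ "fst (p S)"] bexI[of _ "snd (p S)"] conjI) auto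
  qed
qed

text \<open>\<open>z\<close> is constant on levels of \<open>x\<close>. If it differed from its top
  value anywhere, take the highest such level: the set \<open>S\<close> above it is an upper set,
  and its gap links a point of \<open>S\<close> to exactly that level.\<close>

lemma braid_space_constant:
  assumes z: "\<And>u v. u \<in> V \<Longrightarrow> v \<in> V \<Longrightarrow> x $ u = x $ v \<Longrightarrow> z $ u = z $ v"
    and gaps: "\<And>S. S \<in> upper_sets V x \<Longrightarrow> \<exists>u\<in>S. \<exists>w\<in>V - S. (\<forall>v\<in>V - S. x $ v \<le> x $ w) \<and> z $ u = z $ w"
    and uv: "u \<in> V" "v \<in> V"
  shows "z $ u = (z $ v :: real)"
proof -
  have "V \<noteq> {}" using uv by blast
  then have "Max ((\<lambda>v. x $ v) ` V) \<in> (\<lambda>v. x $ v) ` V" by (intro Max_in) simp_all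
  then obtain u0 where u0: "u0 \<in> V" "x $ u0 = Max ((\<lambda>v. x $ v) ` V)" by auto
  have max0: "x $ v \<le> x $ u0" if "v \<in> V" for v unfolding u0(2) using that by (intro Max_ge) auto
  have "{v \<in> V. z $ v \<noteq> z $ u0} = {}"
  proof (rule ccontr)
    assume ne: "{v \<in> V. z $ v \<noteq> z $ u0} \<noteq> {}" (is "?Bad \<noteq> {}")
    then have "Max ((\<lambda>v. x $ v) ` ?Bad) \<in> (\<lambda>v. x $ v) ` ?Bad" by (intro Max_in) simp_all
    then obtain u1 where u1: "u1 \<in> ?Bad" "x $ u1 = Max ((\<lambda>v. x $ v) ` ?Bad)" by auto
    have max1: "x $ v \<le> x $ u1" if "v \<in> ?Bad" for v unfolding u1(2) using that by (intro Max_ge) auto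
    have "x $ u1 \<noteq> x $ u0" using z[of u1 u0] u1(1) u0(1) by auto
    then have lt: "x $ u1 < x $ u0" using max0[of u1] u1(1) by auto
    define S where "S = {v \<in> V. x $ u1 < x $ v}"
    have "S \<in> upper_sets V x" unfolding upper_sets_def proper_subsets_def S_def using u0(1) u1(1) lt by auto
    then obtain u w where uw: "u \<in> S" "w \<in> V - S" "\<And>v. v \<in> V - S \<Longrightarrow> x $ v \<le> x $ w" "z $ u = z $ w"
      using gaps by blast
    have "u \<notin> ?Bad" using max1[of u] uw(1) by (auto simp: S_def)
    then have "z $ u = z $ u0" using uw(1) by (auto simp: S_def)
    moreover have "u1 \<in> V - S" using u1(1) by (auto simp: S_def)
    then have "x $ w = x $ u1" using uw(2) uw(3)[of u1] by (auto simp: S_def)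
    then have "z $ w = z $ u1" using z[of w u1] uw(2) u1(1) by auto
    ultimately show False using uw(4) u1(1) by auto
  qed
  then have "z $ u = z $ u0" "z $ v = z $ u0" using uv by blast+
  then show ?thesis by simp
qed

text \<open>Dual functionals give independence at once. For \<open>y\<close> in the cell their
  values are the coefficients of a candidate \<open>s\<close>; the remainder \<open>y - s\<close> is
  constant on levels and across gaps, hence constant on \<open>V\<close>, hence zero in the braid
  space.\<close>

lemma braid_cell:
  fixes V :: "'v::finite set"
  shows "independent (braid_ray V ` upper_sets V x)" (is "independent ?W")
    and "convex_cone hull (braid_ray V ` upper_sets V x) = closed_cell (braid_space V) (braid_normals V) x"
proof -
  let ?C = "closed_cell (braid_space V) (braid_normals V) x"
  let ?U = "upper_sets V x"
  obtain L :: "'v set \<Rightarrow> real ^ 'v \<Rightarrow> real" where L: "\<And>S. S \<in> ?U \<Longrightarrow> linear (L S)"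
    "\<And>S T. S \<in> ?U \<Longrightarrow> T \<in> ?U \<Longrightarrow> L S (braid_ray V T) = (if T = S then 1 else 0)"
    "\<And>S y. S \<in> ?U \<Longrightarrow> y \<in> ?C \<Longrightarrow> 0 \<le> L S y"
    "\<And>S z. S \<in> ?U \<Longrightarrow> L S z = 0 \<Longrightarrow> \<exists>u\<in>S. \<exists>w\<in>V - S. (\<forall>v\<in>V - S. x $ v \<le> x $ w) \<and> z $ u = z $ w"
    using upper_sets_dual[of V x] by blast
  have fin: "finite ?U" by simp
  have inj: "inj_on (braid_ray V) ?U"
    using inj_on_braid_ray by (rule inj_on_subset) (auto simp: upper_sets_def)
  have LS: "L S (\<Sum>T\<in>?U. c T *\<^sub>R braid_ray V T) = c S" if S: "S \<in> ?U" for S c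
  proof -
    have "L S (\<Sum>T\<in>?U. c T *\<^sub>R braid_ray V T) = (\<Sum>T\<in>?U. c T * (if T = S then 1 else 0))"
      using L(2)[OF S] by (simp add: linear_sum[OF L(1)[OF S]] linear_scale[OF L(1)[OF S]])
    also have "\<dots> = c S" using S fin by (simp add: if_distrib sum.delta cong: if_cong)
    finally show ?thesis .
  qed
  show "independent ?W"
  proof
    assume "dependent ?W"
    then obtain c S where c: "S \<in> ?U" "c (braid_ray V S) \<noteq> 0" "(\<Sum>w\<in>?W. c w *\<^sub>R w) = 0"
      using dependent_finite[of ?W] fin by auto
    have "(\<Sum>T\<in>?U. c (braid_ray V T) *\<^sub>R braid_ray V T) = 0" using c(3) by (simp add: sum.reindex[OF inj])
    then have "c (braid_ray V S) = 0" using LS[OF c(1), of "\<lambda>T. c (braid_ray V T)"] linear_0[OF L(1)[OF c(1)]] by simp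
    then show False using c(2) by simp
  qed
  show "convex_cone hull ?W = ?C"
  proof
    show "convex_cone hull ?W \<subseteq> ?C"
      by (rule hull_minimal) (auto intro: braid_ray_in_cell convex_cone_closed_cell[OF subspace_braid_space])
    show "?C \<subseteq> convex_cone hull ?W"
    proof
      fix y assume y: "y \<in> ?C"
      define s where "s = (\<Sum>S\<in>?U. L S y *\<^sub>R braid_ray V S)"
      have "s = (\<Sum>w\<in>?W. L (the_inv_into ?U (braid_ray V) w) y *\<^sub>R w)"
        unfolding s_def sum.reindex[OF inj] by (intro sum.cong) (simp_all add: the_inv_into_f_f[OF inj])
      also have "\<dots> \<in> convex_cone hull ?W"
        by (rule convex_cone_hull_sumI) (auto simp: the_inv_into_f_f[OF inj] intro: L(3)[OF _ y])
      finally have s: "s \<in> convex_cone hull ?W" .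
      define z where "z = y - s"
      have sC: "s \<in> ?C" using s \<open>convex_cone hull ?W \<subseteq> ?C\<close> by blast
      have zE: "z \<in> braid_space V" unfolding z_def
        using y sC by (intro subspace_diff[OF subspace_braid_space]) (simp_all add: closed_cell_def)
      have Lz: "L S z = 0" if "S \<in> ?U" for S
        unfolding z_def linear_diff[OF L(1)[OF that]] s_def LS[OF that] by simp
      have lev: "z $ u = z $ v" if "u \<in> V" "v \<in> V" "x $ u = x $ v" for u v
      proof -
        have "y $ u = y $ v" "s $ u = s $ v" using y sC that unfolding braid_cell_iff by (metis order_antisym order_refl)+
        then show ?thesis by (simp add: z_def)
      qed
      have "z $ u = z $ v" if "u \<in> V" "v \<in> V" for u v
        by (rule braid_space_constant[OF lev L(4)[OF _ Lz] that])
      then have "z = 0" by (rule braid_space_eq_0[OF zE])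
      then show "y \<in> convex_cone hull ?W" using s by (simp add: z_def)
    qed
  qed
qed

lemma simplicial_fan_braid:
  "simplicial_fan (braid_space V) (braid_normals V) (braid_ray V ` proper_subsets V)"
proof
  show "subspace (braid_space V)" by (rule subspace_braid_space)
  show "finite (braid_normals V)" by (rule finite_braid_normals)
  show "x = 0" if x: "x \<in> braid_space V" "\<And>a. a \<in> braid_normals V \<Longrightarrow> a \<bullet> x = 0" for x
  proof (rule braid_space_eq_0[OF x(1)])
    fix u v assume "u \<in> V" "v \<in> V"
    then have "axis u 1 - axis v 1 \<in> braid_normals V" by (auto simp: braid_normals_def)
    from x(2)[OF this] show "x $ u = x $ v" by (simp add: inner_axis_diff)
  qed
  show "c = 1" if "z \<in> braid_ray V ` proper_subsets V" "0 < c" "c *\<^sub>R z \<in> braid_ray V ` proper_subsets V" for z c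
    using that braid_ray_scale(1) by blast
  show "\<exists>W\<subseteq>braid_ray V ` proper_subsets V. independent W \<and>
      convex_cone hull W = closed_cell (braid_space V) (braid_normals V) x" for x
  proof (intro exI[of _ "braid_ray V ` upper_sets V x"] conjI)
    show "braid_ray V ` upper_sets V x \<subseteq> braid_ray V ` proper_subsets V" by (auto simp: upper_sets_def)
  qed (rule braid_cell)+
qed

text \<open>For finite \<open>V\<close>, the order complex of the proper part of the Boolean
  lattice.\<close>

definition flag_complex :: "'v set \<Rightarrow> 'v set set set" where
  "flag_complex V = {C. C \<subseteq> proper_subsets V \<and> (\<forall>S\<in>C. \<forall>T\<in>C. S \<subseteq> T \<or> T \<subseteq> S)}"

text \<open>A cell yields the chain of upper sets of its point. Conversely, for a chain
  \<open>C\<close> the sum of its rays drops strictly when leaving any member, so \<open>C\<close>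
  consists of upper sets of that sum and spans a subset of a known face.\<close>

lemma braid_faces:
  fixes V :: "'v::finite set"
  shows "fan_faces (braid_space V) (braid_normals V) (braid_ray V ` proper_subsets V) =
    (\<lambda>C. braid_ray V ` C) ` flag_complex V"
proof (intro equalityI subsetI)
  interpret simplicial_fan "braid_space V" "braid_normals V" "braid_ray V ` proper_subsets V"
    by (rule simplicial_fan_braid)
  have upper: "braid_ray V ` upper_sets V x \<in> faces" if "x \<in> braid_space V" for x
    unfolding fan_faces_def using braid_cell[of V x] that by (auto simp: upper_sets_def)
  {
    fix W assume W: "W \<in> faces"
    then obtain x where x: "x \<in> braid_space V" "convex_cone hull W = cell x" by (auto simp: fan_faces_def)
    then have "W = braid_ray V ` upper_sets V x"
      using hull_inj[OF W upper[OF x(1)]] braid_cell(2)[of V x] by simp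
    moreover have "upper_sets V x \<in> flag_complex V"
      using upper_sets_chain[of _ V x] unfolding flag_complex_def upper_sets_def by blast
    ultimately show "W \<in> (\<lambda>C. braid_ray V ` C) ` flag_complex V" by blast
  next
    fix W assume "W \<in> (\<lambda>C. braid_ray V ` C) ` flag_complex V"
    then obtain C where CF: "C \<in> flag_complex V" and C3: "W = braid_ray V ` C" by blast
    have C: "C \<subseteq> proper_subsets V" "\<And>S T. S \<in> C \<Longrightarrow> T \<in> C \<Longrightarrow> S \<subseteq> T \<or> T \<subseteq> S"
      using CF by (simp_all add: flag_complex_def)
    define x where "x = (\<Sum>S\<in>C. braid_ray V S)"
    have xE: "x \<in> braid_space V" unfolding x_def
    proof (rule subspace_sum[OF subspace_braid_space])
      fix S assume "S \<in> C"
      then show "braid_ray V S \<in> braid_space V"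
        using C(1) by (intro braid_ray_in_space) (auto simp: proper_subsets_def)
    qed
    have "C \<subseteq> upper_sets V x"
    proof
      fix S assume S: "S \<in> C"
      have "x $ v < x $ u" if uv: "u \<in> S" "v \<in> V - S" for u v
      proof -
        have uV: "u \<in> V" "v \<in> V" using S C(1) uv by (auto simp: proper_subsets_def)
        have "x $ u - x $ v = (\<Sum>T\<in>C. indicat_real T u - indicat_real T v)"
          unfolding x_def sum_component sum_subtractf[symmetric] using braid_ray_diff[OF uV] by simp
        \<comment> \<open>In a chain, \<open>u\<close> in \<open>S\<close> and \<open>v\<close>
          outside imply that every member containing \<open>v\<close> contains \<open>u\<close>; so
          no term is negative, and the term of \<open>S\<close> is 1.\<close>
        also have "\<dots> \<ge> indicat_real S u - indicat_real S v"
        proof (rule member_le_sum[OF S])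
          fix T assume T: "T \<in> C - {S}"
          then have "S \<subseteq> T \<or> T \<subseteq> S" using C(2) S by blast
          then have "v \<in> T \<Longrightarrow> u \<in> T" using uv by blast
          then show "0 \<le> indicat_real T u - indicat_real T v" by (simp add: indicator_def)
        qed simp
        finally show ?thesis using uv by simp
      qed
      then show "S \<in> upper_sets V x" using S C(1) unfolding upper_sets_def by blast
    qed
    then have "W \<subseteq> braid_ray V ` upper_sets V x" unfolding C3 by (rule image_mono)
    then show "W \<in> faces" by (rule face_down_closed[OF upper[OF xE]])
  }
qed


section \<open>The coloring complex\<close>

lemma chain_of_blocks_Nil: "chain_of_blocks [] = {}"
  by (auto simp: chain_of_blocks_def)

lemma chain_of_blocks_snoc:
  "chain_of_blocks (Ts @ [T]) = insert (\<Union>(set Ts) \<union> T) (chain_of_blocks Ts)"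
proof (intro equalityI subsetI)
  fix S assume "S \<in> chain_of_blocks (Ts @ [T])"
  then obtain k where k: "1 \<le> k" "k \<le> Suc (length Ts)" "S = \<Union>(set (take k (Ts @ [T])))"
    by (auto simp: chain_of_blocks_def)
  show "S \<in> insert (\<Union>(set Ts) \<union> T) (chain_of_blocks Ts)"
  proof (cases "k \<le> length Ts")
    case True
    then have "S = \<Union>(set (take k Ts))" using k(3) by simp
    then show ?thesis using k(1) True unfolding chain_of_blocks_def by blast
  next
    case False
    then have "k = Suc (length Ts)" using k(2) by simp
    then have "S = \<Union>(set Ts) \<union> T" using k(3) by (simp add: Un_commute)
    then show ?thesis by simp
  qed
next
  fix S assume "S \<in> insert (\<Union>(set Ts) \<union> T) (chain_of_blocks Ts)"
  then consider "S = \<Union>(set Ts) \<union> T" | "S \<in> chain_of_blocks Ts" by blast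
  then show "S \<in> chain_of_blocks (Ts @ [T])"
  proof cases
    case 1
    have "S = \<Union>(set (take (Suc (length Ts)) (Ts @ [T])))" using 1 by (simp add: Un_commute)
    then show ?thesis unfolding chain_of_blocks_def
      by (intro CollectI exI[of _ "Suc (length Ts)"]) simp
  next
    case 2
    then obtain k where k: "1 \<le> k" "k \<le> length Ts" "S = \<Union>(set (take k Ts))"
      by (auto simp: chain_of_blocks_def)
    then have "S = \<Union>(set (take k (Ts @ [T])))" by simp
    then show ?thesis using k(1,2) unfolding chain_of_blocks_def
      by (intro CollectI exI[of _ k]) simp
  qed
qed

lemma chain_of_blocks_subset: "S \<in> chain_of_blocks Ts \<Longrightarrow> S \<subseteq> \<Union>(set Ts)"
  by (auto simp: chain_of_blocks_def dest: in_set_takeD)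

lemma ordered_blocks_snocD:
  assumes "ordered_blocks V (Ts @ [T])"
  shows "ordered_blocks V Ts" "T \<noteq> {}" "T \<subseteq> V" "T \<inter> \<Union>(set Ts) = {}" "\<Union>(set Ts) \<union> T \<noteq> V"
proof -
  have a: "\<forall>S\<in>set Ts. S \<noteq> {} \<and> S \<subseteq> V" "T \<noteq> {}" "T \<subseteq> V" "sorted_wrt disjnt Ts" "\<forall>S\<in>set Ts. disjnt S T"
    "\<Union>(set Ts) \<union> T \<noteq> V"
    using assms by (auto simp: ordered_blocks_def sorted_wrt_append Un_commute)
  show "T \<noteq> {}" "T \<subseteq> V" "\<Union>(set Ts) \<union> T \<noteq> V" by (fact a)+
  show "T \<inter> \<Union>(set Ts) = {}" using a(5) by (auto simp: disjnt_def)
  have "\<Union>(set Ts) \<noteq> V"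
  proof
    assume "\<Union>(set Ts) = V"
    then have "\<Union>(set Ts) \<union> T = V" using a(3) by blast
    then show False using a(6) by simp
  qed
  then show "ordered_blocks V Ts" unfolding ordered_blocks_def using a by blast
qed

lemma chain_of_blocks_in_flag_complex:
  "ordered_blocks V Ts \<Longrightarrow> chain_of_blocks Ts \<in> flag_complex V"
proof (induction Ts rule: rev_induct)
  case Nil
  then show ?case by (simp add: chain_of_blocks_Nil flag_complex_def)
next
  case (snoc T Ts)
  note T = ordered_blocks_snocD[OF snoc.prems]
  have IH: "chain_of_blocks Ts \<in> flag_complex V" by (rule snoc.IH[OF T(1)])
  let ?M = "\<Union>(set Ts) \<union> T"
  have "\<Union>(set Ts) \<subseteq> V" using T(1) by (auto simp: ordered_blocks_def)
  then have "?M \<in> proper_subsets V" using T(2,3,5) unfolding proper_subsets_def by blast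
  moreover have "S \<subseteq> ?M" if "S \<in> chain_of_blocks Ts" for S using chain_of_blocks_subset[OF that] by blast
  ultimately show ?case using IH unfolding chain_of_blocks_snoc flag_complex_def by simp
qed

text \<open>Induction on the length of the chain: removing the top element \<open>M\<close> leaves a
  chain with smaller union, and the difference is the last block.\<close>

lemma flag_is_chain_of_blocks:
  assumes "finite V" "V \<noteq> {}" "C \<in> flag_complex V"
  shows "\<exists>Ts. ordered_blocks V Ts \<and> chain_of_blocks Ts = C \<and> \<Union>(set Ts) = \<Union>C"
proof -
  have "C \<subseteq> Pow V" using assms(3) by (auto simp: flag_complex_def proper_subsets_def)
  then have "finite C" using assms(1) finite_subset by blast
  then show ?thesis using assms(3)
  proof (induction "card C" arbitrary: C)
    case 0
    then have "C = {}" by simp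
    \<comment> \<open>The empty list is admissible only for \<open>V\<close> nonempty, since its
      union must differ from \<open>V\<close>.\<close>
    then show ?case using assms(2)
      by (intro exI[of _ "[]"]) (simp add: ordered_blocks_def chain_of_blocks_Nil)
  next
    case (Suc n)
    have C: "C \<subseteq> proper_subsets V" and chain: "\<And>S T. S \<in> C \<Longrightarrow> T \<in> C \<Longrightarrow> S \<subseteq> T \<or> T \<subseteq> S"
      using Suc.prems(2) by (simp_all add: flag_complex_def)
    have ne: "C \<noteq> {}" using Suc.hyps(2) by auto
    have UC: "\<Union>D \<in> D" if "D \<subseteq> C" "D \<noteq> {}" for D
    proof (rule Union_in_chain[where \<A> = C])
      show "finite D" using that(1) Suc.prems(1) by (rule finite_subset)
      show "subset.chain C D" using that(1) chain unfolding subset_chain_def by blast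
    qed (rule that(2))
    define M where "M = \<Union>C"
    have M: "M \<in> C" unfolding M_def by (rule UC[OF order_refl ne])
    define C' where "C' = C - {M}"
    have "n = card C'" using Suc.hyps(2) M Suc.prems(1) by (simp add: C'_def)
    moreover have "finite C'" using Suc.prems(1) by (simp add: C'_def)
    moreover have "C' \<in> flag_complex V" using Suc.prems(2) by (auto simp: C'_def flag_complex_def)
    ultimately have "\<exists>Ts. ordered_blocks V Ts \<and> chain_of_blocks Ts = C' \<and> \<Union>(set Ts) = \<Union>C'"
      by (rule Suc.hyps(1))
    then obtain Ts where Ts: "ordered_blocks V Ts" "chain_of_blocks Ts = C'" "\<Union>(set Ts) = \<Union>C'" by (elim exE conjE) (rule that)
    have sub: "\<Union>C' \<subset> M"
    proof (cases "C' = {}")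
      case True
      have "M \<noteq> {}" using M C by (auto simp: proper_subsets_def)
      then show ?thesis using True by auto
    next
      case False
      then have "\<Union>C' \<in> C'" by (intro UC) (auto simp: C'_def)
      then have "\<Union>C' \<noteq> M" by (auto simp: C'_def)
      moreover have "\<Union>C' \<subseteq> M" by (auto simp: C'_def M_def)
      ultimately show ?thesis by blast
    qed
    define T where "T = M - \<Union>C'"
    have MV: "M \<subset> V" using M C by (auto simp: proper_subsets_def)
    have UM: "\<Union>C' \<union> T = M" using sub by (auto simp: T_def)
    have "ordered_blocks V (Ts @ [T])"
      unfolding ordered_blocks_def
    proof (intro conjI ballI)
      fix S assume "S \<in> set (Ts @ [T])"
      then have "S \<in> set Ts \<or> S = T" by auto
      then show "S \<noteq> {}" "S \<subseteq> V"
        using Ts(1) sub MV unfolding ordered_blocks_def T_def by blast+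
    next
      have "disjnt S T" if "S \<in> set Ts" for S
        using that Ts(3) unfolding T_def disjnt_def by blast
      then show "sorted_wrt disjnt (Ts @ [T])"
        using Ts(1) by (simp add: ordered_blocks_def sorted_wrt_append)
      have "\<Union>(set (Ts @ [T])) = M" using UM Ts(3) by (simp add: Un_commute)
      then show "\<Union>(set (Ts @ [T])) \<noteq> V" using MV by blast
    qed
    moreover have "chain_of_blocks (Ts @ [T]) = C"
      unfolding chain_of_blocks_snoc Ts(2,3) UM using M by (auto simp: C'_def)
    moreover have "\<Union>(set (Ts @ [T])) = \<Union>C" using UM Ts(3) by (simp add: Un_commute M_def)
    ultimately show ?case by blast
  qed
qed

text \<open>Two points lie in a common block, the final remainder included, iff no partial union
  separates them. Appending a block splits the old remainder in two, and the new partial union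
  separates exactly these two pieces.\<close>

lemma unseparated_iff_in_block:
  assumes "ordered_blocks V Ts" "u \<in> V" "v \<in> V"
  shows "(\<exists>T\<in>insert (V - \<Union>(set Ts)) (set Ts). {u, v} \<subseteq> T) \<longleftrightarrow>
    (\<forall>S\<in>chain_of_blocks Ts. u \<in> S \<longleftrightarrow> v \<in> S)"
  using assms(1)
proof (induction Ts rule: rev_induct)
  case Nil
  then show ?case using assms(2,3) by (simp add: chain_of_blocks_Nil)
next
  case (snoc T Ts)
  note T = ordered_blocks_snocD[OF snoc.prems]
  let ?U = "\<Union>(set Ts)"
  have IH: "((u \<notin> ?U \<and> v \<notin> ?U) \<or> (\<exists>T\<in>set Ts. u \<in> T \<and> v \<in> T)) \<longleftrightarrow> (\<forall>S\<in>chain_of_blocks Ts. u \<in> S \<longleftrightarrow> v \<in> S)"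
    using snoc.IH[OF T(1)] assms(2,3) by simp
  have "(\<exists>T\<in>insert (V - \<Union>(set (Ts @ [T]))) (set (Ts @ [T])). {u, v} \<subseteq> T) \<longleftrightarrow>
      (u \<notin> ?U \<union> T \<and> v \<notin> ?U \<union> T) \<or> (u \<in> T \<and> v \<in> T) \<or> (\<exists>T\<in>set Ts. u \<in> T \<and> v \<in> T)"
    using assms(2,3) by auto
  also have "\<dots> \<longleftrightarrow> ((u \<notin> ?U \<and> v \<notin> ?U) \<or> (\<exists>T\<in>set Ts. u \<in> T \<and> v \<in> T)) \<and> (u \<in> ?U \<union> T \<longleftrightarrow> v \<in> ?U \<union> T)"
    using T(4) by blast
  also have "\<dots> \<longleftrightarrow> (\<forall>S\<in>chain_of_blocks (Ts @ [T]). u \<in> S \<longleftrightarrow> v \<in> S)"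
    unfolding chain_of_blocks_snoc IH ball_simps by (rule conj_commute)
  finally show ?case .
qed

lemma simple_graph_edgeE:
  assumes "simple_graph V E" "e \<in> E"
  obtains u v where "u \<in> V" "v \<in> V" "u \<noteq> v" "e = {u, v}"
proof -
  have "card e = 2" "e \<subseteq> V" using assms by (auto simp: simple_graph_def)
  then obtain u v where "e = {u, v}" "u \<noteq> v" by (meson card_2_iff)
  then show ?thesis using that \<open>e \<subseteq> V\<close> by blast
qed

lemma coloring_complex_eq:
  assumes G: "simple_graph V E" and E: "E \<noteq> {}"
  shows "coloring_complex V E = {C \<in> flag_complex V. \<exists>e\<in>E. \<forall>S\<in>C. e \<subseteq> S \<or> e \<inter> S = {}}"
proof -
  have block: "(\<exists>T\<in>insert (V - \<Union>(set Ts)) (set Ts). e \<subseteq> T) \<longleftrightarrow> (\<forall>S\<in>chain_of_blocks Ts. e \<subseteq> S \<or> e \<inter> S = {})"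
    if Ts: "ordered_blocks V Ts" and e: "e \<in> E" for Ts e
  proof -
    obtain u v where uv: "u \<in> V" "v \<in> V" "u \<noteq> v" "e = {u, v}" using simple_graph_edgeE[OF G e] .
    have "(e \<subseteq> S \<or> e \<inter> S = {}) \<longleftrightarrow> (u \<in> S \<longleftrightarrow> v \<in> S)" for S unfolding uv(4) by blast
    then show ?thesis using unseparated_iff_in_block[OF Ts uv(1,2)] uv(4) by simp
  qed
  obtain e0 where e0: "e0 \<in> E" using E by blast
  obtain u0 where "u0 \<in> V" using simple_graph_edgeE[OF G e0] .
  then have V: "finite V" "V \<noteq> {}" using G by (auto simp: simple_graph_def)
  show ?thesis
  proof (intro equalityI subsetI)
    fix C assume "C \<in> coloring_complex V E"
    then consider "C = {}" | Ts T e where "C = chain_of_blocks Ts" "ordered_blocks V Ts"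
        "T \<in> insert (V - \<Union>(set Ts)) (set Ts)" "e \<in> E" "e \<subseteq> T"
      unfolding coloring_complex_def by blast
    then show "C \<in> {C \<in> flag_complex V. \<exists>e\<in>E. \<forall>S\<in>C. e \<subseteq> S \<or> e \<inter> S = {}}"
    proof cases
      case 1
      then show ?thesis using e0 by (auto simp: flag_complex_def)
    next
      case 2
      have "C \<in> flag_complex V" using 2(1) chain_of_blocks_in_flag_complex[OF 2(2)] by simp
      moreover have "\<forall>S\<in>C. e \<subseteq> S \<or> e \<inter> S = {}" using block[OF 2(2,4)] 2(1,3,5) by blast
      ultimately show ?thesis using 2(4) by blast
    qed
  next
    fix C assume "C \<in> {C \<in> flag_complex V. \<exists>e\<in>E. \<forall>S\<in>C. e \<subseteq> S \<or> e \<inter> S = {}}"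
    then obtain e where C: "C \<in> flag_complex V" and e: "e \<in> E" "\<forall>S\<in>C. e \<subseteq> S \<or> e \<inter> S = {}" by blast
    obtain Ts where Ts: "ordered_blocks V Ts" "chain_of_blocks Ts = C"
      using flag_is_chain_of_blocks[OF V C] by (elim exE conjE) (rule that)
    have "\<exists>T\<in>insert (V - \<Union>(set Ts)) (set Ts). e \<subseteq> T" using block[OF Ts(1) e(1)] Ts(2) e(2) by simp
    then have "\<exists>T\<in>insert (V - \<Union>(set Ts)) (set Ts). \<exists>e\<in>E. e \<subseteq> T" using e(1) by blast
    then show "C \<in> coloring_complex V E" unfolding coloring_complex_def
      by (intro insertI2 CollectI exI[of _ Ts] conjI Ts(1) Ts(2)[symmetric])
  qed
qed

theorem coloring_complex_convex_ear_decomposition: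
  fixes V :: "'v::finite set"
  assumes G: "simple_graph V E"
  shows "has_convex_ear_decomposition TYPE(real ^ 'v) (coloring_complex V E)"
proof (cases "E = {}")
  case True
  then have "coloring_complex V E = {{}}" by (simp add: coloring_complex_def)
  then show ?thesis using has_convex_ear_decomposition_trivial by simp
next
  case False
  have edge: "\<exists>p. fst p \<in> V \<and> snd p \<in> V \<and> fst p \<noteq> snd p \<and> e = {fst p, snd p}" if e: "e \<in> E" for e
  proof -
    obtain u v where "u \<in> V" "v \<in> V" "u \<noteq> v" "e = {u, v}" using simple_graph_edgeE[OF G e] .
    then show ?thesis by (intro exI[of _ "(u, v)"]) simp
  qed
  then obtain p where p: "\<And>e. e \<in> E \<Longrightarrow> fst (p e) \<in> V \<and> snd (p e) \<in> V \<and> fst (p e) \<noteq> snd (p e) \<and> e = {fst (p e), snd (p e)}"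
    by metis
  define n :: "'v set \<Rightarrow> real ^ 'v" where "n e = axis (fst (p e)) 1 - axis (snd (p e)) 1" for e
  let ?g = "braid_ray V"
  interpret simplicial_fan "braid_space V" "braid_normals V" "?g ` proper_subsets V"
    by (rule simplicial_fan_braid)
  have ng: "n e \<bullet> ?g S = indicat_real S (fst (p e)) - indicat_real S (snd (p e))" if "e \<in> E" for e S
    unfolding n_def inner_axis_diff using braid_ray_diff p[OF that] by blast
  have sep: "n e \<bullet> ?g S = 0 \<longleftrightarrow> e \<subseteq> S \<or> e \<inter> S = {}" if e: "e \<in> E" for e S
  proof -
    have "n e \<bullet> ?g S = 0 \<longleftrightarrow> (fst (p e) \<in> S \<longleftrightarrow> snd (p e) \<in> S)"
      unfolding ng[OF e] by (simp add: indicator_def)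
    also have "\<dots> \<longleftrightarrow> {fst (p e), snd (p e)} \<subseteq> S \<or> {fst (p e), snd (p e)} \<inter> S = {}" by blast
    also have "{fst (p e), snd (p e)} = e" using p[OF e] by blast
    finally show ?thesis .
  qed
  have single: "{w} \<subseteq> V" "V \<noteq> {}" if "w \<in> e" "e \<in> E" for w e
    using that G by (auto simp: simple_graph_def)
  let ?K = "{W \<in> faces. \<exists>b\<in>n ` E. W \<subseteq> {x. b \<bullet> x = 0}}"
  have ced: "has_convex_ear_decomposition TYPE(real ^ 'v) ?K"
  proof (rule has_convex_ear_decomposition_faces_in_hyperplanes)
    show "n ` E \<noteq> {}" using False by simp
    show "n ` E \<subseteq> braid_normals V"
    proof
      fix b assume "b \<in> n ` E"
      then obtain e where e: "e \<in> E" "b = n e" by blast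
      have "fst (p e) \<in> V" "snd (p e) \<in> V" using p[OF e(1)] by blast+
      then show "b \<in> braid_normals V" unfolding braid_normals_def e(2) n_def by blast
    qed
    show "\<exists>x\<in>braid_space V. b \<bullet> x \<noteq> 0" if "b \<in> n ` E" for b
    proof -
      obtain e where e: "e \<in> E" "b = n e" using \<open>b \<in> n ` E\<close> by blast
      have pe: "fst (p e) \<in> e" "fst (p e) \<noteq> snd (p e)" using p[OF e(1)] by blast+
      have "?g {fst (p e)} \<in> braid_space V" by (rule braid_ray_in_space[OF single[OF pe(1) e(1)]])
      moreover have "b \<bullet> ?g {fst (p e)} \<noteq> 0" unfolding e(2) ng[OF e(1)] using pe(2) by simp
      ultimately show ?thesis by blast
    qed
    show "\<exists>x\<in>braid_space V. b \<bullet> x = 0 \<and> c \<bullet> x \<noteq> 0" if bc: "b \<in> n ` E" "c \<in> n ` E" "b \<noteq> c" for b c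
    proof -
      obtain e f where e: "e \<in> E" "b = n e" and f: "f \<in> E" "c = n f" using bc(1,2) by blast
      \<comment> \<open>Edges have equal size, so some \<open>w\<close> in \<open>f\<close> is not
        in \<open>e\<close>. The ray of \<open>{w}\<close> is orthogonal to \<open>n e\<close>, as
        \<open>e\<close> misses \<open>{w}\<close>, but not to \<open>n f\<close>, as
        \<open>{w}\<close> separates the ends of \<open>f\<close>.\<close>
      have "e \<noteq> f" using bc(3) e(2) f(2) by blast
      moreover have "finite e" "card e = card f" using G e(1) f(1) card.infinite by (fastforce simp: simple_graph_def)+
      ultimately have "\<not> f \<subseteq> e" using card_subset_eq by metis
      then obtain w where w: "w \<in> f" "w \<notin> e" by blast
      have cf: "card f = 2" using G f(1) by (simp add: simple_graph_def)
      have "?g {w} \<in> braid_space V" by (rule braid_ray_in_space[OF single[OF w(1) f(1)]])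
      moreover have "n e \<bullet> ?g {w} = 0" using sep[OF e(1), of "{w}"] w(2) by simp
      moreover have "n f \<bullet> ?g {w} \<noteq> 0"
      proof
        assume "n f \<bullet> ?g {w} = 0"
        then have "f \<subseteq> {w}" using sep[OF f(1), of "{w}"] w(1) by blast
        then have "card f \<le> 1" using card_mono[of "{w}" f] by simp
        then show False using cf by simp
      qed
      ultimately show ?thesis using e(2) f(2) by blast
    qed
  qed
  \<comment> \<open>\<open>h\<close> turns the rays back into subsets of \<open>V\<close>, the
    vertices of the coloring complex.\<close>
  define h where "h = inv_into (proper_subsets V) ?g"
  have hg: "h ` ?g ` C = C" if "C \<subseteq> proper_subsets V" for C
    unfolding h_def by (rule inv_into_image_cancel[OF inj_on_braid_ray that])
  have K: "?K = (\<lambda>C. ?g ` C) ` coloring_complex V E"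
  proof -
    have iff: "(\<exists>b\<in>n ` E. ?g ` C \<subseteq> {x. b \<bullet> x = 0}) \<longleftrightarrow> (\<exists>e\<in>E. \<forall>S\<in>C. e \<subseteq> S \<or> e \<inter> S = {})" for C
    proof -
      have "?g ` C \<subseteq> {x. n e \<bullet> x = 0} \<longleftrightarrow> (\<forall>S\<in>C. e \<subseteq> S \<or> e \<inter> S = {})" if "e \<in> E" for e
        using sep[OF that] by (simp add: image_subset_iff)
      then show ?thesis by simp
    qed
    have "?K = (\<lambda>C. ?g ` C) ` {C \<in> flag_complex V. \<exists>b\<in>n ` E. ?g ` C \<subseteq> {x. b \<bullet> x = 0}}"
      unfolding braid_faces by blast
    then show ?thesis unfolding iff coloring_complex_eq[OF G False] .
  qed
  have sub: "C \<subseteq> proper_subsets V" if "C \<in> coloring_complex V E" for C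
    using that unfolding coloring_complex_eq[OF G False] flag_complex_def by blast
  have "inj_on h (\<Union>?K)"
  proof (rule inj_on_subset)
    show "inj_on h (?g ` proper_subsets V)" unfolding h_def by (rule inj_on_inv_into) simp
    show "\<Union>?K \<subseteq> ?g ` proper_subsets V" using sub unfolding K by blast
  qed
  then have "has_convex_ear_decomposition TYPE(real ^ 'v) (relabel h ?K)"
    using ced by (rule relabel_has_convex_ear_decomposition)
  moreover have "relabel h ?K = coloring_complex V E"
  proof -
    have "relabel h ?K = ((\<lambda>F. h ` F) \<circ> (\<lambda>C. ?g ` C)) ` coloring_complex V E"
      unfolding K relabel_def by (rule image_comp)
    also have "\<dots> = id ` coloring_complex V E"
      by (rule image_cong[OF refl]) (simp only: comp_apply id_apply hg[OF sub])
    finally show ?thesis by simp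
  qed
  ultimately show ?thesis by simp
qed

theorem theorem3p3:
  shows "(\<forall>(V :: 'v::finite set) E. simple_graph V E \<longrightarrow>
            has_convex_ear_decomposition TYPE(real ^ 'v) (coloring_complex V E)) \<and>
         (\<forall>(A :: (real ^ 'n) set set) B.
            arrangement A \<and> essential A \<and> central A \<and> simplicial_arrangement A \<and> B \<subseteq> A \<longrightarrow>
            has_convex_ear_decomposition TYPE(real ^ 'n) (induced_subcomplex A B))"
  using coloring_complex_convex_ear_decomposition induced_subcomplex_convex_ear_decomposition by blast

end
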